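(* The following hold for $\mathbb P$-almost every $\omega$. (a) For all $x\in\mathbb Z^2$, $\operatorname{supp}\mu_{x,x+e_1}\cap\operatorname{supp}\mu_{x,x+e_2}=\{\xi_*(T_x\omega)\}$. In particular, $\mathcal V^\omega\supset\{\xi_*(T_x\omega):x\in\mathbb Z^2\}$. (b) Assume the jump process condition: there exists an event of full $\mathbb P$-probability on which, for all $x,y\in\mathbb Z^2$, every point of $\operatorname{supp}\mu_{x,y}$ is isolated. Then $\mathcal V^\omega=\{\xi_*(T_x\omega):x\in\mathbb Z^2\}$.
   Context: Directions. $e_1=e_+=(1,0)$, $e_2=e_-=(0,1)$, $\hat e=e_1+e_2$. $\mathcal U=\{te_1+(1-t)e_2:0\le t\le1\}$, $\operatorname{ri}\mathcal U=\mathcal U\setminus\{e_1,e_2\}$. For $\zeta,\eta\in\mathbb R^2$ with $\zeta\cdot\hat e=\eta\cdot\hat e$, $\zeta\prec\eta$ (resp. $\zeta\preceq\eta$) means $\zeta\cdot e_1<\eta\cdot e_1$ (resp. $\le$). Intervals $[\zeta,\eta]$, $]\zeta,\eta[$ etc. in $\mathcal U$ and monotone limits $\zeta\nearrow\xi$, $\zeta\searrow\xi$ refer to this order. Vector inequalities $x\le y$, $x<y$ are coordinatewise. $\sigma$ denotes a sign in $\{-,+\}$. Last-passage percolation. $(\Omega,\mathcal F,\mathbb P)$ is a Polish probability space with a group $\{T_x\}_{x\in\mathbb Z^2}$ of measurable $\mathbb P$-preserving bijections ($T_0=$ identity, $T_xT_y=T_{x+y}$) and real random variables (weights) $\omega_x$,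 $x\in\mathbb Z^2$, with $\omega_y(T_x\omega)=\omega_{x+y}(\omega)$, that are i.i.d. with continuous distribution, positive variance, and $\mathbb E|\omega_0|^p<\infty$ for some $p>2$. An up-right path has steps in $\{e_1,e_2\}$ and is indexed so that $\pi_k\cdot\hat e=k$. For $x\le y$, $k=x\cdot\hat e$, $m=y\cdot\hat e$, $G_{x,y}=\max\sum_{i=k}^{m-1}\omega_{\pi_i}$ over up-right paths from $x$ to $y$. The shape function is the deterministic, concave, symmetric, 1-homogeneous $g:\mathbb R_+^2\to\mathbb R$ with a.s. $\lim_n\max_{x\in\mathbb Z_+^2,|x|_1=n}|G_{0,x}-g(x)|/n=0$. For $\xi\in\operatorname{ri}\mathcal U$: $\nabla g(\xi\pm)\cdot e_1=\lim_{\varepsilon\searrow0}\frac{g(\xi\pm\varepsilon e_1)-g(\xi)}{\pm\varepsilon}$, $\nabla g(\xi\pm)\cdot e_2=\lim_{\varepsilon\searrow0}\frac{g(\xi\mp\varepsilon e_2)-g(\xi)}{\mp\varepsilon}$. $\mathcal D=\{\xi\in\operatorname{ri}\mathcal U: g\text{ differentiable at }\xi\}$. $\mathcal U_{\xi\sigma}=\{\zeta\in\operatorname{ri}\mathcal U:g(\zeta)-g(\xi)=\nabla g(\xi\sigma)\cdot(\zeta-\xi)\}$, $\mathcal U_\xi=\mathcal U_{\xi-}\cup\mathcal U_{\xi+}=[\underline\xi,\overline\xi]$. Busemann process. On $\Omega$ there is a fixed family of real random variables $B^{\xi\sigma}(x,y)=B^{\xi\sigma}_{x,y}$ ($x,y\in\mathbb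 Z^2$, $\xi\in\operatorname{ri}\mathcal U$, $\sigma\in\{-,+\}$), measurable in $(x,y,\omega,\xi)$, constructed in earlier work, with these properties. (B1) On one $T$-invariant event of probability one, for all $x,y,z,\xi,\sigma$: $B^{\xi\sigma}(x+z,y+z,\omega)=B^{\xi\sigma}(x,y,T_z\omega)$; $B^{\xi\sigma}(x,y)+B^{\xi\sigma}(y,z)=B^{\xi\sigma}(x,z)$; $\min_{i}B^{\xi\sigma}(x,x+e_i)=\omega_x$; for $\xi\prec\xi'$, $B^{\xi-}(x,x+e_1)\ge B^{\xi+}(x,x+e_1)\ge B^{\xi'-}(x,x+e_1)\ge B^{\xi'+}(x,x+e_1)$ and the reversed inequalities with $e_2$ in place of $e_1$; $B^{\xi-}(x,y)=\lim_{\zeta\nearrow\xi}B^{\zeta\sigma}(x,y)$ and $B^{\xi+}(x,y)=\lim_{\zeta\searrow\xi}B^{\zeta\sigma}(x,y)$; $B^{\xi\sigma}(x,x+e_i)\to\infty$ as $\xi\to e_{3-i}$. (B2) $B^{\xi\sigma}(x,y)$ is integrable and $\mathbb E[B^{\xi\sigma}(x,x+e_i)]=\nabla g(\xi\sigma)\cdot e_i$. (B3) If $\nabla g(\zeta\sigma)=\nabla g(\eta\sigma)$ then $B^{\zeta\sigma}\equiv B^{\eta\sigma}$. (B4) For any $I\subset\mathbb Z^2$, $\{(\omega_x,B^{\xi\sigma}(x,y)):x\in I,y\ge x,\sigma,\xi\}$ is independent of $\{\omega_x: x\not\ge z\ \forall z\in I\}$. (B5) For each fixed $\xi$, a.s.: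 $B^{\xi\sigma}(x,x+e_1)\ne B^{\xi\sigma}(x,x+e_2)$ for all $x,\sigma$; $n^{-1}\max_{x\in\mathbb Z_+^2,|x|_1=n}|B^{\xi\sigma}(0,x)-x\cdot\nabla g(\xi\sigma)|\to0$; if $\xi\in\mathcal D$ then $B^{\xi+}=B^{\xi-}$; if $\xi,\underline\xi,\overline\xi\in\mathcal D$ then $B^{\xi\pm}(x,y)=\lim_n(G_{x,v_n}-G_{y,v_n})$ whenever $|v_n|\to\infty$, $v_n/n\to\xi$. Competition interface direction. $\xi_*(\omega)\in\operatorname{ri}\mathcal U$ is the (a.s. existing and unique) direction such that $B^{\zeta\pm}(e_1,e_2)<0$ if $\zeta\prec\xi_*(\omega)$ and $B^{\zeta\pm}(e_1,e_2)>0$ if $\zeta\succ\xi_*(\omega)$. Busemann measures. For $x,y\in\mathbb Z^2$ and a compact interval $K\subset\operatorname{ri}\mathcal U$, $\mu^K_{x,y}$ is the signed measure on $K$ with $\mu^K_{x,y}(]\zeta,\eta])=B^{\eta+}_{x,y}-B^{\zeta+}_{x,y}$ and $\mu^K_{x,y}([\zeta,\eta[)=B^{\eta-}_{x,y}-B^{\zeta-}_{x,y}$ for $\zeta\prec\eta$, $[\zeta,\eta]\subset K$. $\operatorname{supp}\mu_{x,y}=\bigcup_{\zeta\prec\eta\text{ in }\operatorname{ri}\mathcal U}\operatorname{supp}\mu^{[\zeta,\eta]}_{x,y}$, where the support of a signed measure is the smallest closed set whose complement has zero total variation measure. $\mathcal V^\omega=\bigcup_{x,y\in\mathbb Z^2}\operatorname{supp}\mu_{x,y}\subset\operatorname{ri}\mathcal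 U$. *)

theory Defs
  imports "HOL-Probability.Probability"
begin

section \<open>Lattice, directions and their order\<close>

type_synonym site = "int \<times> int"
type_synonym dir = "real \<times> real"

datatype sign = Minus | Plus

definition sgn_val :: "sign \<Rightarrow> real" where
  "sgn_val \<sigma> = (case \<sigma> of Minus \<Rightarrow> - 1 | Plus \<Rightarrow> 1)"

definition e1 :: "'a::zero_neq_one \<times> 'a" where "e1 = (1, 0)"
definition e2 :: "'a::zero_neq_one \<times> 'a" where "e2 = (0, 1)"
definition ehat :: dir where "ehat = e1 + e2"

definition level :: "site \<Rightarrow> int" where
  "level x = fst x + snd x"

definition rvec :: "site \<Rightarrow> dir" where
  "rvec x = (of_int (fst x), of_int (snd x))"

definition dirs :: "dir set" where
  "dirs = {t *\<^sub>R e1 + (1 - t) *\<^sub>R e2 | t. 0 \<le> t \<and> t \<le> 1}"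

definition ri_dirs :: "dir set" where
  "ri_dirs = dirs - {e1, e2}"

definition dir_less :: "dir \<Rightarrow> dir \<Rightarrow> bool" (infix "\<prec>" 50) where
  "\<zeta> \<prec> \<eta> \<longleftrightarrow> \<zeta> \<bullet> ehat = \<eta> \<bullet> ehat \<and> \<zeta> \<bullet> e1 < \<eta> \<bullet> e1"

definition dir_le :: "dir \<Rightarrow> dir \<Rightarrow> bool" (infix "\<preceq>" 50) where
  "\<zeta> \<preceq> \<eta> \<longleftrightarrow> \<zeta> \<bullet> ehat = \<eta> \<bullet> ehat \<and> \<zeta> \<bullet> e1 \<le> \<eta> \<bullet> e1"

definition dir_cc :: "dir \<Rightarrow> dir \<Rightarrow> dir set" where
  "dir_cc \<zeta> \<eta> = {\<xi> \<in> dirs. \<zeta> \<preceq> \<xi> \<and> \<xi> \<preceq> \<eta>}"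

definition dir_oc :: "dir \<Rightarrow> dir \<Rightarrow> dir set" where
  "dir_oc \<zeta> \<eta> = {\<xi> \<in> dirs. \<zeta> \<prec> \<xi> \<and> \<xi> \<preceq> \<eta>}"

definition dir_co :: "dir \<Rightarrow> dir \<Rightarrow> dir set" where
  "dir_co \<zeta> \<eta> = {\<xi> \<in> dirs. \<zeta> \<preceq> \<xi> \<and> \<xi> \<prec> \<eta>}"

section \<open>Last-passage times and the shape function\<close>

text \<open>Only the values of \<^term>\<open>\<pi>\<close> on the levels between those of \<open>x\<close> and \<open>y\<close> matter.
  The indexing convention that \<open>\<pi> i\<close> has level \<open>i\<close> follows from the first and third
  conjuncts.\<close>

definition up_right_path :: "site \<Rightarrow> site \<Rightarrow> (int \<Rightarrow> site) \<Rightarrow> bool" where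
  "up_right_path x y \<pi> \<longleftrightarrow> \<pi> (level x) = x \<and> \<pi> (level y) = y \<and>
     (\<forall>i\<in>{level x..<level y}. \<pi> (i + 1) - \<pi> i \<in> {e1, e2})"

text \<open>Meaningful for \<open>x \<le> y\<close> coordinatewise; the set is then finite and nonempty. The weight
  of the final site \<open>y\<close> is not counted.\<close>

definition last_passage :: "(site \<Rightarrow> 'a \<Rightarrow> real) \<Rightarrow> site \<Rightarrow> site \<Rightarrow> 'a \<Rightarrow> real" where
  "last_passage w x y \<omega> =
     Max {(\<Sum>i\<in>{level x..<level y}. w (\<pi> i) \<omega>) | \<pi>. up_right_path x y \<pi>}"

definition simplex_sites :: "nat \<Rightarrow> site set" where
  "simplex_sites n = {x. 0 \<le> fst x \<and> 0 \<le> snd x \<and> \<bar>fst x\<bar> + \<bar>snd x\<bar> = int n}"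

definition grad :: "(dir \<Rightarrow> real) \<Rightarrow> dir \<Rightarrow> sign \<Rightarrow> dir" where
  "grad g \<xi> \<sigma> =
     (Lim (at_right 0) (\<lambda>\<epsilon>. (g (\<xi> + (sgn_val \<sigma> * \<epsilon>) *\<^sub>R e1) - g \<xi>) / (sgn_val \<sigma> * \<epsilon>)),
      Lim (at_right 0) (\<lambda>\<epsilon>. (g (\<xi> - (sgn_val \<sigma> * \<epsilon>) *\<^sub>R e2) - g \<xi>) / (- (sgn_val \<sigma> * \<epsilon>))))"

definition diff_dirs :: "(dir \<Rightarrow> real) \<Rightarrow> dir set" where
  "diff_dirs g = {\<xi> \<in> ri_dirs. g differentiable (at \<xi>)}"

definition lin_dirs_sgn :: "(dir \<Rightarrow> real) \<Rightarrow> dir \<Rightarrow> sign \<Rightarrow> dir set" where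
  "lin_dirs_sgn g \<xi> \<sigma> = {\<zeta> \<in> ri_dirs. g \<zeta> - g \<xi> = grad g \<xi> \<sigma> \<bullet> (\<zeta> - \<xi>)}"

definition lin_dirs :: "(dir \<Rightarrow> real) \<Rightarrow> dir \<Rightarrow> dir set" where
  "lin_dirs g \<xi> = lin_dirs_sgn g \<xi> Minus \<union> lin_dirs_sgn g \<xi> Plus"

definition lower_end :: "(dir \<Rightarrow> real) \<Rightarrow> dir \<Rightarrow> dir" where
  "lower_end g \<xi> = (THE \<zeta>. \<zeta> \<in> lin_dirs g \<xi> \<and> (\<forall>\<eta>\<in>lin_dirs g \<xi>. \<zeta> \<preceq> \<eta>))"

definition upper_end :: "(dir \<Rightarrow> real) \<Rightarrow> dir \<Rightarrow> dir" where
  "upper_end g \<xi> = (THE \<zeta>. \<zeta> \<in> lin_dirs g \<xi> \<and> (\<forall>\<eta>\<in>lin_dirs g \<xi>. \<eta> \<preceq> \<zeta>))"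

locale lpp_model = prob_space M
  for M :: "'a::polish_space measure" +
  fixes T :: "site \<Rightarrow> 'a \<Rightarrow> 'a"
    and w :: "site \<Rightarrow> 'a \<Rightarrow> real"
  assumes sets_M: "sets M = sets borel"
    and T_bij: "\<And>x. bij (T x)"
    and T_measurable: "\<And>x. T x \<in> measurable M M"
    and T_preserving: "\<And>x. distr M M (T x) = M"
    and T_zero: "T 0 = id"
    and T_add: "\<And>x y. T x \<circ> T y = T (x + y)"
    and w_measurable: "\<And>x. w x \<in> borel_measurable M"
    and w_shift: "\<And>x y \<omega>. w y (T x \<omega>) = w (x + y) \<omega>"
    and w_indep: "indep_vars (\<lambda>_. borel) w UNIV"
    and w_ident: "\<And>x. distr M borel (w x) = distr M borel (w 0)"
    and w_continuous: "\<And>r. isCont (cdf (distr M borel (w 0))) r"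
    and w_variance: "variance (w 0) > 0"
    and w_moment: "\<exists>p>2. integrable M (\<lambda>\<omega>. \<bar>w 0 \<omega>\<bar> powr p)"

text \<open>The shape function is only constrained on the closed quadrant; its values elsewhere are
  irrelevant.\<close>

locale lpp_shape = lpp_model M T w
  for M :: "'a::polish_space measure" and T w +
  fixes g :: "dir \<Rightarrow> real"
  assumes g_concave: "concave_on {p. 0 \<le> fst p \<and> 0 \<le> snd p} g"
    and g_symmetric: "\<And>a b. 0 \<le> a \<Longrightarrow> 0 \<le> b \<Longrightarrow> g (a, b) = g (b, a)"
    and g_homogeneous:
      "\<And>c p. 0 \<le> c \<Longrightarrow> 0 \<le> fst p \<Longrightarrow> 0 \<le> snd p \<Longrightarrow> g (c *\<^sub>R p) = c * g p"
    and g_shape: "AE \<omega> in M.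
      (\<lambda>n. Max ((\<lambda>x. \<bar>last_passage w 0 x \<omega> - g (rvec x)\<bar> / real n) ` simplex_sites n))
        \<longlonglongrightarrow> 0"

section \<open>The Busemann process\<close>

definition gen_sigma :: "'a measure \<Rightarrow> ('a \<Rightarrow> real) set \<Rightarrow> 'a set set" where
  "gen_sigma M F = sigma_sets (space M) {X -` S \<inter> space M | X S. X \<in> F \<and> S \<in> sets borel}"

text \<open>The arguments of \<open>B\<close> are, in this order, the direction, the sign, the two sites and the
  environment. Only directions in \<^term>\<open>ri_dirs\<close> are meaningful.\<close>

locale busemann_process = lpp_shape M T w g
  for M :: "'a::polish_space measure" and T w g +
  fixes B :: "dir \<Rightarrow> sign \<Rightarrow> site \<Rightarrow> site \<Rightarrow> 'a \<Rightarrow> real"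
  assumes B_measurable: "\<And>\<sigma>. (\<lambda>(x, y, \<omega>, \<xi>). B \<xi> \<sigma> x y \<omega>) \<in> borel_measurable
      (count_space UNIV \<Otimes>\<^sub>M (count_space UNIV \<Otimes>\<^sub>M (M \<Otimes>\<^sub>M restrict_space borel ri_dirs)))"
    and B_pathwise: "\<exists>\<Omega>\<^sub>0\<in>sets M. prob \<Omega>\<^sub>0 = 1 \<and> (\<forall>z. T z -` \<Omega>\<^sub>0 = \<Omega>\<^sub>0) \<and> (\<forall>\<omega>\<in>\<Omega>\<^sub>0.
      (\<forall>\<xi>\<in>ri_dirs. \<forall>\<sigma> x y z. B \<xi> \<sigma> (x + z) (y + z) \<omega> = B \<xi> \<sigma> x y (T z \<omega>)) \<and>
      (\<forall>\<xi>\<in>ri_dirs. \<forall>\<sigma> x y z. B \<xi> \<sigma> x y \<omega> + B \<xi> \<sigma> y z \<omega> = B \<xi> \<sigma> x z \<omega>) \<and>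
      (\<forall>\<xi>\<in>ri_dirs. \<forall>\<sigma> x. min (B \<xi> \<sigma> x (x + e1) \<omega>) (B \<xi> \<sigma> x (x + e2) \<omega>) = w x \<omega>) \<and>
      (\<forall>\<xi>\<in>ri_dirs. \<forall>\<xi>'\<in>ri_dirs. \<xi> \<prec> \<xi>' \<longrightarrow> (\<forall>x.
         B \<xi> Minus x (x + e1) \<omega> \<ge> B \<xi> Plus x (x + e1) \<omega> \<and>
         B \<xi> Plus x (x + e1) \<omega> \<ge> B \<xi>' Minus x (x + e1) \<omega> \<and>
         B \<xi>' Minus x (x + e1) \<omega> \<ge> B \<xi>' Plus x (x + e1) \<omega> \<and>
         B \<xi> Minus x (x + e2) \<omega> \<le> B \<xi> Plus x (x + e2) \<omega> \<and>
         B \<xi> Plus x (x + e2) \<omega> \<le> B \<xi>' Minus x (x + e2) \<omega> \<and>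
         B \<xi>' Minus x (x + e2) \<omega> \<le> B \<xi>' Plus x (x + e2) \<omega>)) \<and>
      (\<forall>\<xi>\<in>ri_dirs. \<forall>\<sigma> x y.
         ((\<lambda>\<zeta>. B \<zeta> \<sigma> x y \<omega>) \<longlongrightarrow> B \<xi> Minus x y \<omega>) (at \<xi> within {\<zeta>\<in>ri_dirs. \<zeta> \<prec> \<xi>}) \<and>
         ((\<lambda>\<zeta>. B \<zeta> \<sigma> x y \<omega>) \<longlongrightarrow> B \<xi> Plus x y \<omega>) (at \<xi> within {\<zeta>\<in>ri_dirs. \<xi> \<prec> \<zeta>})) \<and>
      (\<forall>\<sigma> x. filterlim (\<lambda>\<xi>. B \<xi> \<sigma> x (x + e1) \<omega>) at_top (at e2 within ri_dirs) \<and>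
             filterlim (\<lambda>\<xi>. B \<xi> \<sigma> x (x + e2) \<omega>) at_top (at e1 within ri_dirs)))"
    and B_integrable: "\<And>\<xi> \<sigma> x y. \<xi> \<in> ri_dirs \<Longrightarrow> integrable M (B \<xi> \<sigma> x y)"
    and B_mean_e1:
      "\<And>\<xi> \<sigma> x. \<xi> \<in> ri_dirs \<Longrightarrow> expectation (B \<xi> \<sigma> x (x + e1)) = grad g \<xi> \<sigma> \<bullet> e1"
    and B_mean_e2:
      "\<And>\<xi> \<sigma> x. \<xi> \<in> ri_dirs \<Longrightarrow> expectation (B \<xi> \<sigma> x (x + e2)) = grad g \<xi> \<sigma> \<bullet> e2"
    and B_grad_eq: "AE \<omega> in M. \<forall>\<zeta>\<in>ri_dirs. \<forall>\<eta>\<in>ri_dirs. \<forall>\<sigma>. grad g \<zeta> \<sigma> = grad g \<eta> \<sigma> \<longrightarrow>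
      (\<forall>x y. B \<zeta> \<sigma> x y \<omega> = B \<eta> \<sigma> x y \<omega>)"
    and B_indep: "\<And>I. indep_set
      (gen_sigma M ({w x | x. x \<in> I} \<union>
         {B \<xi> \<sigma> x y | \<xi> \<sigma> x y. \<xi> \<in> ri_dirs \<and> x \<in> I \<and> fst x \<le> fst y \<and> snd x \<le> snd y}))
      (gen_sigma M {w x | x. \<forall>z\<in>I. \<not> (fst z \<le> fst x \<and> snd z \<le> snd x)})"
    and B_noteq: "\<And>\<xi>. \<xi> \<in> ri_dirs \<Longrightarrow>
      AE \<omega> in M. \<forall>x \<sigma>. B \<xi> \<sigma> x (x + e1) \<omega> \<noteq> B \<xi> \<sigma> x (x + e2) \<omega>"
    and B_shape: "\<And>\<xi>. \<xi> \<in> ri_dirs \<Longrightarrow> AE \<omega> in M. \<forall>\<sigma>.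
      (\<lambda>n. Max ((\<lambda>x. \<bar>B \<xi> \<sigma> 0 x \<omega> - rvec x \<bullet> grad g \<xi> \<sigma>\<bar>) ` simplex_sites n) / real n)
        \<longlonglongrightarrow> 0"
    and B_diff: "\<And>\<xi>. \<xi> \<in> diff_dirs g \<Longrightarrow>
      AE \<omega> in M. \<forall>x y. B \<xi> Plus x y \<omega> = B \<xi> Minus x y \<omega>"
    and B_limit: "\<And>\<xi>. \<xi> \<in> diff_dirs g \<Longrightarrow> lower_end g \<xi> \<in> diff_dirs g \<Longrightarrow>
      upper_end g \<xi> \<in> diff_dirs g \<Longrightarrow>
      AE \<omega> in M. \<forall>v :: nat \<Rightarrow> site.
        filterlim (\<lambda>n. norm (rvec (v n))) at_top sequentially \<longrightarrow>
        (\<lambda>n. rvec (v n) /\<^sub>R real n) \<longlonglongrightarrow> \<xi> \<longrightarrow>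
        (\<forall>\<sigma> x y. (\<lambda>n. last_passage w x (v n) \<omega> - last_passage w y (v n) \<omega>)
           \<longlonglongrightarrow> B \<xi> \<sigma> x y \<omega>)"

section \<open>Competition interface direction\<close>

definition xi_star :: "(dir \<Rightarrow> sign \<Rightarrow> site \<Rightarrow> site \<Rightarrow> 'a \<Rightarrow> real) \<Rightarrow> 'a \<Rightarrow> dir" where
  "xi_star B \<omega> = (THE \<xi>. \<xi> \<in> ri_dirs \<and> (\<forall>\<zeta>\<in>ri_dirs. \<forall>\<sigma>.
     (\<zeta> \<prec> \<xi> \<longrightarrow> B \<zeta> \<sigma> e1 e2 \<omega> < 0) \<and> (\<xi> \<prec> \<zeta> \<longrightarrow> B \<zeta> \<sigma> e1 e2 \<omega> > 0)))"

section \<open>Busemann measures and their supports\<close>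

definition signed_measure :: "'b measure \<Rightarrow> ('b set \<Rightarrow> real) \<Rightarrow> bool" where
  "signed_measure N \<nu> \<longleftrightarrow> \<nu> {} = 0 \<and>
     (\<forall>A :: nat \<Rightarrow> 'b set. range A \<subseteq> sets N \<longrightarrow> disjoint_family A \<longrightarrow>
        (\<lambda>n. \<nu> (A n)) sums \<nu> (\<Union>n. A n))"

definition total_variation :: "'b measure \<Rightarrow> ('b set \<Rightarrow> real) \<Rightarrow> 'b set \<Rightarrow> ennreal" where
  "total_variation N \<nu> A =
     (SUP P \<in> {P. finite P \<and> P \<subseteq> sets N \<and> partition_on A P}. \<Sum>S\<in>P. ennreal \<bar>\<nu> S\<bar>)"

text \<open>Support of a signed measure on the Borel sets of a closed set \<open>K\<close>. By second countability
  this intersection is itself a closed set with null complement, hence the smallest such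
  set.\<close>

definition signed_support ::
    "'b::second_countable_topology set \<Rightarrow> ('b set \<Rightarrow> real) \<Rightarrow> 'b set" where
  "signed_support K \<nu> =
     \<Inter> {C. closed C \<and> C \<subseteq> K \<and> total_variation (restrict_space borel K) \<nu> (K - C) = 0}"

text \<open>The condition that \<open>\<nu>\<close> vanishes on non-measurable sets only serves to make the set
  function unique.\<close>

definition busemann_measure ::
    "(dir \<Rightarrow> sign \<Rightarrow> site \<Rightarrow> site \<Rightarrow> 'a \<Rightarrow> real) \<Rightarrow> site \<Rightarrow> site \<Rightarrow> 'a \<Rightarrow> dir set \<Rightarrow> dir set \<Rightarrow> real"
  where
  "busemann_measure B x y \<omega> K = (THE \<nu>.
     signed_measure (restrict_space borel K) \<nu> \<and>
     (\<forall>A. A \<notin> sets (restrict_space borel K) \<longrightarrow> \<nu> A = 0) \<and>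
     (\<forall>\<zeta>\<in>ri_dirs. \<forall>\<eta>\<in>ri_dirs. \<zeta> \<prec> \<eta> \<longrightarrow> dir_cc \<zeta> \<eta> \<subseteq> K \<longrightarrow>
        \<nu> (dir_oc \<zeta> \<eta>) = B \<eta> Plus x y \<omega> - B \<zeta> Plus x y \<omega> \<and>
        \<nu> (dir_co \<zeta> \<eta>) = B \<eta> Minus x y \<omega> - B \<zeta> Minus x y \<omega>))"

definition supp_mu ::
    "(dir \<Rightarrow> sign \<Rightarrow> site \<Rightarrow> site \<Rightarrow> 'a \<Rightarrow> real) \<Rightarrow> site \<Rightarrow> site \<Rightarrow> 'a \<Rightarrow> dir set" where
  "supp_mu B x y \<omega> = (\<Union>(\<zeta>, \<eta>) \<in> {(\<zeta>, \<eta>). \<zeta> \<in> ri_dirs \<and> \<eta> \<in> ri_dirs \<and> \<zeta> \<prec> \<eta>}.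
     signed_support (dir_cc \<zeta> \<eta>) (busemann_measure B x y \<omega> (dir_cc \<zeta> \<eta>)))"

definition exceptional_dirs ::
    "(dir \<Rightarrow> sign \<Rightarrow> site \<Rightarrow> site \<Rightarrow> 'a \<Rightarrow> real) \<Rightarrow> 'a \<Rightarrow> dir set" where
  "exceptional_dirs B \<omega> = (\<Union>x. \<Union>y. supp_mu B x y \<omega>)"

definition jump_process_condition ::
    "'a measure \<Rightarrow> (dir \<Rightarrow> sign \<Rightarrow> site \<Rightarrow> site \<Rightarrow> 'a \<Rightarrow> real) \<Rightarrow> bool" where
  "jump_process_condition M B \<longleftrightarrow> (\<exists>\<Omega>\<^sub>1\<in>sets M. measure M \<Omega>\<^sub>1 = 1 \<and>
     (\<forall>\<omega>\<in>\<Omega>\<^sub>1. \<forall>x y. \<forall>\<xi>\<in>supp_mu B x y \<omega>. \<xi> isolated_in supp_mu B x y \<omega>))"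

end

theory Submission
  imports Defs
begin

text \<open>
Part (a) is pathwise. The increment \<open>B(x + e1, x + e2)\<close> is nondecreasing in the direction and
changes sign at \<open>\<xi>\<^sub>*(T x \<omega>)\<close>, so by recovery the increment along \<open>e2\<close> is frozen at \<open>\<omega> x\<close> below this
direction and the one along \<open>e1\<close> above it, while each is strictly larger on the other side.

For part (b) no coalescence of geodesics is needed. A jump at \<open>\<xi>\<close> is a conserved flow across
lattice edges, which splits, going south-west, exactly at the sites \<open>x\<close> with
\<open>\<xi>\<^sub>*(T x \<omega>) = \<xi>\<close>. Mass conservation and stationarity give recurrence: almost surely a jump
direction attained by some site is also attained by sites of arbitrarily high level. Suppose that an
isolated jump direction is attained by no site. On a fixed antidiagonal, \<open>B\<^sup>\<xi>\<^sup>-\<close> and \<open>B\<^sup>\<xi>\<^sup>+\<close> are two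
boundary profiles for the same last-passage recursion, and if the weights below take two close values
\<open>a < b\<close> of the support, some configuration makes the two profiles disagree about the first step of a
geodesic, that is, it makes the jump split. Weights below the antidiagonal are independent of the
Busemann functions above, so such a split happens with positive probability, contradicting recurrence.
\<close>

section \<open>Last-passage values with two boundary profiles\<close>

text \<open>The jump direction is random, while the absence of ties and the sublinear growth of
  increments hold almost surely for one fixed direction at a time. The event that an unattained jump
  would produce is therefore phrased with rational directions, integers and a finite set only
  (\<open>fresh_split\<close>). This leaves countably many events, each measurable with respect to
  data at level \<open>k\<close> and above, and each is shown to be null. The values a < b have to
  be close because the jump size h has no lower bound: changing one row of weights moves a
  difference of two last-passage values by at most 2(b - a), and b - a < h/2 keeps this below h.
  Continuity of the weight distribution enters here, since an atomless law has support points
  arbitrarily close together. Exact values have probability zero, so the split is required with a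
  margin, which the Lipschitz dependence on the weights absorbs. Isolation makes increments constant
  on each side of the jump, so that two rationals can stand for the one-sided limits. Since Busemann
  measures are given by a definite description, existence and uniqueness on each compact interval
  come before any statement about supports.\<close>

primrec lpv :: "(nat \<Rightarrow> int \<Rightarrow> real) \<Rightarrow> (int \<Rightarrow> real) \<Rightarrow> nat \<Rightarrow> int \<Rightarrow> real" where
  "lpv u f 0 p = f p"
| "lpv u f (Suc j) p = u j p + max (lpv u f j p) (lpv u f j (p + 1))"

lemma lpv_add_const: "lpv u (\<lambda>p. f p + c) j p = lpv u f j p + c"
  by (induction j arbitrary: p) auto

text \<open>Paths from position \<open>p\<close> of row \<open>j\<close> only visit this triangle.
  Later this allows a configuration to be cut down to finitely many places.\<close>

lemma lpv_cong:
  assumes "\<And>i t. i < j \<Longrightarrow> p \<le> t \<Longrightarrow> t \<le> p + int j \<Longrightarrow> u i t = u' i t"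
    and "\<And>t. p \<le> t \<Longrightarrow> t \<le> p + int j \<Longrightarrow> f t = f' t"
  shows "lpv u f j p = lpv u' f' j p"
  using assms
proof (induction j arbitrary: p)
  case 0
  then show ?case by simp
next
  case (Suc j)
  have "lpv u f j p = lpv u' f' j p" "lpv u f j (p + 1) = lpv u' f' j (p + 1)"
    by (rule Suc.IH; rule Suc.prems; simp)+
  with Suc.prems(1)[of j p] show ?case by simp
qed

text \<open>A maximum is 1-Lipschitz in the supremum norm and each row is passed once. Separate
  bounds per row allow a single row to be changed.\<close>

lemma lpv_lipschitz:
  assumes "\<And>i t. i < j \<Longrightarrow> p \<le> t \<Longrightarrow> t \<le> p + int j \<Longrightarrow> \<bar>u i t - u' i t\<bar> \<le> d i"
  shows "\<bar>lpv u f j p - lpv u' f j p\<bar> \<le> (\<Sum>i<j. d i)"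
  using assms
proof (induction j arbitrary: p)
  case 0
  then show ?case by simp
next
  case (Suc j)
  have "\<bar>lpv u f j p - lpv u' f j p\<bar> \<le> (\<Sum>i<j. d i)"
    and "\<bar>lpv u f j (p + 1) - lpv u' f j (p + 1)\<bar> \<le> (\<Sum>i<j. d i)"
    by (rule Suc.IH; rule Suc.prems; simp)+
  moreover have "\<bar>u j p - u' j p\<bar> \<le> d j"
    by (rule Suc.prems) auto
  ultimately show ?case
    by (auto simp: max_def abs_if split: if_splits)
qed

text \<open>The difference of the two maxima over \<open>p\<close> and \<open>p + 1\<close> lies
  between the differences of the profiles at \<open>p + 1\<close> and at \<open>p\<close>, so the
  new differences interlace with the old ones.\<close>

lemma lpv_diff_antimono:
  assumes "\<And>p. f1 (p + 1) - f2 (p + 1) \<le> f1 p - f2 p"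
  shows "lpv u f1 j (p + 1) - lpv u f2 j (p + 1) \<le> lpv u f1 j p - lpv u f2 j p"
proof (induction j arbitrary: p)
  case 0
  then show ?case using assms by simp
next
  case (Suc j)
  from Suc[of p] Suc[of "p + 1"] show ?case
    by (auto simp: max_def)
qed

text \<open>If no configuration separates the profiles, then the boundary between the sites whose geodesic
  ends left and right of the jump is a staircase \<open>pos\<close> that does not depend on \<open>u\<close>. Putting \<open>b\<close> on one
  side and \<open>a\<close> on the other shifts the balance linearly in \<open>j\<close>, which the sublinear increments of
  \<open>f1\<close> cannot compensate.\<close>

lemma two_colour_paths:
  fixes f1 f2 :: "int \<Rightarrow> real"
  assumes anti: "\<And>p. f1 (p + 1) - f2 (p + 1) \<le> f1 p - f2 p"
    and jump: "f1 (p0 + 1) - f2 (p0 + 1) + h \<le> f1 p0 - f2 p0"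
    and ab: "a < b" "2 * (b - a) < h"
    and sublin: "\<And>\<epsilon>. \<epsilon> > 0 \<Longrightarrow> \<exists>C. \<forall>p. \<bar>f1 (p + 1) - f1 p\<bar> \<le> C + \<epsilon> * \<bar>real_of_int p\<bar>"
  shows "\<exists>u j p. (\<forall>i t. u i t \<in> {a, b}) \<and> lpv u f1 j (p + 1) < lpv u f1 j p \<and>
           lpv u f2 j p < lpv u f2 j (p + 1)"
proof (rule ccontr)
  assume "\<not> ?thesis"
  then have NS: "lpv u f2 j (p + 1) \<le> lpv u f2 j p"
    if "\<And>i t. u i t \<in> {a, b}" "lpv u f1 j (p + 1) < lpv u f1 j p" for u j p
    using that by (meson not_le)
  \<comment> \<open>In row \<open>j\<close> the jump lies between \<open>pos j\<close> and
    \<open>pos j + 1\<close> (see \<open>gap\<close>). The constant weight \<open>a\<close> is one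
    choice among many: by \<open>unif\<close> the comparison is the same for all weights with values
    a, b.\<close>
  define pos where "pos = rec_nat p0 (\<lambda>j l. if lpv (\<lambda>_ _. a) f1 j (l + 1) < lpv (\<lambda>_ _. a) f1 j l
    then l else l - 1)"
  have pos0: "pos 0 = p0" by (simp add: pos_def)
  have posS: "pos (Suc j) = (if lpv (\<lambda>_ _. a) f1 j (pos j + 1) < lpv (\<lambda>_ _. a) f1 j (pos j)
    then pos j else pos j - 1)" for j
    by (simp add: pos_def)
  have h: "h > 0" using ab by simp
  \<comment> \<open>If \<open>f1\<close> prefers the left position then so does \<open>f2\<close>,
    and the gap leaves a drop of at least \<open>h\<close>. Hence the increment of \<open>f1\<close>
    at the staircase avoids ]-h, 0[, and a change smaller than \<open>h\<close> cannot reverse the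
    comparison.\<close>
  have dich: "lpv u f1 j (pos j + 1) + h \<le> lpv u f1 j (pos j)"
    if gap: "lpv u f1 j (pos j + 1) - lpv u f2 j (pos j + 1) + h \<le> lpv u f1 j (pos j) - lpv u f2 j (pos j)"
      and u: "\<And>i t. u i t \<in> {a, b}"
      and less: "lpv u f1 j (pos j + 1) < lpv u f1 j (pos j)" for u j
    using NS[OF u less] gap by linarith
  \<comment> \<open>changing one row at a time moves every value by less than half of the gap\<close>
  have unif: "lpv u f1 j (pos j + 1) < lpv u f1 j (pos j) \<longleftrightarrow> lpv u' f1 j (pos j + 1) < lpv u' f1 j (pos j)"
    if gap: "\<And>u. (\<And>i t. u i t \<in> {a, b}) \<Longrightarrow>
        lpv u f1 j (pos j + 1) - lpv u f2 j (pos j + 1) + h \<le> lpv u f1 j (pos j) - lpv u f2 j (pos j)"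
      and u: "\<And>i t. u i t \<in> {a, b}" and u': "\<And>i t. u' i t \<in> {a, b}" for u u' j
  proof -
    define v where "v n = (\<lambda>i t. if i < n then u' i t else u i t)" for n :: nat
    have v: "v n i t \<in> {a, b}" for n i t
      using u u' unfolding v_def by auto
    have abs: "\<bar>x - y\<bar> \<le> b - a" if "x \<in> {a, b}" "y \<in> {a, b}" for x y
      using that ab by auto
    have close: "\<bar>lpv (v n) f1 j p - lpv (v (Suc n)) f1 j p\<bar> \<le> b - a" for n p
    proof -
      have "\<bar>lpv (v n) f1 j p - lpv (v (Suc n)) f1 j p\<bar> \<le> (\<Sum>i<j. if i = n then b - a else 0)"
        by (rule lpv_lipschitz) (use u u' abs in \<open>auto simp: v_def\<close>)
      also have "\<dots> \<le> b - a" using ab by (simp add: sum.delta)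
      finally show ?thesis .
    qed
    have "lpv (v 0) f1 j (pos j + 1) < lpv (v 0) f1 j (pos j) \<longleftrightarrow>
          lpv (v n) f1 j (pos j + 1) < lpv (v n) f1 j (pos j)" for n
    proof (induction n)
      case (Suc n)
      have "lpv (v n) f1 j (pos j + 1) < lpv (v n) f1 j (pos j) \<longleftrightarrow>
          lpv (v (Suc n)) f1 j (pos j + 1) < lpv (v (Suc n)) f1 j (pos j)"
        using dich[OF gap[of "v n", OF v] v] dich[OF gap[of "v (Suc n)", OF v] v]
          close[of n "pos j"] close[of n "pos j + 1"] ab by (smt (verit))
      with Suc show ?case by simp
    qed simp
    moreover have "lpv (v j) f1 j p = lpv u' f1 j p" for p
      by (rule lpv_cong) (auto simp: v_def)
    moreover have "v 0 = u" by (auto simp: v_def)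
    ultimately show ?thesis by metis
  qed
  have gap: "lpv u f1 j (pos j + 1) - lpv u f2 j (pos j + 1) + h \<le> lpv u f1 j (pos j) - lpv u f2 j (pos j)"
    if "\<And>i t. u i t \<in> {a, b}" for u j
    using that
  proof (induction j arbitrary: u)
    case 0
    then show ?case using jump by (simp add: pos0)
  next
    case (Suc j)
    note u = Suc.prems
    have g: "lpv u f1 j (pos j + 1) - lpv u f2 j (pos j + 1) + h \<le> lpv u f1 j (pos j) - lpv u f2 j (pos j)"
      by (rule Suc.IH) (rule u)
    note m = lpv_diff_antimono[of f1 f2 u j, OF anti]
    have un: "lpv u f1 j (pos j + 1) < lpv u f1 j (pos j) \<longleftrightarrow>
       lpv (\<lambda>_ _. a) f1 j (pos j + 1) < lpv (\<lambda>_ _. a) f1 j (pos j)"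
      by (rule unif[OF Suc.IH u]) auto
    show ?case
    \<comment> \<open>In both cases the two profiles choose the same predecessor at position
      \<open>pos j\<close>, by \<open>NS\<close> or by the gap. The whole gap is then inherited,
      with the right neighbour if the choice is \<open>pos j\<close> and with the left neighbour if
      it is \<open>pos j + 1\<close>.\<close>
    proof (cases "lpv u f1 j (pos j + 1) < lpv u f1 j (pos j)")
      case True
      then have eq: "pos (Suc j) = pos j" by (simp add: posS un)
      show ?thesis
        using NS[OF u True] True g m[of "pos j + 1"] by (auto simp: eq max_def)
    next
      case False
      then have eq: "pos (Suc j) = pos j - 1" by (simp add: posS un)
      show ?thesis
        using False g m[of "pos j - 1"] h by (auto simp: eq max_def)
    qed
  qed
  define down where "down j \<longleftrightarrow> pos (Suc j) = pos j" for j
  have downD: "lpv u f1 j (pos j + 1) + h \<le> lpv u f1 j (pos j)"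
    if "down j" and u: "\<And>i t. u i t \<in> {a, b}" for u j
  proof -
    have "lpv u f1 j (pos j + 1) < lpv u f1 j (pos j) \<longleftrightarrow>
       lpv (\<lambda>_ _. a) f1 j (pos j + 1) < lpv (\<lambda>_ _. a) f1 j (pos j)"
      by (rule unif[OF gap u]) auto
    then show ?thesis using that(1) dich[of u j, OF gap[of u j, OF u] u] by (auto simp: down_def posS split: if_splits)
  qed
  have leftD: "lpv u f1 j (pos j) \<le> lpv u f1 j (pos j + 1)"
    if "\<not> down j" and u: "\<And>i t. u i t \<in> {a, b}" for u j
  proof -
    have "lpv u f1 j (pos j + 1) < lpv u f1 j (pos j) \<longleftrightarrow>
       lpv (\<lambda>_ _. a) f1 j (pos j + 1) < lpv (\<lambda>_ _. a) f1 j (pos j)"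
      by (rule unif[OF gap u]) auto
    then show ?thesis using that(1) by (auto simp: down_def posS split: if_splits)
  qed
  have pos_down: "down j \<Longrightarrow> pos (Suc j) = pos j" and pos_left: "\<not> down j \<Longrightarrow> pos (Suc j) = pos j - 1" for j
    by (auto simp: down_def posS split: if_splits)
  have pos_le: "pos j \<le> p0" and pos_ge: "p0 \<le> pos j + int j" for j
    by (induction j) (auto simp: pos0 posS)
  \<comment> \<open>Weight \<beta> left of the staircase, \<gamma> right of it. Weights with index
    \<open>i\<close> sit in row \<open>i + 1\<close>, hence \<open>pos (Suc i)\<close>.\<close>
  define E where "E \<beta> \<gamma> = (\<lambda>(i::nat) (t::int). if t \<le> pos (Suc i) then \<beta> else \<gamma> :: real)" for \<beta> \<gamma>
  have E: "E \<beta> \<gamma> i t \<in> {a, b}" if "\<beta> \<in> {a, b}" "\<gamma> \<in> {a, b}" for \<beta> \<gamma> i t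
    using that by (auto simp: E_def)
  \<comment> \<open>The two sides do not mix: next to the staircase \<open>downD\<close> and
    \<open>leftD\<close> provide a maximizer on the same side, so an optimal path collects only
    \<beta> or only \<gamma> and then the best reachable boundary value.\<close>
  have val: "(p \<le> pos j \<longrightarrow> lpv (E \<beta> \<gamma>) f1 j p = real j * \<beta> + Max (f1 ` {p..min (p + int j) p0})) \<and>
    (p > pos j \<longrightarrow> lpv (E \<beta> \<gamma>) f1 j p = real j * \<gamma> + Max (f1 ` {max p (p0 + 1)..p + int j}))"
    if bg: "\<beta> \<in> {a, b}" "\<gamma> \<in> {a, b}" for \<beta> \<gamma> j p
  proof (induction j arbitrary: p)
    case 0
    show ?case by (auto simp: pos0)
  next
    case (Suc j)
    let ?V = "lpv (E \<beta> \<gamma>) f1 j"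
    have mx: "max (c + Max (f1 ` A)) (c + Max (f1 ` B)) = c + Max (f1 ` (A \<union> B))"
      if "finite A" "finite B" "A \<noteq> {}" "B \<noteq> {}" for A B c
      using that by (simp add: image_Un Max_Un max_def)
    show ?case
    proof (intro conjI impI)
      assume p: "p \<le> pos (Suc j)"
      then have p': "p \<le> pos j" using pos_down[of j] pos_left[of j] by linarith
      have "max (?V p) (?V (p + 1)) = real j * \<beta> + Max (f1 ` {p..min (p + int (Suc j)) p0})"
      proof (cases "p + 1 \<le> pos j")
        case True
        have "{p..min (p + int (Suc j)) p0} = {p..min (p + int j) p0} \<union> {p+1..min (p + 1 + int j) p0}"
          using True pos_le[of j] by auto
        then show ?thesis using True p' pos_le[of j] Suc[of p] Suc[of "p+1"]
          by (simp only: mp) (subst mx, auto)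
      next
        case False
        with p' have eq: "p = pos j" by simp
        then have "down j" using p by (auto simp: down_def posS split: if_splits)
        from downD[OF this, of "E \<beta> \<gamma>"] E[OF bg] have "?V (p + 1) \<le> ?V p" using h eq by force
        moreover have "{p..min (p + int (Suc j)) p0} = {p..min (p + int j) p0}"
          using pos_ge[of j] eq by auto
        ultimately show ?thesis using Suc[of p] p' by (simp only: max.absorb1)
      qed
      then show "lpv (E \<beta> \<gamma>) f1 (Suc j) p = real (Suc j) * \<beta> + Max (f1 ` {p..min (p + int (Suc j)) p0})"
        using p by (simp add: E_def algebra_simps)
    next
      assume p: "pos (Suc j) < p"
      have "max (?V p) (?V (p + 1)) = real j * \<gamma> + Max (f1 ` {max p (p0 + 1)..p + int (Suc j)})"
      proof (cases "p > pos j")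
        case True
        have "{max p (p0 + 1)..p + int (Suc j)} =
            {max p (p0 + 1)..p + int j} \<union> {max (p+1) (p0 + 1)..p + 1 + int j}"
          using True pos_ge[of j] by auto
        then show ?thesis using True pos_ge[of j] Suc[of p] Suc[of "p+1"]
          by (simp only: mp) (subst mx, auto)
      next
        case False
        with p have eq: "p = pos j" and left: "\<not> down j" using pos_down[of j] pos_left[of j] by fastforce+
        from leftD[OF left, of "E \<beta> \<gamma>"] E[OF bg] have "?V p \<le> ?V (p + 1)" using eq by force
        moreover have "{max p (p0 + 1)..p + int (Suc j)} = {max (p + 1) (p0 + 1)..p + 1 + int j}"
          using pos_le[of j] eq by auto
        moreover have "pos j < p + 1" using eq by simp
        ultimately show ?thesis using Suc[of "p + 1"] by (simp only: max.absorb2)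
      qed
      then show "lpv (E \<beta> \<gamma>) f1 (Suc j) p =
          real (Suc j) * \<gamma> + Max (f1 ` {max p (p0 + 1)..p + int (Suc j)})"
        using p by (simp add: E_def algebra_simps)
    qed
  qed
  define A where "A j = Max (f1 ` {pos j..p0})" for j
  define D where "D j = Max (f1 ` {p0 + 1..pos j + 1 + int j})" for j
  have vA: "lpv (E \<beta> \<gamma>) f1 j (pos j) = real j * \<beta> + A j"
    and vD: "lpv (E \<beta> \<gamma>) f1 j (pos j + 1) = real j * \<gamma> + D j"
    if "\<beta> \<in> {a, b}" "\<gamma> \<in> {a, b}" for \<beta> \<gamma> j
  proof -
    have "min (pos j + int j) p0 = p0" "max (pos j + 1) (p0 + 1) = p0 + 1"
      using pos_le[of j] pos_ge[of j] by auto
    then show "lpv (E \<beta> \<gamma>) f1 j (pos j) = real j * \<beta> + A j"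
      "lpv (E \<beta> \<gamma>) f1 j (pos j + 1) = real j * \<gamma> + D j"
      using val[OF that, where p="pos j" and j=j] val[OF that, where p="pos j + 1" and j=j]
      unfolding A_def D_def by auto
  qed
  \<comment> \<open>The colouring works against the observed choice: the larger weight is put on the
    other side and the choice still stands, so the boundary maxima must make up for
    \<open>j (b - a)\<close>.\<close>
  have PD: "real j * (b - a) \<le> A j - D j" if "down j" for j
    using downD[OF that, of "E a b"] E[of a b] vA[of a b j] vD[of a b j] h
    by (auto simp: algebra_simps)
  have PL: "A j - D j \<le> - (real j * (b - a))" if "\<not> down j" for j
    using leftD[OF that, of "E b a"] E[of b a] vA[of b a j] vD[of b a j]
    by (auto simp: algebra_simps)
  have A_down: "A (Suc j) = A j" if "down j" for j
    using pos_down[OF that] by (simp add: A_def)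
  have D_left: "D (Suc j) = D j" if "\<not> down j" for j
    using pos_left[OF that] by (simp add: D_def add.assoc)
  have D_down: "D (Suc j) = max (D j) (f1 (pos j + int j + 2))" if "down j" for j
  proof -
    have "{p0 + 1..pos (Suc j) + 1 + int (Suc j)} =
        insert (pos j + int j + 2) {p0 + 1..pos j + 1 + int j}"
      using pos_down[OF that] pos_ge[of j] by auto
    then show ?thesis using pos_ge[of j] by (simp add: D_def max.commute)
  qed
  have A_left: "A (Suc j) = max (A j) (f1 (pos j - 1))" if "\<not> down j" for j
  proof -
    have "{pos (Suc j)..p0} = insert (pos j - 1) {pos j..p0}"
      using pos_left[OF that] pos_le[of j] by auto
    then show ?thesis using pos_le[of j] by (simp add: A_def max.commute)
  qed
  have D_ge: "f1 (pos j + int j + 1) \<le> D j" "f1 (p0 + 1) \<le> D j" for j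
    unfolding D_def using pos_ge[of j] by (auto intro!: Max_ge)
  have A_ge: "f1 (pos j) \<le> A j" "f1 p0 \<le> A j" for j
    unfolding A_def using pos_le[of j] by (auto intro!: Max_ge)
  obtain C where C: "\<And>p. \<bar>f1 (p + 1) - f1 p\<bar> \<le> C + (b - a) * \<bar>real_of_int p\<bar>"
    using sublin[of "b - a"] ab by auto
  \<comment> \<open>From row \<open>J\<close> on, 2 j (b - a) exceeds every single increment of
    \<open>f1\<close> that the staircase can meet in row \<open>j\<close>.\<close>
  obtain J :: nat where J: "C + (b - a) * (\<bar>real_of_int p0\<bar> + 1) < real J * (b - a)"
    using ab by (metis diff_gt_0_iff_gt reals_Archimedean3)
  have big: "C + (b - a) * \<bar>real_of_int p\<bar> < 2 * real j * (b - a)"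
    if "J \<le> j" "\<bar>real_of_int p\<bar> \<le> \<bar>real_of_int p0\<bar> + real j + 1" for j p
  proof -
    have "(b - a) * \<bar>real_of_int p\<bar> \<le> (b - a) * (\<bar>real_of_int p0\<bar> + real j + 1)"
      using that ab by (intro mult_left_mono) auto
    moreover have "real J * (b - a) \<le> real j * (b - a)"
      using that ab by (intro mult_right_mono) auto
    ultimately show ?thesis using J by (simp add: algebra_simps)
  qed
  \<comment> \<open>A turn of the staircase makes \<open>A - D\<close> swing by more than 2 j (b -
    a) within one row, while only one new boundary value enters. That value would differ too much
    from its neighbour.\<close>
  have keep_down: "down (Suc j)" if "J \<le> j" "down j" for j
  proof (rule ccontr)
    assume n: "\<not> down (Suc j)"
    have ab1: "0 \<le> real j * (b - a)" "0 < b - a" using ab by auto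
    have s: "A (Suc j) - D (Suc j) \<le> - (real j * (b - a)) - (b - a)" using PL[OF n] by (simp add: algebra_simps)
    have "D (Suc j) - D j > 0" using s PD[OF that(2)] A_down[OF that(2)] ab1 by linarith
    then have "D (Suc j) = f1 (pos j + int j + 2)" using D_down[OF that(2)] by auto
    then have "2 * real j * (b - a) \<le> f1 ((pos j + int j + 1) + 1) - f1 (pos j + int j + 1)"
      using s PD[OF that(2)] A_down[OF that(2)] D_ge(1)[of j] ab by (simp add: add.assoc)
    moreover have "\<bar>real_of_int (pos j + int j + 1)\<bar> \<le> \<bar>real_of_int p0\<bar> + real j + 1"
      using pos_le[of j] pos_ge[of j] by linarith
    ultimately show False using C[of "pos j + int j + 1"] big[OF that(1)] by fastforce
  qed
  have keep_left: "\<not> down (Suc j)" if "J \<le> j" "\<not> down j" for j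
  proof
    assume d: "down (Suc j)"
    have ab1: "0 \<le> real j * (b - a)" "0 < b - a" using ab by auto
    have s: "real j * (b - a) + (b - a) \<le> A (Suc j) - D (Suc j)" using PD[OF d] by (simp add: algebra_simps)
    have "A (Suc j) - A j > 0" using s PL[OF that(2)] D_left[OF that(2)] ab1 by linarith
    then have "A (Suc j) = f1 (pos j - 1)" using A_left[OF that(2)] by auto
    then have "2 * real j * (b - a) \<le> \<bar>f1 ((pos j - 1) + 1) - f1 (pos j - 1)\<bar>"
      using s PL[OF that(2)] D_left[OF that(2)] A_ge(1)[of j] ab by simp
    moreover have "\<bar>real_of_int (pos j - 1)\<bar> \<le> \<bar>real_of_int p0\<bar> + real j + 1"
      using pos_le[of j] pos_ge[of j] by linarith
    ultimately show False using C[of "pos j - 1"] big[OF that(1)] by fastforce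
  qed
  \<comment> \<open>The staircase is now straight: one maximum is frozen, the other never falls
    below its first entry, yet their difference has to grow linearly.\<close>
  show False
  proof (cases "down J")
    case True
    have d: "down (J + i) \<and> A (J + i) = A J" for i
      by (induction i) (use True keep_down A_down in auto)
    have bd: "real (J + i) * (b - a) \<le> A J - f1 (p0 + 1)" for i
      using PD[of "J + i"] d[of i] D_ge(2)[of "J + i"] by linarith
    obtain i :: nat where "A J - f1 (p0 + 1) < real i * (b - a)"
      using ab by (metis diff_gt_0_iff_gt reals_Archimedean3)
    moreover have "real i * (b - a) \<le> real (J + i) * (b - a)" using ab by (intro mult_right_mono) auto
    ultimately show False using bd[of i] by linarith
  next
    case False
    have d: "\<not> down (J + i) \<and> D (J + i) = D J" for i
      by (induction i) (use False keep_left D_left in auto)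
    have bd: "real (J + i) * (b - a) \<le> D J - f1 p0" for i
      using PL[of "J + i"] d[of i] A_ge(2)[of "J + i"] by linarith
    obtain i :: nat where "D J - f1 p0 < real i * (b - a)"
      using ab by (metis diff_gt_0_iff_gt reals_Archimedean3)
    moreover have "real i * (b - a) \<le> real (J + i) * (b - a)" using ab by (intro mult_right_mono) auto
    ultimately show False using bd[of i] by linarith
  qed
qed

section \<open>Signed measures on intervals of directions\<close>

definition dir_at :: "real \<Rightarrow> dir" where
  "dir_at t = (t, 1 - t)"

lemma fst_dir_at [simp]: "fst (dir_at t) = t"
  by (simp add: dir_at_def)

lemma dir_at_inject [simp]: "dir_at s = dir_at t \<longleftrightarrow> s = t"
  by (simp add: dir_at_def)

lemma dir_less_dir_at [simp]: "dir_at s \<prec> dir_at t \<longleftrightarrow> s < t"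
  and dir_le_dir_at [simp]: "dir_at s \<preceq> dir_at t \<longleftrightarrow> s \<le> t"
  by (auto simp: dir_at_def dir_less_def dir_le_def ehat_def e1_def e2_def)

lemma dirs_eq: "dirs = dir_at ` {0..1}"
  by (force simp: dirs_def dir_at_def e1_def e2_def)

lemma ri_dirs_eq: "ri_dirs = dir_at ` {0<..<1}"
  unfolding ri_dirs_def dirs_eq by (force simp: dir_at_def e1_def e2_def)

lemma dir_at_in_ri_dirs [simp]: "dir_at t \<in> ri_dirs \<longleftrightarrow> 0 < t \<and> t < 1"
  by (auto simp: ri_dirs_eq)

lemma dir_intervals:
  assumes "0 \<le> s" "t \<le> 1"
  shows "dir_cc (dir_at s) (dir_at t) = dir_at ` {s..t}"
    and "dir_oc (dir_at s) (dir_at t) = dir_at ` {s<..t}"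
    and "dir_co (dir_at s) (dir_at t) = dir_at ` {s..<t}"
  using assms by (auto simp: dir_cc_def dir_oc_def dir_co_def dirs_eq)

lemma continuous_dir_at: "continuous_on S dir_at"
  unfolding dir_at_def by (intro continuous_intros)

lemma dir_at_borel [measurable]: "dir_at \<in> borel_measurable borel"
  by (intro borel_measurable_continuous_onI continuous_dir_at)

lemma closed_dir_interval [simp]: "closed (dir_at ` {s..t})"
  by (intro compact_imp_closed compact_continuous_image continuous_dir_at) auto

lemma sets_dir_interval:
  "A \<in> sets (restrict_space borel (dir_at ` {s..t})) \<longleftrightarrow> A \<subseteq> dir_at ` {s..t} \<and> A \<in> sets borel"
  by (subst sets_restrict_space_iff) auto

lemma vimage_dir_at_borel: "A \<in> sets borel \<Longrightarrow> dir_at -` A \<in> sets borel"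
  using measurable_sets_borel[OF dir_at_borel] by auto

text \<open>The continuous left inverse \<open>fst\<close> turns the image into a preimage.\<close>

lemma image_dir_at_borel:
  assumes "S \<in> sets borel"
  shows "dir_at ` (S \<inter> {s..t}) \<in> sets borel"
proof -
  have eq: "dir_at ` (S \<inter> {s..t}) = fst -` S \<inter> dir_at ` {s..t}"
    by auto
  have "fst -` S \<in> sets (borel :: dir measure)"
    by (rule measurable_sets_borel[OF _ assms]) (intro borel_measurable_continuous_onI continuous_intros)
  then show ?thesis unfolding eq by (intro sets.Int) auto
qed

lemma dir_subinterval_sets:
  "s0 \<le> s \<Longrightarrow> t \<le> t0 \<Longrightarrow> dir_at ` {s..t} \<in> sets (restrict_space borel (dir_at ` {s0..t0}))"
  "s0 \<le> s \<Longrightarrow> t \<le> t0 \<Longrightarrow> dir_at ` {s<..t} \<in> sets (restrict_space borel (dir_at ` {s0..t0}))"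
  "s0 \<le> s \<Longrightarrow> t \<le> t0 \<Longrightarrow> dir_at ` {s..<t} \<in> sets (restrict_space borel (dir_at ` {s0..t0}))"
  "s0 \<le> s \<Longrightarrow> t \<le> t0 \<Longrightarrow> dir_at ` {s<..<t} \<in> sets (restrict_space borel (dir_at ` {s0..t0}))"
proof -
  have *: "dir_at ` S \<in> sets (restrict_space borel (dir_at ` {s0..t0}))"
    if "S \<in> sets borel" "S \<subseteq> {s0..t0}" for S
  proof -
    have "S \<inter> {s0..t0} = S" using that by auto
    with image_dir_at_borel[OF that(1), of s0 t0] that(2) show ?thesis
      by (auto simp: sets_dir_interval)
  qed
  assume "s0 \<le> s" "t \<le> t0"
  then show "dir_at ` {s..t} \<in> sets (restrict_space borel (dir_at ` {s0..t0}))"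
    "dir_at ` {s<..t} \<in> sets (restrict_space borel (dir_at ` {s0..t0}))"
    "dir_at ` {s..<t} \<in> sets (restrict_space borel (dir_at ` {s0..t0}))"
    "dir_at ` {s<..<t} \<in> sets (restrict_space borel (dir_at ` {s0..t0}))"
    by (intro *; auto)+
qed

section \<open>Signed measures on a direction interval: uniqueness\<close>

lemma signed_measure_empty: "signed_measure N \<nu> \<Longrightarrow> \<nu> {} = 0"
  by (simp add: signed_measure_def)

lemma signed_measure_sums:
  "signed_measure N \<nu> \<Longrightarrow> range A \<subseteq> sets N \<Longrightarrow> disjoint_family A \<Longrightarrow> (\<lambda>n. \<nu> (A n)) sums \<nu> (\<Union>n. A n)"
  by (simp add: signed_measure_def)

lemma signed_measure_add:
  assumes "signed_measure N \<nu>1" "signed_measure N \<nu>2"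
  shows "signed_measure N (\<lambda>A. \<nu>1 A + \<nu>2 A)"
  using assms unfolding signed_measure_def by (auto intro!: sums_add)

lemma signed_measure_uminus:
  assumes "signed_measure N \<nu>"
  shows "signed_measure N (\<lambda>A. - \<nu> A)"
  using assms unfolding signed_measure_def by (auto intro!: sums_minus)

lemma signed_measure_diff:
  assumes "signed_measure N \<nu>1" "signed_measure N \<nu>2"
  shows "signed_measure N (\<lambda>A. \<nu>1 A - \<nu>2 A)"
  using assms unfolding signed_measure_def by (auto intro!: sums_diff)

lemma signed_measure_Int:
  assumes "signed_measure N \<nu>" "E \<in> sets N"
  shows "signed_measure N (\<lambda>A. \<nu> (A \<inter> E))"
  unfolding signed_measure_def
proof (intro conjI allI impI)
  fix A :: "nat \<Rightarrow> 'a set"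
  assume A: "range A \<subseteq> sets N" "disjoint_family A"
  have "(\<lambda>n. \<nu> (A n \<inter> E)) sums \<nu> (\<Union>n. A n \<inter> E)"
    using A assms(2) by (intro signed_measure_sums[OF assms(1)]) (auto simp: disjoint_family_on_def)
  then show "(\<lambda>n. \<nu> (A n \<inter> E)) sums \<nu> ((\<Union>n. A n) \<inter> E)" by (simp add: Int_UN_distrib2)
qed (use assms in \<open>simp add: signed_measure_def\<close>)

lemma signed_measure_Un:
  assumes "signed_measure N \<nu>" "A \<in> sets N" "C \<in> sets N" "A \<inter> C = {}"
  shows "\<nu> (A \<union> C) = \<nu> A + \<nu> C"
proof -
  have "(\<lambda>n. \<nu> (binaryset A C n)) sums \<nu> (\<Union>n. binaryset A C n)"
    using assms by (intro signed_measure_sums[OF assms(1)])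
      (auto simp: range_binaryset_eq disjoint_family_on_def binaryset_def)
  moreover have "(\<lambda>n. \<nu> (binaryset A C n)) sums (\<nu> A + \<nu> C)"
    by (intro binaryset_sums signed_measure_empty[OF assms(1)])
  ultimately show ?thesis by (simp add: UN_binaryset_eq sums_unique2)
qed

text \<open>Closed subintervals are stable under intersection and generate the Borel sets.\<close>

lemma signed_measure_zeroI:
  assumes sm: "signed_measure (restrict_space borel (dir_at ` {s0..t0})) \<nu>"
    and zero: "\<And>s t. s0 \<le> s \<Longrightarrow> s \<le> t \<Longrightarrow> t \<le> t0 \<Longrightarrow> \<nu> (dir_at ` {s..t}) = 0"
    and A: "A \<in> sets (restrict_space borel (dir_at ` {s0..t0}))"
  shows "\<nu> A = 0"
proof -
  let ?N = "restrict_space borel (dir_at ` {s0..t0})"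
  \<comment> \<open>Transport to the real line, where half-lines are a generator stable under
    intersection.\<close>
  define \<nu>' where "\<nu>' S = \<nu> (dir_at ` (S \<inter> {s0..t0}))" for S
  have in_N: "dir_at ` (S \<inter> {s0..t0}) \<in> sets ?N" if "S \<in> sets borel" for S
    using image_dir_at_borel[OF that] by (auto simp: sets_dir_interval)
  have sm': "signed_measure borel \<nu>'"
    unfolding signed_measure_def
  proof (intro conjI allI impI)
    show "\<nu>' {} = 0" using signed_measure_empty[OF sm] by (simp add: \<nu>'_def)
    fix A :: "nat \<Rightarrow> real set"
    assume A: "range A \<subseteq> sets borel" "disjoint_family A"
    have dj: "disjoint_family (\<lambda>n. dir_at ` (A n \<inter> {s0..t0}))"
      using A(2) unfolding disjoint_family_on_def disjoint_iff
      by (blast dest: dir_at_inject[THEN iffD1])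
    have "(\<lambda>n. \<nu> (dir_at ` (A n \<inter> {s0..t0}))) sums \<nu> (\<Union>n. dir_at ` (A n \<inter> {s0..t0}))"
      using A in_N dj by (intro signed_measure_sums[OF sm]) auto
    moreover have "(\<Union>n. dir_at ` (A n \<inter> {s0..t0})) = dir_at ` ((\<Union>n. A n) \<inter> {s0..t0})" by auto
    ultimately show "(\<lambda>n. \<nu>' (A n)) sums \<nu>' (\<Union>n. A n)"
      unfolding \<nu>'_def by simp
  qed
  have atMost: "\<nu>' {..t} = 0" for t
  proof (cases "s0 \<le> min t t0")
    case True
    have "{..t} \<inter> {s0..t0} = {s0..min t t0}" by auto
    with zero[of s0 "min t t0"] True show ?thesis by (simp add: \<nu>'_def)
  next
    case False
    then have "{..t} \<inter> {s0..t0} = {}" by auto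
    then show ?thesis using signed_measure_empty[OF sm] by (simp add: \<nu>'_def)
  qed
  have UNIV0: "\<nu>' UNIV = 0"
    using atMost[of t0] by (simp add: \<nu>'_def Int_absorb1 Int_commute atLeastAtMost_def Int_assoc)
  have "\<nu>' S = 0" if "S \<in> sigma_sets UNIV (range (\<lambda>a::real. {..a}))" for S
  proof (rule sigma_sets_induct_disjoint[OF _ _ that])
    show "Int_stable (range (\<lambda>a::real. {..a}))"
      by (auto simp: Int_stable_def)
    have borelD: "A \<in> sets borel" if "A \<in> sigma_sets UNIV (range (\<lambda>a::real. {..a}))" for A
      using that by (simp add: borel_eq_atMost)
    show "\<nu>' (UNIV - A) = 0" if "A \<in> sigma_sets UNIV (range (\<lambda>a::real. {..a}))" "\<nu>' A = 0" for A
      using signed_measure_Un[OF sm', of A "UNIV - A"] borelD[OF that(1)] that(2) UNIV0 by auto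
    show "\<nu>' (\<Union>i::nat. A i) = 0"
      if "disjoint_family A" "range A \<subseteq> sigma_sets UNIV (range (\<lambda>a::real. {..a}))"
        "\<And>i. \<nu>' (A i) = 0" for A
      using signed_measure_sums[OF sm', of A] that borelD
      by (metis (no_types, lifting) image_subset_iff sums_unique2 sums_zero sums_cong subsetD subsetI)
  qed (use atMost signed_measure_empty[OF sm'] in auto)
  moreover have "dir_at -` A \<in> sigma_sets UNIV (range (\<lambda>a::real. {..a}))"
    using vimage_dir_at_borel[of A] A unfolding borel_eq_atMost[where 'a = real]
    by (simp add: sets_dir_interval)
  moreover have "dir_at ` (dir_at -` A \<inter> {s0..t0}) = A"
    using A by (auto simp: sets_dir_interval)
  ultimately show ?thesis by (metis \<nu>'_def)
qed

lemma signed_measure_split_interval: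
  assumes sm: "signed_measure (restrict_space borel (dir_at ` {s0..t0})) \<nu>"
    and "s0 \<le> s" "s \<le> t" "t \<le> t0"
  shows "\<nu> (dir_at ` {s..t}) = \<nu> {dir_at s} + \<nu> (dir_at ` {s<..t})"
    and "\<nu> (dir_at ` {s..t}) = \<nu> (dir_at ` {s..<t}) + \<nu> {dir_at t}"
proof -
  have "{s..t} = {s} \<union> {s<..t}" "{s..t} = {s..<t} \<union> {t}" using assms by auto
  then have eq: "dir_at ` {s..t} = {dir_at s} \<union> dir_at ` {s<..t}"
    "dir_at ` {s..t} = dir_at ` {s..<t} \<union> {dir_at t}"
    by (metis image_Un image_insert image_empty)+
  have "{dir_at s} \<in> sets (restrict_space borel (dir_at ` {s0..t0}))"
    "{dir_at t} \<in> sets (restrict_space borel (dir_at ` {s0..t0}))"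
    using assms by (auto simp: sets_dir_interval)
  then show "\<nu> (dir_at ` {s..t}) = \<nu> {dir_at s} + \<nu> (dir_at ` {s<..t})"
    "\<nu> (dir_at ` {s..t}) = \<nu> (dir_at ` {s..<t}) + \<nu> {dir_at t}"
    using assms by (subst eq, intro signed_measure_Un[OF sm] dir_subinterval_sets; auto)+
qed

text \<open>The half-open intervals determine the differences of any two atoms, and the atoms at
  infinitely many distinct points are summable.\<close>

lemma signed_measure_zeroI_half_open:
  assumes sm: "signed_measure (restrict_space borel (dir_at ` {s0..t0})) \<nu>"
    and st: "s0 < t0"
    and oc: "\<And>s t. s0 \<le> s \<Longrightarrow> s < t \<Longrightarrow> t \<le> t0 \<Longrightarrow> \<nu> (dir_at ` {s<..t}) = 0"
    and co: "\<And>s t. s0 \<le> s \<Longrightarrow> s < t \<Longrightarrow> t \<le> t0 \<Longrightarrow> \<nu> (dir_at ` {s..<t}) = 0"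
    and A: "A \<in> sets (restrict_space borel (dir_at ` {s0..t0}))"
  shows "\<nu> A = 0"
proof (rule signed_measure_zeroI[OF sm _ A])
  let ?at = "\<lambda>t. \<nu> {dir_at t}"
  note split = signed_measure_split_interval[OF sm]
  have at_eq: "?at s = ?at t" if "s0 \<le> s" "s < t" "t \<le> t0" for s t
    using split[of s t] oc[of s t] co[of s t] that by simp
  define r where "r n = s0 + (t0 - s0) / real (Suc n)" for n
  have r: "s0 < r n" "r n \<le> t0" for n
  proof -
    have "(t0 - s0) / real (Suc n) \<le> (t0 - s0) / 1" using st by (intro divide_left_mono) auto
    then show "s0 < r n" "r n \<le> t0" using st by (auto simp: r_def)
  qed
  have inj: "r m = r n \<Longrightarrow> m = n" for m n
    using st by (auto simp: r_def)
  have "(\<lambda>n. ?at (r n)) sums \<nu> (\<Union>n. {dir_at (r n)})"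
    using r inj by (intro signed_measure_sums[OF sm])
      (auto simp: disjoint_family_on_def sets_dir_interval less_imp_le)
  then have "(\<lambda>n. ?at (r n)) \<longlonglongrightarrow> 0" by (intro summable_LIMSEQ_zero) (auto simp: summable_def)
  moreover have "?at (r n) = ?at s0" for n using at_eq[of s0 "r n"] r[of n] by simp
  ultimately have at0: "?at s0 = 0" by (simp add: LIMSEQ_const_iff)
  fix s t assume "s0 \<le> s" "s \<le> t" "t \<le> t0"
  moreover have "?at s = 0" using at0 at_eq[of s0 s] \<open>s0 \<le> s\<close> \<open>s \<le> t\<close> \<open>t \<le> t0\<close> by (cases "s = s0") auto
  ultimately show "\<nu> (dir_at ` {s..t}) = 0"
    using split(1)[of s t] oc[of s t] by (cases "s = t") auto
qed

section \<open>Existence and evaluation of Busemann measures\<close>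

definition has_interval_values :: "(dir set \<Rightarrow> real) \<Rightarrow> (real \<Rightarrow> real) \<Rightarrow> (real \<Rightarrow> real) \<Rightarrow> real \<Rightarrow> real \<Rightarrow> bool"
  where "has_interval_values \<nu> Gp Gm s0 t0 \<longleftrightarrow>
    signed_measure (restrict_space borel (dir_at ` {s0..t0})) \<nu> \<and>
    (\<forall>s t. s0 \<le> s \<longrightarrow> s \<le> t \<longrightarrow> t \<le> t0 \<longrightarrow> \<nu> (dir_at ` {s..t}) = Gp t - Gm s)"

lemma has_interval_values_add:
  assumes "has_interval_values \<nu>1 Gp1 Gm1 s0 t0" "has_interval_values \<nu>2 Gp2 Gm2 s0 t0"
  shows "has_interval_values (\<lambda>A. \<nu>1 A + \<nu>2 A) (\<lambda>t. Gp1 t + Gp2 t) (\<lambda>t. Gm1 t + Gm2 t) s0 t0"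
  using assms unfolding has_interval_values_def by (auto intro: signed_measure_add)

lemma has_interval_values_uminus:
  assumes "has_interval_values \<nu> Gp Gm s0 t0"
  shows "has_interval_values (\<lambda>A. - \<nu> A) (\<lambda>t. - Gp t) (\<lambda>t. - Gm t) s0 t0"
  using assms unfolding has_interval_values_def by (auto intro: signed_measure_uminus)

text \<open>Closed intervals also record atoms: the case \<open>s = t\<close> gives the mass
  \<open>Gp s - Gm s\<close> of a point. Removing an end point yields the half-open values by which
  Busemann measures are specified.\<close>

lemma has_interval_values_half_open:
  assumes "has_interval_values \<nu> Gp Gm s0 t0" "s0 \<le> s" "s < t" "t \<le> t0"
  shows "\<nu> (dir_at ` {s<..t}) = Gp t - Gp s" "\<nu> (dir_at ` {s..<t}) = Gm t - Gm s"
proof -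
  have sm: "signed_measure (restrict_space borel (dir_at ` {s0..t0})) \<nu>"
    and v: "\<And>s t. s0 \<le> s \<Longrightarrow> s \<le> t \<Longrightarrow> t \<le> t0 \<Longrightarrow> \<nu> (dir_at ` {s..t}) = Gp t - Gm s"
    using assms(1) by (auto simp: has_interval_values_def)
  show "\<nu> (dir_at ` {s<..t}) = Gp t - Gp s" "\<nu> (dir_at ` {s..<t}) = Gm t - Gm s"
    using v[of s t] v[of s s] v[of t t] assms signed_measure_split_interval[OF sm, of s t] by auto
qed

text \<open>A Lebesgue-Stieltjes measure: \<open>Gp\<close> is a right-continuous distribution
  function with left limits \<open>Gm\<close>.\<close>

lemma ex_interval_values_mono:
  assumes st: "s0 < t0"
    and jump: "\<And>s. s0 \<le> s \<Longrightarrow> s \<le> t0 \<Longrightarrow> Gm s \<le> Gp s"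
    and mono: "\<And>s t. s0 \<le> s \<Longrightarrow> s < t \<Longrightarrow> t \<le> t0 \<Longrightarrow> Gp s \<le> Gm t"
    and right: "\<And>s. s0 \<le> s \<Longrightarrow> s < t0 \<Longrightarrow> (Gp \<longlongrightarrow> Gp s) (at_right s)"
    and left: "\<And>s. s0 < s \<Longrightarrow> s \<le> t0 \<Longrightarrow> (Gp \<longlongrightarrow> Gm s) (at_left s)"
  shows "\<exists>\<nu>. has_interval_values \<nu> Gp Gm s0 t0"
proof -
  \<comment> \<open>The value \<open>Gm s0\<close> to the left of \<open>s0\<close> creates the atom
    \<open>Gp s0 - Gm s0\<close> at the left end.\<close>
  define F where "F t = (if t < s0 then Gm s0 else if t \<le> t0 then Gp t else Gp t0)" for t
  have Gp_mono: "Gp s \<le> Gp t" if "s0 \<le> s" "s \<le> t" "t \<le> t0" for s t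
    using mono[of s t] jump[of t] that by (cases "s = t") auto
  have F_mono: "F x \<le> F y" if "x \<le> y" for x y
    using that st jump[of s0] Gp_mono[of s0 y] Gp_mono[of x y] Gp_mono[of s0 t0] Gp_mono[of x t0]
    by (auto simp: F_def)
  have F_right: "continuous (at_right a) F" for a
  proof -
    consider "a < s0" | "s0 \<le> a" "a < t0" | "t0 \<le> a" by linarith
    then have "(F \<longlongrightarrow> F a) (at_right a)"
    proof cases
      case 1
      have "eventually (\<lambda>t. F t = F a) (at_right a)"
        using eventually_at_right_less[of a] eventually_at_right_real[OF 1]
        by eventually_elim (use 1 in \<open>auto simp: F_def\<close>)
      then show ?thesis by (rule tendsto_eventually)
    next
      case 2
      have "eventually (\<lambda>t. Gp t = F t) (at_right a)"
        using eventually_at_right_real[OF 2(2)]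
        by eventually_elim (use 2 in \<open>auto simp: F_def\<close>)
      with right[OF 2] show ?thesis using 2 by (auto simp: F_def intro: Lim_transform_eventually)
    next
      case 3
      have "eventually (\<lambda>t. F t = F a) (at_right a)"
        using eventually_at_right_less[of a]
        by eventually_elim (use 3 st in \<open>auto simp: F_def\<close>)
      then show ?thesis by (rule tendsto_eventually)
    qed
    then show ?thesis by (simp add: continuous_within)
  qed
  have F_left: "(F \<longlongrightarrow> Gm s) (at_left s)" if s: "s0 \<le> s" "s \<le> t0" for s
  proof (cases "s = s0")
    case True
    have "eventually (\<lambda>t. F t = Gm s) (at_left s)"
      using eventually_at_left_real[of "s - 1" s]
      by (auto elim!: eventually_mono simp: F_def True)
    then show ?thesis by (rule tendsto_eventually)
  next
    case False
    then have s': "s0 < s" using s by simp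
    have "eventually (\<lambda>t. Gp t = F t) (at_left s)"
      using eventually_at_left_real[OF s'] by eventually_elim (use s in \<open>auto simp: F_def\<close>)
    with left[OF s' s(2)] show ?thesis by (rule Lim_transform_eventually)
  qed
  let ?I = "interval_measure F"
  have Ioc: "emeasure ?I {a<..b} = ennreal (F b - F a)" if "a \<le> b" for a b
    using emeasure_interval_measure_Ioc[OF that F_mono F_right] by simp
  have Icc: "measure ?I {s..t} = Gp t - Gm s" if s: "s0 \<le> s" "s \<le> t" "t \<le> t0" for s t
  proof -
    \<comment> \<open>Half-open intervals shrinking to the closed one, so that the left limit
      \<open>Gm s\<close> appears.\<close>
    define A where "A n = {s - 1 / real (Suc n)<..t}" for n
    have "decseq A"
      unfolding A_def decseq_def
    proof (intro allI impI subsetI)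
      fix m n :: nat and x assume "m \<le> n" "x \<in> {s - 1 / real (Suc n)<..t}"
      moreover have "1 / real (Suc n) \<le> 1 / real (Suc m)"
        using \<open>m \<le> n\<close> by (intro divide_left_mono) auto
      ultimately show "x \<in> {s - 1 / real (Suc m)<..t}" by auto
    qed
    moreover have fin: "emeasure ?I (A n) \<noteq> \<infinity>" for n
      unfolding A_def using s Ioc[of "s - 1 / real (Suc n)" t]
      by (subst Ioc) (auto intro: order_trans[of _ s])
    moreover have "range A \<subseteq> sets ?I" by (auto simp: A_def)
    ultimately have "(\<lambda>n. measure ?I (A n)) \<longlonglongrightarrow> measure ?I (\<Inter>n. A n)"
      by (intro Lim_measure_decseq)
    moreover have "(\<Inter>n. A n) = {s..t}"
    proof (intro set_eqI iffI)
      fix x assume x: "x \<in> (\<Inter>n. A n)"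
      have "s \<le> x"
      proof (rule field_le_epsilon)
        fix e :: real assume "e > 0"
        then obtain n where "inverse (real (Suc n)) < e" using reals_Archimedean by blast
        with x show "s \<le> x + e" by (auto simp: A_def inverse_eq_divide dest!: spec[of _ n])
      qed
      then show "x \<in> {s..t}" using x by (auto simp: A_def)
    qed (auto simp: A_def intro: less_le_trans[of _ s])
    moreover have "measure ?I (A n) = F t - F (s - 1 / real (Suc n))" for n
      using s F_mono unfolding A_def
      by (intro measure_interval_measure_Ioc F_mono F_right) (auto intro: order_trans[of _ s])
    moreover have "(\<lambda>n. F t - F (s - 1 / real (Suc n))) \<longlonglongrightarrow> F t - Gm s"
    proof (intro tendsto_intros filterlim_compose[OF F_left[of s]])
      have "(\<lambda>n. s - 1 / real (Suc n)) \<longlonglongrightarrow> s - 0"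
        by (intro tendsto_intros LIMSEQ_Suc lim_1_over_n)
      then show "filterlim (\<lambda>n. s - 1 / real (Suc n)) (at_left s) sequentially"
        by (auto simp: filterlim_at)
    qed (use s in auto)
    ultimately have "measure ?I {s..t} = F t - Gm s" by (simp add: LIMSEQ_unique)
    then show ?thesis using s by (simp add: F_def)
  qed
  define \<nu> where "\<nu> A = measure ?I (dir_at -` A \<inter> {s0..t0})" for A
  have "signed_measure (restrict_space borel (dir_at ` {s0..t0})) \<nu>"
    unfolding signed_measure_def
  proof (intro conjI allI impI)
    fix A :: "nat \<Rightarrow> dir set"
    assume A: "range A \<subseteq> sets (restrict_space borel (dir_at ` {s0..t0}))" "disjoint_family A"
    have b: "dir_at -` A n \<in> sets borel" for n
    proof -
      have "A n \<in> sets (restrict_space borel (dir_at ` {s0..t0}))" using A(1) by auto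
      then show ?thesis by (intro vimage_dir_at_borel) (simp add: sets_dir_interval)
    qed
    have fin: "emeasure ?I (\<Union>n. dir_at -` A n \<inter> {s0..t0}) \<noteq> \<infinity>"
    proof -
      have "emeasure ?I (\<Union>n. dir_at -` A n \<inter> {s0..t0}) \<le> emeasure ?I {s0 - 1<..t0}"
        by (intro emeasure_mono) auto
      also have "\<dots> < \<infinity>" using st by (subst Ioc) auto
      finally show ?thesis by simp
    qed
    have dj: "disjoint_family (\<lambda>n. dir_at -` A n \<inter> {s0..t0})"
      using A(2) unfolding disjoint_family_on_def by blast
    have "(\<lambda>n. measure ?I (dir_at -` A n \<inter> {s0..t0})) sums measure ?I (\<Union>n. dir_at -` A n \<inter> {s0..t0})"
      using b fin dj by (intro measure_UNION) auto
    then show "(\<lambda>n. \<nu> (A n)) sums \<nu> (\<Union>n. A n)"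
      by (simp add: \<nu>_def Int_UN_distrib2 vimage_UN)
  qed (simp add: \<nu>_def)
  moreover have "\<nu> (dir_at ` {s..t}) = Gp t - Gm s" if "s0 \<le> s" "s \<le> t" "t \<le> t0" for s t
  proof -
    have "dir_at -` dir_at ` {s..t} \<inter> {s0..t0} = {s..t}" using that by auto
    then show ?thesis using Icc[OF that] by (simp add: \<nu>_def)
  qed
  ultimately show ?thesis unfolding has_interval_values_def by blast
qed

text \<open>Evaluates the definite description. A measure with these values, set to zero off the
  sigma-algebra, meets the defining conditions, and the difference of two candidates vanishes on all
  half-open intervals.\<close>

lemma busemann_measure_interval_values:
  fixes B :: "dir \<Rightarrow> sign \<Rightarrow> site \<Rightarrow> site \<Rightarrow> 'a \<Rightarrow> real"
  assumes st: "0 < s0" "s0 < t0" "t0 < 1"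
    and ex: "has_interval_values \<nu> (\<lambda>t. B (dir_at t) Plus x y \<omega>) (\<lambda>t. B (dir_at t) Minus x y \<omega>) s0 t0"
  shows "has_interval_values (busemann_measure B x y \<omega> (dir_at ` {s0..t0}))
    (\<lambda>t. B (dir_at t) Plus x y \<omega>) (\<lambda>t. B (dir_at t) Minus x y \<omega>) s0 t0"
proof -
  let ?K = "dir_at ` {s0..t0}"
  let ?N = "restrict_space borel ?K"
  define P where "P \<nu> \<longleftrightarrow> signed_measure ?N \<nu> \<and>
     (\<forall>A. A \<notin> sets ?N \<longrightarrow> \<nu> A = 0) \<and>
     (\<forall>\<zeta>\<in>ri_dirs. \<forall>\<eta>\<in>ri_dirs. \<zeta> \<prec> \<eta> \<longrightarrow> dir_cc \<zeta> \<eta> \<subseteq> ?K \<longrightarrow>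
        \<nu> (dir_oc \<zeta> \<eta>) = B \<eta> Plus x y \<omega> - B \<zeta> Plus x y \<omega> \<and>
        \<nu> (dir_co \<zeta> \<eta>) = B \<eta> Minus x y \<omega> - B \<zeta> Minus x y \<omega>)" for \<nu>
  define \<nu>' where "\<nu>' A = (if A \<in> sets ?N then \<nu> A else 0)" for A
  have "signed_measure ?N \<nu>'"
    unfolding signed_measure_def
  proof (intro conjI allI impI)
    fix A :: "nat \<Rightarrow> dir set"
    assume A: "range A \<subseteq> sets ?N" "disjoint_family A"
    have "A n \<in> sets ?N" for n using A(1) by auto
    moreover have "(\<Union>n. A n) \<in> sets ?N" using A(1) by (intro sets.countable_UN) auto
    moreover have "(\<lambda>n. \<nu> (A n)) sums \<nu> (\<Union>n. A n)"
      using ex A by (auto simp: has_interval_values_def intro: signed_measure_sums)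
    ultimately show "(\<lambda>n. \<nu>' (A n)) sums \<nu>' (\<Union>n. A n)" by (simp add: \<nu>'_def)
  qed (use ex in \<open>auto simp: \<nu>'_def has_interval_values_def signed_measure_def\<close>)
  then have hiv': "has_interval_values \<nu>' (\<lambda>t. B (dir_at t) Plus x y \<omega>) (\<lambda>t. B (dir_at t) Minus x y \<omega>) s0 t0"
    using ex by (auto simp: has_interval_values_def \<nu>'_def dir_subinterval_sets)
  have bounds: "s0 \<le> s" "t \<le> t0" if "dir_cc (dir_at s) (dir_at t) \<subseteq> ?K" "s < t" "0 < s" "t < 1" for s t
  proof -
    have "dir_at s \<in> dir_cc (dir_at s) (dir_at t)" "dir_at t \<in> dir_cc (dir_at s) (dir_at t)"
      using that by (auto simp: dir_intervals)
    with that(1) show "s0 \<le> s" "t \<le> t0" by auto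
  qed
  have P': "P \<nu>'"
    unfolding P_def
  proof (intro conjI ballI impI allI)
    fix \<zeta> \<eta> :: dir assume a: "\<zeta> \<in> ri_dirs" "\<eta> \<in> ri_dirs" "\<zeta> \<prec> \<eta>" "dir_cc \<zeta> \<eta> \<subseteq> ?K"
    then obtain s t where s: "\<zeta> = dir_at s" "\<eta> = dir_at t" "0 < s" "s < t" "t < 1"
      by (auto simp: ri_dirs_eq)
    with bounds[of s t] a(4) have "s0 \<le> s" "t \<le> t0" by auto
    from has_interval_values_half_open[OF hiv' this(1) s(4) this(2)] s
    show "\<nu>' (dir_oc \<zeta> \<eta>) = B \<eta> Plus x y \<omega> - B \<zeta> Plus x y \<omega>"
      "\<nu>' (dir_co \<zeta> \<eta>) = B \<eta> Minus x y \<omega> - B \<zeta> Minus x y \<omega>"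
      by (auto simp: dir_intervals)
  qed (use hiv' in \<open>auto simp: has_interval_values_def \<nu>'_def\<close>)
  have "\<mu> = \<nu>'" if "P \<mu>" for \<mu>
  proof
    fix A
    show "\<mu> A = \<nu>' A"
    proof (cases "A \<in> sets ?N")
      case True
      have v: "\<kappa> (dir_at ` {s<..t}) = B (dir_at t) Plus x y \<omega> - B (dir_at s) Plus x y \<omega> \<and>
          \<kappa> (dir_at ` {s..<t}) = B (dir_at t) Minus x y \<omega> - B (dir_at s) Minus x y \<omega>"
        if "P \<kappa>" "s0 \<le> s" "s < t" "t \<le> t0" for \<kappa> s t
      proof -
        have a: "dir_at s \<in> ri_dirs" "dir_at t \<in> ri_dirs" "dir_at s \<prec> dir_at t"
          "dir_cc (dir_at s) (dir_at t) \<subseteq> ?K"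
          using that st by (auto simp: dir_intervals)
        from that(1) have "\<forall>\<zeta>\<in>ri_dirs. \<forall>\<eta>\<in>ri_dirs. dir_less \<zeta> \<eta> \<longrightarrow> dir_cc \<zeta> \<eta> \<subseteq> ?K \<longrightarrow>
            \<kappa> (dir_oc \<zeta> \<eta>) = B \<eta> Plus x y \<omega> - B \<zeta> Plus x y \<omega> \<and>
            \<kappa> (dir_co \<zeta> \<eta>) = B \<eta> Minus x y \<omega> - B \<zeta> Minus x y \<omega>"
          by (simp add: P_def)
        from this[rule_format, OF a] show ?thesis using that st by (simp add: dir_intervals)
      qed
      have "signed_measure ?N (\<lambda>A. \<mu> A - \<nu>' A)"
        using that P' unfolding P_def by (intro signed_measure_diff) auto
      then have "\<mu> A - \<nu>' A = 0"
        by (rule signed_measure_zeroI_half_open[OF _ st(2)]) (use True v[OF that] v[OF P'] in auto)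
      then show ?thesis by simp
    qed (use that P' in \<open>simp add: P_def\<close>)
  qed
  with P' have "(THE \<nu>. P \<nu>) = \<nu>'" by (rule the_equality)
  then show ?thesis using hiv' unfolding busemann_measure_def P_def by simp
qed

text \<open>A signed measure can vanish on a set without having zero variation there, but if it
  vanishes on all closed subintervals of a window, then so does its restriction to the window on
  every Borel set. The bounds by \<open>s0\<close> and \<open>t0\<close> make the window relative to
  the compact interval.\<close>

lemma signed_support_interval_iff:
  assumes hiv: "has_interval_values \<nu> Gp Gm s0 t0" and \<xi>: "s0 \<le> \<xi>" "\<xi> \<le> t0"
  shows "dir_at \<xi> \<notin> signed_support (dir_at ` {s0..t0}) \<nu> \<longleftrightarrow>
    (\<exists>s t. s < \<xi> \<and> \<xi> < t \<and> (\<forall>a b. s0 \<le> a \<longrightarrow> s \<le> a \<longrightarrow> a \<le> b \<longrightarrow> b \<le> t \<longrightarrow> b \<le> t0 \<longrightarrow> Gp b = Gm a))"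
    (is "?L \<longleftrightarrow> ?R")
proof
  let ?K = "dir_at ` {s0..t0}"
  let ?N = "restrict_space borel ?K"
  have sm: "signed_measure ?N \<nu>"
    and v: "\<And>s t. s0 \<le> s \<Longrightarrow> s \<le> t \<Longrightarrow> t \<le> t0 \<Longrightarrow> \<nu> (dir_at ` {s..t}) = Gp t - Gm s"
    using hiv by (auto simp: has_interval_values_def)
  {
    assume ?L
    then obtain C where C: "closed C" "C \<subseteq> ?K" "total_variation ?N \<nu> (?K - C) = 0" "dir_at \<xi> \<notin> C"
      by (auto simp: signed_support_def)
    have null: "\<nu> S = 0" if S: "S \<in> sets ?N" "S \<subseteq> ?K - C" for S
    proof (cases "S = {}")
      case False
      have KC: "?K - C \<in> sets ?N" using C by (auto simp: sets_dir_interval)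
      \<comment> \<open>\<open>S\<close> and its complement, the latter omitted when empty since a
        partition has no empty block.\<close>
      define P where "P = (if S = ?K - C then {S} else {S, ?K - C - S})"
      have P: "P \<in> {P. finite P \<and> P \<subseteq> sets ?N \<and> partition_on (?K - C) P}"
        using S KC False by (auto simp: P_def partition_on_def disjoint_def)
      have "ennreal \<bar>\<nu> S\<bar> \<le> (\<Sum>S\<in>P. ennreal \<bar>\<nu> S\<bar>)"
        by (rule sum_nonneg_leq_bound[OF _ _ refl]) (auto simp: P_def)
      also have "\<dots> \<le> total_variation ?N \<nu> (?K - C)"
        unfolding total_variation_def using P by (rule SUP_upper)
      finally show ?thesis using C(3) by simp
    qed (use signed_measure_empty[OF sm] in simp)
    have "open (dir_at -` (- C))" using C(1)
      by (intro open_vimage continuous_dir_at) auto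
    then obtain e where e: "e > 0" "\<And>r. dist r \<xi> < e \<Longrightarrow> dir_at r \<notin> C"
      using C(4) unfolding open_dist by (metis ComplD ComplI vimageE vimageI2)
    show ?R
    proof (intro exI conjI allI impI)
      show "\<xi> - e/2 < \<xi>" "\<xi> < \<xi> + e/2" using e by auto
      fix a b assume ab: "s0 \<le> a" "\<xi> - e/2 \<le> a" "a \<le> b" "b \<le> \<xi> + e/2" "b \<le> t0"
      have "\<nu> (dir_at ` {a..b}) = 0"
        using ab e by (intro null dir_subinterval_sets) (auto simp: dist_real_def abs_if)
      then show "Gp b = Gm a" using v[of a b] ab by simp
    qed
  }
  {
    assume ?R
    then obtain s t where st: "s < \<xi>" "\<xi> < t"
      and c: "\<And>a b. s0 \<le> a \<Longrightarrow> s \<le> a \<Longrightarrow> a \<le> b \<Longrightarrow> b \<le> t \<Longrightarrow> b \<le> t0 \<Longrightarrow> Gp b = Gm a" by blast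
    define E where "E = dir_at ` {max s s0..min t t0}"
    have EN: "E \<in> sets ?N" unfolding E_def by (intro dir_subinterval_sets) auto
    have null: "\<nu> (A \<inter> E) = 0" if "A \<in> sets ?N" for A
    proof (rule signed_measure_zeroI[OF signed_measure_Int[OF sm EN] _ that])
      fix a b assume ab: "s0 \<le> a" "a \<le> b" "b \<le> t0"
      have eq: "dir_at ` {a..b} \<inter> E = dir_at ` {max a (max s s0)..min b (min t t0)}"
        by (auto simp: E_def)
      show "\<nu> (dir_at ` {a..b} \<inter> E) = 0"
      proof (cases "max a (max s s0) \<le> min b (min t t0)")
        case True
        then show ?thesis unfolding eq using ab v c by auto
      next
        case False
        then have "{max a (max s s0)..min b (min t t0)} = {}" by auto
        then show ?thesis unfolding eq using signed_measure_empty[OF sm] by (simp del: atLeastatMost_empty_iff)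
      qed
    qed
    define C where "C = dir_at ` ({s0..s} \<union> {t..t0}) \<inter> ?K"
    have "closed C" unfolding C_def image_Un by (intro closed_Int closed_Un) auto
    moreover have "total_variation ?N \<nu> (?K - C) = 0"
    proof -
      have "(\<Sum>S\<in>P. ennreal \<bar>\<nu> S\<bar>) \<le> 0" if "P \<subseteq> sets ?N" "partition_on (?K - C) P" for P
      proof -
        have "\<nu> S = 0" if "S \<in> P" for S
        proof -
          have "S \<subseteq> ?K - C" using \<open>partition_on (?K - C) P\<close> that by (auto simp: partition_on_def)
          then have "S \<subseteq> E" unfolding C_def E_def by (force simp: not_le)
          then have "S \<inter> E = S" by auto
          then show ?thesis using null[of S] that \<open>P \<subseteq> sets ?N\<close> by auto
        qed
        then show ?thesis by simp
      qed
      then have "total_variation ?N \<nu> (?K - C) \<le> 0"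
        unfolding total_variation_def by (intro SUP_least) auto
      then show ?thesis by simp
    qed
    moreover have "dir_at \<xi> \<notin> C" using st by (auto simp: C_def)
    ultimately show ?L unfolding signed_support_def C_def by blast
  }
qed

section \<open>Pathwise analysis\<close>

text \<open>Unit steps, taken forwards or backwards, connect all sites. This reduces claims on
  arbitrary pairs to the increments along \<open>e1\<close> and \<open>e2\<close>, which are
  monotone in the direction.\<close>

lemma site_relation_all:
  fixes R :: "site \<Rightarrow> site \<Rightarrow> bool"
  assumes refl: "\<And>x. R x x" and sym: "\<And>x y. R x y \<Longrightarrow> R y x"
    and trans: "\<And>x y z. R x y \<Longrightarrow> R y z \<Longrightarrow> R x z"
    and step: "\<And>x. R x (x + e1)" "\<And>x. R x (x + e2)"
  shows "R x y"
proof -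
  have row: "R (i, k) (j, k)" for i j k :: int
  proof -
    have up: "R (i, k) (i + int n, k)" for i n
    proof (induction n)
      case (Suc n)
      from trans[OF this step(1)[of "(i + int n, k)"]] show ?case by (simp add: e1_def algebra_simps)
    qed (simp add: refl)
    show ?thesis
      using up[of i "nat (j - i)"] sym[OF up[of j "nat (i - j)"]] by (cases "i \<le> j") auto
  qed
  have col: "R (k, i) (k, j)" for i j k :: int
  proof -
    have up: "R (k, i) (k, i + int n)" for i n
    proof (induction n)
      case (Suc n)
      from trans[OF this step(2)[of "(k, i + int n)"]] show ?case by (simp add: e2_def algebra_simps)
    qed (simp add: refl)
    show ?thesis
      using up[of i "nat (j - i)"] sym[OF up[of j "nat (i - j)"]] by (cases "i \<le> j") auto
  qed
  show ?thesis
    using trans[OF row[of "fst x" "snd x" "fst y"] col[of "fst y" "snd x" "snd y"]] by simp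
qed

section \<open>Antidiagonal coordinates, fresh splits and the interface parameter\<close>

definition level_site :: "int \<Rightarrow> nat \<Rightarrow> int \<Rightarrow> site" where
  "level_site k j p = (p, k - int j - p)"

text \<open>Rows are counted downwards from antidiagonal \<open>k\<close>; the two upper neighbours
  of position \<open>p\<close> are the positions \<open>p + 1\<close> and \<open>p\<close> in the
  recursion of \<open>lpv\<close>.\<close>

lemma level_site_Suc_e1 [simp]: "level_site k (Suc j) p + e1 = level_site k j (p + 1)"
  and level_site_Suc_e2 [simp]: "level_site k (Suc j) p + e2 = level_site k j p"
  by (auto simp: level_site_def e1_def e2_def)

lemma level_level_site [simp]: "level (level_site k j p) = k - int j"
  by (simp add: level_def level_site_def)

lemma level_e1 [simp]: "level (x + e1) = level x + 1" and level_e2 [simp]: "level (x + e2) = level x + 1"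
  by (auto simp: level_def e1_def e2_def)

text \<open>Coded by the set of places with value \<open>b\<close>. Only finite sets will be used,
  so there are countably many codes.\<close>

definition config :: "real \<Rightarrow> real \<Rightarrow> (nat \<times> int) set \<Rightarrow> nat \<Rightarrow> int \<Rightarrow> real" where
  "config a b S i t = (if (i, t) \<in> S then b else a)"

text \<open>Only rational directions and sites of level at least \<open>k\<close> enter. The last clause says that
  no site of level at least \<open>k\<close> has its competition interface direction at the jump
  of \<open>\<phi> q (level_site k 0 p0) (level_site k 0 (p0 + 1))\<close> between \<open>q1\<close> and \<open>q2\<close>.\<close>

definition fresh_split ::
    "real \<Rightarrow> real \<Rightarrow> (real \<Rightarrow> site \<Rightarrow> site \<Rightarrow> real) \<Rightarrow> int \<Rightarrow> int \<Rightarrow> real \<Rightarrow> real \<Rightarrow> nat \<Rightarrow> int \<Rightarrow>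
      (nat \<times> int) set \<Rightarrow> real \<Rightarrow> bool" where
  "fresh_split a b \<phi> k p0 q1 q2 m p S \<epsilon> \<longleftrightarrow>
    (\<forall>q\<in>\<rat> \<inter> {q1..q2}.
      (\<forall>t\<in>{p..p + int m + 1}. \<phi> q (level_site k 0 t) (level_site k 0 p) = \<phi> q1 (level_site k 0 t) (level_site k 0 p)) \<and>
        \<phi> q (level_site k 0 p0) (level_site k 0 (p0 + 1)) \<noteq> \<phi> q2 (level_site k 0 p0) (level_site k 0 (p0 + 1)) \<or>
      (\<forall>t\<in>{p..p + int m + 1}. \<phi> q (level_site k 0 t) (level_site k 0 p) = \<phi> q2 (level_site k 0 t) (level_site k 0 p)) \<and>
        \<phi> q (level_site k 0 p0) (level_site k 0 (p0 + 1)) = \<phi> q2 (level_site k 0 p0) (level_site k 0 (p0 + 1))) \<and>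
    \<phi> q1 (level_site k 0 p0) (level_site k 0 (p0 + 1)) \<noteq> \<phi> q2 (level_site k 0 p0) (level_site k 0 (p0 + 1)) \<and>
    lpv (config a b S) (\<lambda>t. \<phi> q1 (level_site k 0 t) (level_site k 0 p)) m (p + 1) + \<epsilon> <
      lpv (config a b S) (\<lambda>t. \<phi> q1 (level_site k 0 t) (level_site k 0 p)) m p \<and>
    lpv (config a b S) (\<lambda>t. \<phi> q2 (level_site k 0 t) (level_site k 0 p)) m p + \<epsilon> <
      lpv (config a b S) (\<lambda>t. \<phi> q2 (level_site k 0 t) (level_site k 0 p)) m (p + 1) \<and>
    (\<forall>z\<in>{z. k \<le> level z}. \<exists>q\<in>\<rat> \<inter> {q1..q2}.
      (\<phi> q (z + e1) (z + e2) > 0) \<noteq>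
      (\<phi> q (level_site k 0 p0) (level_site k 0 (p0 + 1)) = \<phi> q2 (level_site k 0 p0) (level_site k 0 (p0 + 1))))"

text \<open>The first coordinate of \<xi>_* at the shifted environment (\<open>xi_star_eq\<close>).
  Rational \<open>q\<close> make it measurable; the inserted 1 keeps the infimum over a nonempty
  set.\<close>

definition interface_param :: "(real \<Rightarrow> sign \<Rightarrow> site \<Rightarrow> site \<Rightarrow> real) \<Rightarrow> site \<Rightarrow> real" where
  "interface_param \<beta> x = Inf (insert 1 {q \<in> \<rat>. 0 < q \<and> q < 1 \<and> \<beta> q Plus (x + e1) (x + e2) > 0})"

lemma interface_param_less_iff:
  "interface_param \<beta> x < c \<longleftrightarrow>
    1 < c \<or> (\<exists>q\<in>\<rat>. 0 < q \<and> q < 1 \<and> \<beta> q Plus (x + e1) (x + e2) > 0 \<and> q < c)"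
proof -
  have "bdd_below (insert 1 {q \<in> \<rat>. 0 < q \<and> q < 1 \<and> \<beta> q Plus (x + e1) (x + e2) > 0})"
    by (rule bdd_belowI[of _ 0]) auto
  then show ?thesis unfolding interface_param_def by (subst cInf_less_iff) auto
qed

text \<open>A single realization, with the direction replaced by its first coordinate. Ties are
  excluded at rational parameters, as they are excluded almost surely for each fixed
  direction.\<close>

locale busemann_path =
  fixes \<beta> :: "real \<Rightarrow> sign \<Rightarrow> site \<Rightarrow> site \<Rightarrow> real"
    and W :: "site \<Rightarrow> real"
  assumes cocycle: "0 < t \<Longrightarrow> t < 1 \<Longrightarrow> \<beta> t \<sigma> x y + \<beta> t \<sigma> y z = \<beta> t \<sigma> x z"
    and recovery: "0 < t \<Longrightarrow> t < 1 \<Longrightarrow> min (\<beta> t \<sigma> x (x + e1)) (\<beta> t \<sigma> x (x + e2)) = W x"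
    and chain_e1: "0 < s \<Longrightarrow> s < t \<Longrightarrow> t < 1 \<Longrightarrow> \<beta> s Plus x (x + e1) \<le> \<beta> s Minus x (x + e1) \<and>
      \<beta> t Minus x (x + e1) \<le> \<beta> s Plus x (x + e1) \<and> \<beta> t Plus x (x + e1) \<le> \<beta> t Minus x (x + e1)"
    and chain_e2: "0 < s \<Longrightarrow> s < t \<Longrightarrow> t < 1 \<Longrightarrow> \<beta> s Minus x (x + e2) \<le> \<beta> s Plus x (x + e2) \<and>
      \<beta> s Plus x (x + e2) \<le> \<beta> t Minus x (x + e2) \<and> \<beta> t Minus x (x + e2) \<le> \<beta> t Plus x (x + e2)"
    and left_limit: "0 < t \<Longrightarrow> t < 1 \<Longrightarrow> ((\<lambda>s. \<beta> s \<sigma> x y) \<longlongrightarrow> \<beta> t Minus x y) (at_left t)"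
    and right_limit: "0 < t \<Longrightarrow> t < 1 \<Longrightarrow> ((\<lambda>s. \<beta> s \<sigma> x y) \<longlongrightarrow> \<beta> t Plus x y) (at_right t)"
    and blowup_e1: "filterlim (\<lambda>t. \<beta> t \<sigma> x (x + e1)) at_top (at_right 0)"
    and blowup_e2: "filterlim (\<lambda>t. \<beta> t \<sigma> x (x + e2)) at_top (at_left 1)"
    and rational_noteq: "q \<in> \<rat> \<Longrightarrow> 0 < q \<Longrightarrow> q < 1 \<Longrightarrow> \<beta> q Plus x (x + e1) \<noteq> \<beta> q Plus x (x + e2)"
begin

section \<open>Signs of increments on the two sides of the interface direction\<close>

lemma jump_e1: "0 < t \<Longrightarrow> t < 1 \<Longrightarrow> \<beta> t Plus x (x + e1) \<le> \<beta> t Minus x (x + e1)"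
  using chain_e1[of t "(t + 1) / 2"] by auto

lemma jump_e2: "0 < t \<Longrightarrow> t < 1 \<Longrightarrow> \<beta> t Minus x (x + e2) \<le> \<beta> t Plus x (x + e2)"
  using chain_e2[of t "(t + 1) / 2"] by auto

lemma mono_e1: "0 < s \<Longrightarrow> s < t \<Longrightarrow> t < 1 \<Longrightarrow> \<beta> t \<sigma> x (x + e1) \<le> \<beta> s \<sigma>' x (x + e1)"
  using chain_e1[of s t x] by (cases \<sigma>; cases \<sigma>') auto

lemma mono_e2: "0 < s \<Longrightarrow> s < t \<Longrightarrow> t < 1 \<Longrightarrow> \<beta> s \<sigma> x (x + e2) \<le> \<beta> t \<sigma>' x (x + e2)"
  using chain_e2[of s t x] by (cases \<sigma>; cases \<sigma>') auto

lemma path_refl: "0 < t \<Longrightarrow> t < 1 \<Longrightarrow> \<beta> t \<sigma> x x = 0"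
  using cocycle[of t \<sigma> x x x] by simp

lemma path_sym: "0 < t \<Longrightarrow> t < 1 \<Longrightarrow> \<beta> t \<sigma> y x = - \<beta> t \<sigma> x y"
  using cocycle[of t \<sigma> x y x] path_refl[of t \<sigma> x] by simp

lemma path_diag: "0 < t \<Longrightarrow> t < 1 \<Longrightarrow> \<beta> t \<sigma> (x + e1) (x + e2) = \<beta> t \<sigma> x (x + e2) - \<beta> t \<sigma> x (x + e1)"
  using cocycle[of t \<sigma> x "x + e1" "x + e2"] by simp

lemma mono_diag: "0 < s \<Longrightarrow> s < t \<Longrightarrow> t < 1 \<Longrightarrow> \<beta> s \<sigma> (x + e1) (x + e2) \<le> \<beta> t \<sigma>' (x + e1) (x + e2)"
  using mono_e1[of s t \<sigma>' x \<sigma>] mono_e2[of s t \<sigma> x \<sigma>'] path_diag[of s] path_diag[of t] by simp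

lemma jump_diag: "0 < t \<Longrightarrow> t < 1 \<Longrightarrow> \<beta> t Minus (x + e1) (x + e2) \<le> \<beta> t Plus (x + e1) (x + e2)"
  using jump_e1[of t x] jump_e2[of t x] path_diag[of t] by simp

abbreviation tau :: "site \<Rightarrow> real" where
  "tau \<equiv> interface_param \<beta>"

lemma diag_pos_above_tau:
  assumes "tau x < t" "0 < t" "t < 1"
  shows "\<beta> t \<sigma> (x + e1) (x + e2) > 0"
proof -
  from assms obtain q where "q \<in> \<rat>" "0 < q" "q < 1" "\<beta> q Plus (x + e1) (x + e2) > 0" "q < t"
    by (auto simp: interface_param_less_iff)
  with mono_diag[of q t Plus x \<sigma>] assms show ?thesis by auto
qed

text \<open>Strictness comes from a rational between \<open>t\<close> and \<open>tau x\<close>,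
  where the increment is not positive by the choice of \<open>tau\<close> and not zero because there
  is no tie.\<close>

lemma diag_neg_below_tau:
  assumes "t < tau x" "0 < t" "t < 1"
  shows "\<beta> t \<sigma> (x + e1) (x + e2) < 0"
proof -
  obtain q where q: "q \<in> \<rat>" "t < q" "q < min (tau x) 1"
    using Rats_dense_in_real[of t "min (tau x) 1"] assms by auto
  have "\<not> \<beta> q Plus (x + e1) (x + e2) > 0"
    using q assms interface_param_less_iff[of \<beta> x "tau x"] by auto
  moreover have "\<beta> q Plus (x + e1) (x + e2) \<noteq> 0"
    using rational_noteq[of q x] q assms path_diag[of q Plus x] by auto
  ultimately show ?thesis using mono_diag[of t q \<sigma> x Plus] q assms by auto
qed

text \<open>Close to direction \<open>e2\<close> the increment along \<open>e1\<close> exceeds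
  \<open>W x\<close>, so recovery makes the one along \<open>e2\<close> the minimum and the diagonal
  increment is negative.\<close>

lemma tau_gt_0: "0 < tau x"
proof -
  have "eventually (\<lambda>t. \<beta> t Plus x (x + e1) > W x) (at_right 0)"
    using blowup_e1 by (auto simp: filterlim_at_top_dense)
  then obtain d where d: "d > 0" "\<And>t. 0 < t \<Longrightarrow> t < d \<Longrightarrow> \<beta> t Plus x (x + e1) > W x"
    by (auto simp: eventually_at_right_field)
  have "\<not> tau x < min d 1"
  proof
    assume "tau x < min d 1"
    then obtain q where q: "0 < q" "q < 1" "q < d" "\<beta> q Plus (x + e1) (x + e2) > 0"
      by (auto simp: interface_param_less_iff)
    with d(2)[of q] recovery[of q Plus x] path_diag[of q Plus x] show False by (auto simp: min_def split: if_splits)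
  qed
  then show ?thesis using d(1) by auto
qed

lemma tau_less_1: "tau x < 1"
proof -
  have "eventually (\<lambda>t. \<beta> t Plus x (x + e2) > W x) (at_left 1)"
    using blowup_e2 by (auto simp: filterlim_at_top_dense)
  then obtain d where d: "d < 1" "\<And>t. d < t \<Longrightarrow> t < 1 \<Longrightarrow> \<beta> t Plus x (x + e2) > W x"
    by (auto simp: eventually_at_left_field)
  obtain q where q: "q \<in> \<rat>" "max d 0 < q" "q < 1" using Rats_dense_in_real[of "max d 0" 1] d by auto
  with d(2)[of q] recovery[of q Plus x] path_diag[of q Plus x] have "\<beta> q Plus (x + e1) (x + e2) > 0"
    by (auto simp: min_def split: if_splits)
  then show ?thesis using q by (auto simp: interface_param_less_iff intro!: bexI[of _ q])
qed

text \<open>At \<open>q = tau x\<close> the right limit gives a nonnegative value and the absence of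
  ties makes it positive. Through this equivalence \<open>fresh_split\<close> can speak about
  \<open>tau\<close> with rationals only.\<close>

lemma rational_diag_pos_iff:
  assumes "q \<in> \<rat>" "0 < q" "q < 1"
  shows "\<beta> q Plus (x + e1) (x + e2) > 0 \<longleftrightarrow> tau x \<le> q"
proof -
  have "\<beta> q Plus (x + e1) (x + e2) > 0" if "tau x = q"
  proof -
    have "0 \<le> \<beta> q Plus (x + e1) (x + e2)"
    proof (rule tendsto_lowerbound[OF right_limit[of q Plus "x + e1" "x + e2"]])
      show "eventually (\<lambda>t. 0 \<le> \<beta> t Plus (x + e1) (x + e2)) (at_right q)"
        using eventually_at_right_real[of q 1] assms
        by (auto elim!: eventually_mono intro!: less_imp_le diag_pos_above_tau simp: that)
    qed (use assms in auto)
    moreover have "\<beta> q Plus (x + e1) (x + e2) \<noteq> 0"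
      using rational_noteq[of q x] assms path_diag[of q Plus x] by auto
    ultimately show ?thesis by simp
  qed
  then show ?thesis
    using diag_pos_above_tau[of x q Plus] diag_neg_below_tau[of q x Plus] assms by fastforce
qed

lemma below_tau:
  assumes "t < tau x" "0 < t" "t < 1"
  shows "\<beta> t \<sigma> x (x + e2) = W x" "W x < \<beta> t \<sigma> x (x + e1)"
  using diag_neg_below_tau[OF assms, of \<sigma>] recovery[of t \<sigma> x] path_diag[of t \<sigma> x] assms
  by (auto simp: min_def split: if_splits)

lemma above_tau:
  assumes "tau x < t" "0 < t" "t < 1"
  shows "\<beta> t \<sigma> x (x + e1) = W x" "W x < \<beta> t \<sigma> x (x + e2)"
  using diag_pos_above_tau[OF assms, of \<sigma>] recovery[of t \<sigma> x] path_diag[of t \<sigma> x] assms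
  by (auto simp: min_def split: if_splits)

text \<open>\<open>Plus\<close> at the right end minus \<open>Minus\<close> at the left end is the
  mass of the closed interval, so this describes the complement of the support
  (\<open>supp_mu_eq\<close>) without mentioning a measure.\<close>

definition flat :: "real \<Rightarrow> site \<Rightarrow> site \<Rightarrow> bool" where
  "flat t x y \<longleftrightarrow> (\<exists>s u. 0 < s \<and> s < t \<and> t < u \<and> u < 1 \<and>
     (\<forall>a b. s \<le> a \<longrightarrow> a \<le> b \<longrightarrow> b \<le> u \<longrightarrow> \<beta> b Plus x y = \<beta> a Minus x y))"

lemma flat_refl: "0 < t \<Longrightarrow> t < 1 \<Longrightarrow> flat t x x"
  unfolding flat_def by (rule exI[of _ "t / 2"], rule exI[of _ "(t + 1) / 2"]) (auto simp: path_refl)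

lemma flat_sym: "flat t x y \<Longrightarrow> flat t y x" (is "_ \<Longrightarrow> ?thesis")
proof -
  assume "flat t x y"
  then obtain s u where "0 < s" "s < t" "t < u" "u < 1"
    "\<And>a b. s \<le> a \<Longrightarrow> a \<le> b \<Longrightarrow> b \<le> u \<Longrightarrow> \<beta> b Plus x y = \<beta> a Minus x y"
    unfolding flat_def by blast
  then show ?thesis
    unfolding flat_def
    by (intro exI[of _ s] exI[of _ u]) (auto simp: path_sym[of _ _ y x])
qed

lemma flat_trans:
  assumes "flat t x y" "flat t y z"
  shows "flat t x z"
proof -
  from assms(1) obtain s1 u1 where 1: "0 < s1" "s1 < t" "t < u1" "u1 < 1"
    "\<And>a b. s1 \<le> a \<Longrightarrow> a \<le> b \<Longrightarrow> b \<le> u1 \<Longrightarrow> \<beta> b Plus x y = \<beta> a Minus x y"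
    unfolding flat_def by blast
  from assms(2) obtain s2 u2 where 2: "0 < s2" "s2 < t" "t < u2" "u2 < 1"
    "\<And>a b. s2 \<le> a \<Longrightarrow> a \<le> b \<Longrightarrow> b \<le> u2 \<Longrightarrow> \<beta> b Plus y z = \<beta> a Minus y z"
    unfolding flat_def by blast
  show ?thesis
    unfolding flat_def
  proof (intro exI conjI allI impI)
    fix a b assume ab: "max s1 s2 \<le> a" "a \<le> b" "b \<le> min u1 u2"
    then have "0 < a" "a < 1" "0 < b" "b < 1" using 1(1,4) by auto
    then show "\<beta> b Plus x z = \<beta> a Minus x z"
      using 1(5)[of a b] 2(5)[of a b] ab cocycle[of a Minus x y z] cocycle[of b Plus x y z] by auto
  qed (use 1 2 in auto)
qed

lemma flat_nearby: "flat t x y \<Longrightarrow> \<exists>e>0. \<forall>s. \<bar>s - t\<bar> < e \<longrightarrow> flat s x y"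
proof -
  assume "flat t x y"
  then obtain s u where su: "0 < s" "s < t" "t < u" "u < 1"
    "\<And>a b. s \<le> a \<Longrightarrow> a \<le> b \<Longrightarrow> b \<le> u \<Longrightarrow> \<beta> b Plus x y = \<beta> a Minus x y"
    unfolding flat_def by blast
  have "flat r x y" if "\<bar>r - t\<bar> < min (t - s) (u - t)" for r
    unfolding flat_def using su that by (intro exI[of _ s] exI[of _ u]) auto
  then show ?thesis using su by (intro exI[of _ "min (t - s) (u - t)"]) auto
qed

lemma flat_const:
  assumes "flat t x y"
  obtains s u c where "0 < s" "s < t" "t < u" "u < 1" "\<And>a \<sigma>. a \<in> {s..u} \<Longrightarrow> \<beta> a \<sigma> x y = c"
proof -
  from assms obtain s u where su: "0 < s" "s < t" "t < u" "u < 1"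
    "\<And>a b. s \<le> a \<Longrightarrow> a \<le> b \<Longrightarrow> b \<le> u \<Longrightarrow> \<beta> b Plus x y = \<beta> a Minus x y"
    unfolding flat_def by blast
  have "\<beta> a \<sigma> x y = \<beta> s Minus x y" if "a \<in> {s..u}" for a \<sigma>
    using su(5)[of s a] su(5)[of s u] su(5)[of a u] that by (cases \<sigma>) auto
  with su that show thesis by blast
qed

lemma flat_e1_above_tau: "tau x < t \<Longrightarrow> t < 1 \<Longrightarrow> flat t x (x + e1)"
  unfolding flat_def using tau_gt_0[of x]
  by (intro exI[of _ "(tau x + t) / 2"] exI[of _ "(1 + t) / 2"]) (auto simp: above_tau(1))

lemma flat_e2_below_tau: "t < tau x \<Longrightarrow> 0 < t \<Longrightarrow> flat t x (x + e2)"
  unfolding flat_def using tau_less_1[of x]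
  by (intro exI[of _ "t / 2"] exI[of _ "(tau x + t) / 2"]) (auto simp: below_tau(1))

lemma not_flat_tau: "\<not> flat (tau x) x (x + e1)" "\<not> flat (tau x) x (x + e2)"
proof -
  { fix y assume "flat (tau x) x y"
    then obtain s u c where su: "0 < s" "s < tau x" "tau x < u" "u < 1"
       "\<And>a \<sigma>. a \<in> {s..u} \<Longrightarrow> \<beta> a \<sigma> x y = c"
      by (rule flat_const) blast
    then have "\<beta> s Plus x y = \<beta> u Plus x y" by auto
    with su have "\<exists>s u. 0 < s \<and> s < tau x \<and> tau x < u \<and> u < 1 \<and> \<beta> s Plus x y = \<beta> u Plus x y" by blast }
  note * = this
  show "\<not> flat (tau x) x (x + e1)"
  proof
    assume "flat (tau x) x (x + e1)"
    from *[OF this] obtain s u where "0 < s" "s < tau x" "tau x < u" "u < 1"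
      "\<beta> s Plus x (x + e1) = \<beta> u Plus x (x + e1)" by blast
    with below_tau(2)[of s x Plus] above_tau(1)[of x u Plus] show False by auto
  qed
  show "\<not> flat (tau x) x (x + e2)"
  proof
    assume "flat (tau x) x (x + e2)"
    from *[OF this] obtain s u where "0 < s" "s < tau x" "tau x < u" "u < 1"
      "\<beta> s Plus x (x + e2) = \<beta> u Plus x (x + e2)" by blast
    with below_tau(1)[of s x Plus] above_tau(2)[of x u Plus] show False by auto
  qed
qed

text \<open>The increment along \<open>e1\<close> can vary only at or below \<open>tau x\<close>,
  the one along \<open>e2\<close> only at or above it, and both vary at \<open>tau x\<close>. Part
  (a) is read off from this.\<close>

lemma not_flat_e1_e2_iff:
  assumes "0 < t" "t < 1"
  shows "\<not> flat t x (x + e1) \<and> \<not> flat t x (x + e2) \<longleftrightarrow> t = tau x"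
  using flat_e1_above_tau[of x t] flat_e2_below_tau[of t x] not_flat_tau[of x] assms by fastforce

text \<open>Away from every \<open>tau z\<close> one of the two edges at each site is flat, and a
  flat diagonal passes this on to the other edge. Read backwards, an unattained jump shows up
  between two neighbours on an antidiagonal, which then serves as boundary.\<close>

lemma flat_diag:
  assumes "0 < t" "t < 1" "\<And>z. t \<noteq> tau z" "\<And>z. flat t (z + e1) (z + e2)"
  shows "flat t x y"
proof (rule site_relation_all)
  have e: "flat t z (z + e1) \<or> flat t z (z + e2)" for z
    using not_flat_e1_e2_iff[of t z] assms by auto
  show "flat t z (z + e1)" "flat t z (z + e2)" for z
    using e[of z] assms(4)[of z] flat_trans flat_sym by blast+
qed (use assms flat_refl flat_sym flat_trans in blast)+

text \<open>Increments along \<open>e2\<close>, and the negatives of those along \<open>e1\<close>,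
  are nondecreasing in the direction and have Stieltjes measures. The cocycle property adds these up
  along a lattice path.\<close>

lemma ex_interval_values:
  assumes "0 < s0" "s0 < t0" "t0 < 1"
  shows "\<exists>\<nu>. has_interval_values \<nu> (\<lambda>t. \<beta> t Plus x y) (\<lambda>t. \<beta> t Minus x y) s0 t0"
proof (rule site_relation_all[where R = "\<lambda>x y. \<exists>\<nu>. has_interval_values \<nu> (\<lambda>t. \<beta> t Plus x y) (\<lambda>t. \<beta> t Minus x y) s0 t0"])
  have cong: "has_interval_values \<nu> Gp' Gm' s0 t0"
    if "has_interval_values \<nu> Gp Gm s0 t0" "\<And>t. s0 \<le> t \<Longrightarrow> t \<le> t0 \<Longrightarrow> Gp t = Gp' t \<and> Gm t = Gm' t" for \<nu> Gp Gm Gp' Gm'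
    using that unfolding has_interval_values_def by auto
  show "\<exists>\<nu>. has_interval_values \<nu> (\<lambda>t. \<beta> t Plus x x) (\<lambda>t. \<beta> t Minus x x) s0 t0" for x
    using assms by (intro exI[of _ "\<lambda>_. 0"]) (auto simp: has_interval_values_def signed_measure_def path_refl)
  show "\<exists>\<nu>. has_interval_values \<nu> (\<lambda>t. \<beta> t Plus y x) (\<lambda>t. \<beta> t Minus y x) s0 t0"
    if ex: "\<exists>\<nu>. has_interval_values \<nu> (\<lambda>t. \<beta> t Plus x y) (\<lambda>t. \<beta> t Minus x y) s0 t0" for x y
  proof -
    from ex obtain \<nu> where "has_interval_values \<nu> (\<lambda>t. \<beta> t Plus x y) (\<lambda>t. \<beta> t Minus x y) s0 t0" ..
    then show ?thesis
      by (intro exI, rule cong[OF has_interval_values_uminus]) (use assms in \<open>simp add: path_sym[of _ _ y x]\<close>)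
  qed
  show "\<exists>\<nu>. has_interval_values \<nu> (\<lambda>t. \<beta> t Plus x z) (\<lambda>t. \<beta> t Minus x z) s0 t0"
    if ex: "\<exists>\<nu>. has_interval_values \<nu> (\<lambda>t. \<beta> t Plus x y) (\<lambda>t. \<beta> t Minus x y) s0 t0"
       "\<exists>\<nu>. has_interval_values \<nu> (\<lambda>t. \<beta> t Plus y z) (\<lambda>t. \<beta> t Minus y z) s0 t0" for x y z
  proof -
    from ex obtain \<nu>1 \<nu>2 where "has_interval_values \<nu>1 (\<lambda>t. \<beta> t Plus x y) (\<lambda>t. \<beta> t Minus x y) s0 t0"
      "has_interval_values \<nu>2 (\<lambda>t. \<beta> t Plus y z) (\<lambda>t. \<beta> t Minus y z) s0 t0" by blast
    then show ?thesis
      by (intro exI, rule cong[OF has_interval_values_add]) (use assms in \<open>simp add: cocycle\<close>)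
  qed
  show "\<exists>\<nu>. has_interval_values \<nu> (\<lambda>t. \<beta> t Plus x (x + e2)) (\<lambda>t. \<beta> t Minus x (x + e2)) s0 t0" for x
    using assms by (intro ex_interval_values_mono mono_e2 jump_e2 left_limit right_limit) auto
  have neg: "\<exists>\<nu>. has_interval_values \<nu> (\<lambda>t. - \<beta> t Plus x (x + e1)) (\<lambda>t. - \<beta> t Minus x (x + e1)) s0 t0" for x
    using assms by (intro ex_interval_values_mono tendsto_minus left_limit right_limit)
      (auto intro: mono_e1 jump_e1)
  show "\<exists>\<nu>. has_interval_values \<nu> (\<lambda>t. \<beta> t Plus x (x + e1)) (\<lambda>t. \<beta> t Minus x (x + e1)) s0 t0" for x
  proof -
    from neg[of x] obtain \<nu> where
      "has_interval_values \<nu> (\<lambda>t. - \<beta> t Plus x (x + e1)) (\<lambda>t. - \<beta> t Minus x (x + e1)) s0 t0" ..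
    from has_interval_values_uminus[OF this] show ?thesis by auto
  qed
qed

lemma supp_mu_eq:
  assumes B: "\<And>t \<sigma> x y. 0 < t \<Longrightarrow> t < 1 \<Longrightarrow> B (dir_at t) \<sigma> x y \<omega> = \<beta> t \<sigma> x y"
  shows "supp_mu B x y \<omega> = dir_at ` {t. 0 < t \<and> t < 1 \<and> \<not> flat t x y}"
proof -
  have hiv: "has_interval_values (busemann_measure B x y \<omega> (dir_at ` {s0..t0}))
    (\<lambda>t. B (dir_at t) Plus x y \<omega>) (\<lambda>t. B (dir_at t) Minus x y \<omega>) s0 t0" if "0 < s0" "s0 < t0" "t0 < 1" for s0 t0
  proof -
    from ex_interval_values[OF that] obtain \<nu> where
      "has_interval_values \<nu> (\<lambda>t. \<beta> t Plus x y) (\<lambda>t. \<beta> t Minus x y) s0 t0" by blast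
    then have "has_interval_values \<nu> (\<lambda>t. B (dir_at t) Plus x y \<omega>) (\<lambda>t. B (dir_at t) Minus x y \<omega>) s0 t0"
      using that by (auto simp: has_interval_values_def B)
    then show ?thesis by (rule busemann_measure_interval_values[OF that])
  qed
  have supp_sub: "signed_support (dir_at ` {s0..t0}) \<nu> \<subseteq> dir_at ` {s0..t0}" for s0 t0 \<nu>
  proof -
    have "total_variation (restrict_space borel (dir_at ` {s0..t0})) \<nu> {} \<le> 0"
      unfolding total_variation_def
    proof (rule SUP_least)
      fix P assume "P \<in> {P. finite P \<and> P \<subseteq> sets (restrict_space borel (dir_at ` {s0..t0})) \<and> partition_on {} P}"
      then have "P = {}" by (auto simp: partition_on_def)
      then show "(\<Sum>S\<in>P. ennreal \<bar>\<nu> S\<bar>) \<le> 0" by simp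
    qed
    then show ?thesis unfolding signed_support_def by (intro Inter_lower) simp
  qed
  have eq: "supp_mu B x y \<omega> = (\<Union>(s0, t0)\<in>{(s0, t0). 0 < s0 \<and> s0 < t0 \<and> t0 < 1}.
      signed_support (dir_at ` {s0..t0}) (busemann_measure B x y \<omega> (dir_at ` {s0..t0})))"
  proof (rule set_eqI)
    fix \<xi>
    have "\<xi> \<in> supp_mu B x y \<omega> \<longleftrightarrow> (\<exists>\<zeta>\<in>ri_dirs. \<exists>\<eta>\<in>ri_dirs. dir_less \<zeta> \<eta> \<and>
       \<xi> \<in> signed_support (dir_cc \<zeta> \<eta>) (busemann_measure B x y \<omega> (dir_cc \<zeta> \<eta>)))"
      unfolding supp_mu_def by blast
    also have "\<dots> \<longleftrightarrow> (\<exists>s0\<in>{0<..<1}. \<exists>t0\<in>{0<..<1}. s0 < t0 \<and>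
       \<xi> \<in> signed_support (dir_at ` {s0..t0}) (busemann_measure B x y \<omega> (dir_at ` {s0..t0})))"
      unfolding ri_dirs_eq by (simp add: dir_intervals)
    finally show "\<xi> \<in> supp_mu B x y \<omega> \<longleftrightarrow> \<xi> \<in> (\<Union>(s0, t0)\<in>{(s0, t0). 0 < s0 \<and> s0 < t0 \<and> t0 < 1}.
      signed_support (dir_at ` {s0..t0}) (busemann_measure B x y \<omega> (dir_at ` {s0..t0})))"
      by force
  qed
  show ?thesis
  proof (intro equalityI subsetI)
    fix \<xi> assume "\<xi> \<in> supp_mu B x y \<omega>"
    then obtain s0 t0 where st: "0 < s0" "s0 < t0" "t0 < 1"
      and \<xi>: "\<xi> \<in> signed_support (dir_at ` {s0..t0}) (busemann_measure B x y \<omega> (dir_at ` {s0..t0}))"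
      unfolding eq by auto
    have "\<xi> \<in> dir_at ` {s0..t0}" by (rule subsetD[OF supp_sub \<xi>])
    then obtain t where t: "\<xi> = dir_at t" "s0 \<le> t" "t \<le> t0" by auto
    have "\<not> flat t x y"
    proof
      assume "flat t x y"
      then obtain s u where su: "0 < s" "s < t" "t < u" "u < 1"
        "\<And>a b. s \<le> a \<Longrightarrow> a \<le> b \<Longrightarrow> b \<le> u \<Longrightarrow> \<beta> b Plus x y = \<beta> a Minus x y"
        unfolding flat_def by blast
      have "\<forall>a b. s0 \<le> a \<longrightarrow> s \<le> a \<longrightarrow> a \<le> b \<longrightarrow> b \<le> u \<longrightarrow> b \<le> t0 \<longrightarrow>
          B (dir_at b) Plus x y \<omega> = B (dir_at a) Minus x y \<omega>"
        using st su by (simp add: B)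
      then have "dir_at t \<notin> signed_support (dir_at ` {s0..t0}) (busemann_measure B x y \<omega> (dir_at ` {s0..t0}))"
        using su(2,3) by (intro signed_support_interval_iff[OF hiv[OF st] t(2,3), THEN iffD2] exI conjI)
      with \<xi> t show False by simp
    qed
    then show "\<xi> \<in> dir_at ` {t. 0 < t \<and> t < 1 \<and> \<not> flat t x y}" using t st by auto
  next
    fix \<xi> assume "\<xi> \<in> dir_at ` {t. 0 < t \<and> t < 1 \<and> \<not> flat t x y}"
    then obtain t where t: "\<xi> = dir_at t" "0 < t" "t < 1" "\<not> flat t x y" by auto
    \<comment> \<open>A window with \<open>t\<close> in its interior: at an end point the support
      would test one side only.\<close>
    define s0 t0 where "s0 = t / 2" and "t0 = (t + 1) / 2"
    have st: "0 < s0" "s0 < t0" "t0 < 1" "s0 < t" "t < t0" using t by (auto simp: s0_def t0_def)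
    have "dir_at t \<in> signed_support (dir_at ` {s0..t0}) (busemann_measure B x y \<omega> (dir_at ` {s0..t0}))"
    proof (rule ccontr)
      assume "\<not> ?thesis"
      then obtain s u where su: "s < t" "t < u"
        "\<And>a b. s0 \<le> a \<Longrightarrow> s \<le> a \<Longrightarrow> a \<le> b \<Longrightarrow> b \<le> u \<Longrightarrow> b \<le> t0 \<Longrightarrow>
           B (dir_at b) Plus x y \<omega> = B (dir_at a) Minus x y \<omega>"
        using signed_support_interval_iff[OF hiv[OF st(1-3)], of t] st by auto
      have "flat t x y"
        unfolding flat_def
        using st su by (intro exI[of _ "max s s0"] exI[of _ "min u t0"]) (auto simp flip: B)
      with t show False by simp
    qed
    then show "\<xi> \<in> supp_mu B x y \<omega>"
      unfolding eq using st t by (intro UN_I[of "(s0, t0)"]) auto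
  qed
qed

lemma xi_star_eq:
  assumes B: "\<And>t \<sigma>. 0 < t \<Longrightarrow> t < 1 \<Longrightarrow> B (dir_at t) \<sigma> e1 e2 \<omega> = \<beta> t \<sigma> (x + e1) (x + e2)"
  shows "xi_star B \<omega> = dir_at (tau x)"
  unfolding xi_star_def
proof (rule the_equality, safe)
  show "dir_at (tau x) \<in> ri_dirs" using tau_gt_0 tau_less_1 by simp
  fix \<zeta> \<sigma> assume z: "\<zeta> \<in> ri_dirs"
  show "B \<zeta> \<sigma> e1 e2 \<omega> < 0" if "dir_less \<zeta> (dir_at (tau x))"
    using z that by (auto simp: ri_dirs_eq B diag_neg_below_tau)
  show "B \<zeta> \<sigma> e1 e2 \<omega> > 0" if "dir_less (dir_at (tau x)) \<zeta>"
    using z that by (auto simp: ri_dirs_eq B diag_pos_above_tau)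
next
  fix \<xi> :: dir
  assume "\<xi> \<in> ri_dirs" and *: "\<forall>\<zeta>\<in>ri_dirs. \<forall>\<sigma>. (dir_less \<zeta> \<xi> \<longrightarrow> B \<zeta> \<sigma> e1 e2 \<omega> < 0) \<and>
    (dir_less \<xi> \<zeta> \<longrightarrow> 0 < B \<zeta> \<sigma> e1 e2 \<omega>)"
  then obtain t where t: "\<xi> = dir_at t" "0 < t" "t < 1" by (auto simp: ri_dirs_eq)
  have **: "(s < t \<longrightarrow> \<beta> s Plus (x + e1) (x + e2) < 0) \<and> (t < s \<longrightarrow> 0 < \<beta> s Plus (x + e1) (x + e2))"
    if "0 < s" "s < 1" for s
    using *[rule_format, of "dir_at s" Plus] that B[of s Plus] by (simp add: t)
  \<comment> \<open>If \<open>t\<close> and \<open>tau x\<close> differed, the increment at their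
    midpoint would have both strict signs.\<close>
  have "\<not> t < tau x"
  proof
    assume "t < tau x"
    then show False
      using **[of "(t + tau x) / 2"] diag_neg_below_tau[of "(t + tau x) / 2" x Plus] t tau_less_1[of x] by auto
  qed
  moreover have "\<not> tau x < t"
  proof
    assume "tau x < t"
    then show False
      using **[of "(t + tau x) / 2"] diag_pos_above_tau[of x "(t + tau x) / 2" Plus] t tau_gt_0[of x] by auto
  qed
  ultimately show "\<xi> = dir_at (tau x)" using t by simp
qed

text \<open>Recovery together with the cocycle property reads B(x, z) = W x + max (B(x + e1, z))
  (B(x + e2, z)), which is the recursion of \<open>lpv\<close>.\<close>

lemma lpv_busemann:
  assumes "0 < t" "t < 1"
  shows "\<beta> t \<sigma> (level_site k j p) z = lpv (\<lambda>i p. W (level_site k (Suc i) p)) (\<lambda>p. \<beta> t \<sigma> (level_site k 0 p) z) j p"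
proof (induction j arbitrary: p)
  case (Suc j)
  have "\<beta> t \<sigma> (level_site k (Suc j) p) z = W (level_site k (Suc j) p) + max (\<beta> t \<sigma> (level_site k j p) z) (\<beta> t \<sigma> (level_site k j (p + 1)) z)"
    using recovery[OF assms, of \<sigma> "level_site k (Suc j) p"]
      cocycle[OF assms, of \<sigma> "level_site k (Suc j) p" "level_site k j p" z] cocycle[OF assms, of \<sigma> "level_site k (Suc j) p" "level_site k j (p + 1)" z]
    by auto
  then show ?case by (simp add: Suc)
qed simp

text \<open>On each side of \<open>t\<close> the increment is locally constant on a connected set,
  hence constant, and the one-sided limit identifies the constant.\<close>

lemma isolated_jump_const:
  assumes t: "0 < t" "t < 1"
    and iso: "e > 0" "\<And>s. 0 < \<bar>s - t\<bar> \<Longrightarrow> \<bar>s - t\<bar> < e \<Longrightarrow> 0 < s \<Longrightarrow> s < 1 \<Longrightarrow> flat s x y"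
  shows "\<exists>d>0. (\<forall>s. t - d < s \<and> s < t \<longrightarrow> \<beta> s Plus x y = \<beta> t Minus x y) \<and>
           (\<forall>s. t \<le> s \<and> s < t + d \<longrightarrow> \<beta> s Plus x y = \<beta> t Plus x y)"
proof -
  define d where "d = min e (min t (1 - t))"
  have d: "d > 0" "d \<le> e" "d \<le> t" "d \<le> 1 - t" using t iso by (auto simp: d_def)
  have const: "\<beta> a Plus x y = \<beta> b Plus x y"
    if A: "connected A" "a \<in> A" "b \<in> A" "\<And>s. s \<in> A \<Longrightarrow> flat s x y" for A a b
  proof (rule connected_local_const[OF A(1-3)], rule ballI)
    fix s assume "s \<in> A"
    with A(4) obtain l u c where lu: "l < s" "s < u" "\<And>a \<sigma>. a \<in> {l..u} \<Longrightarrow> \<beta> a \<sigma> x y = c"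
      using flat_const by metis
    have "eventually (\<lambda>b. b \<in> {l<..<u}) (at s within A)"
      unfolding eventually_at_topological using lu by (intro exI[of _ "{l<..<u}"]) auto
    then show "eventually (\<lambda>b. \<beta> s Plus x y = \<beta> b Plus x y) (at s within A)"
      by eventually_elim (use lu in auto)
  qed
  have L: "\<beta> s Plus x y = \<beta> t Minus x y" if s: "t - d < s" "s < t" for s
  proof -
    have "eventually (\<lambda>r. \<beta> r Plus x y = \<beta> s Plus x y) (at_left t)"
      using eventually_at_left_real[OF s(2)]
    proof (rule eventually_mono)
      fix r assume "r \<in> {s<..<t}"
      then show "\<beta> r Plus x y = \<beta> s Plus x y"
        using s d by (intro const[of "{s..r}"]) (auto intro!: iso)
    qed
    then have "((\<lambda>r. \<beta> r Plus x y) \<longlongrightarrow> \<beta> s Plus x y) (at_left t)" by (rule tendsto_eventually)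
    from tendsto_unique[OF _ this left_limit[OF t]] show ?thesis by simp
  qed
  have R: "\<beta> s Plus x y = \<beta> t Plus x y" if s: "t < s" "s < t + d" for s
  proof -
    have "eventually (\<lambda>r. \<beta> r Plus x y = \<beta> s Plus x y) (at_right t)"
      using eventually_at_right_real[OF s(1)]
    proof (rule eventually_mono)
      fix r assume "r \<in> {t<..<s}"
      then show "\<beta> r Plus x y = \<beta> s Plus x y"
        using s d by (intro const[of "{r..s}"]) (auto intro!: iso)
    qed
    then have "((\<lambda>r. \<beta> r Plus x y) \<longlongrightarrow> \<beta> s Plus x y) (at_right t)" by (rule tendsto_eventually)
    from tendsto_unique[OF _ this right_limit[OF t]] show ?thesis by simp
  qed
  show ?thesis using d L R by (intro exI[of _ d]) (auto simp: le_less)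
qed

end

section \<open>Isolated jumps and fresh splits on one sample path\<close>

context busemann_path
begin

text \<open>If both one-sided values agreed, the \<open>Plus\<close> increment would be constant
  across \<open>t\<close>, left limits would carry this over to \<open>Minus\<close>, and
  \<open>t\<close> would be flat. This is what makes the gap \<open>h\<close> positive.\<close>

lemma isolated_not_flat_jump:
  assumes t: "0 < t" "t < 1"
    and iso: "e > 0" "\<And>s. 0 < \<bar>s - t\<bar> \<Longrightarrow> \<bar>s - t\<bar> < e \<Longrightarrow> 0 < s \<Longrightarrow> s < 1 \<Longrightarrow> flat s x y"
    and nf: "\<not> flat t x y"
  shows "\<beta> t Minus x y \<noteq> \<beta> t Plus x y"
proof
  assume eq: "\<beta> t Minus x y = \<beta> t Plus x y"
  have "\<exists>d>0. (\<forall>s. t - d < s \<and> s < t \<longrightarrow> \<beta> s Plus x y = \<beta> t Minus x y) \<and>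
           (\<forall>s. t \<le> s \<and> s < t + d \<longrightarrow> \<beta> s Plus x y = \<beta> t Plus x y)"
    by (rule isolated_jump_const[OF t iso(1)]) (use iso(2) in blast)
  then obtain d where d: "d > 0" "\<And>s. t - d < s \<Longrightarrow> s < t + d \<Longrightarrow> \<beta> s Plus x y = \<beta> t Plus x y"
    using eq by (metis linorder_not_le)
  define l u where "l = max (t - d) 0" and "u = min (t + d) 1"
  have lu: "0 \<le> l" "l < t" "t < u" "u \<le> 1" using t d(1) by (auto simp: l_def u_def)
  define c where "c = \<beta> t Plus x y"
  have P: "\<beta> s Plus x y = c" if "l < s" "s < u" for s
    using d(2)[of s] that unfolding c_def by (auto simp: l_def u_def)
  have M: "\<beta> s Minus x y = c" if s: "l < s" "s < u" for s
  proof -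
    have "eventually (\<lambda>r. \<beta> r Plus x y = c) (at_left s)"
      using eventually_at_left_real[OF s(1)] by eventually_elim (use P s in auto)
    then have "((\<lambda>r. \<beta> r Plus x y) \<longlongrightarrow> c) (at_left s)" by (rule tendsto_eventually)
    moreover have "((\<lambda>r. \<beta> r Plus x y) \<longlongrightarrow> \<beta> s Minus x y) (at_left s)"
      using s lu by (intro left_limit) auto
    ultimately show ?thesis using tendsto_unique[of "at_left s"] by simp
  qed
  have "flat t x y"
    unfolding flat_def using lu P M
    by (intro exI[of _ "(l + t) / 2"] exI[of _ "(t + u) / 2"]) (auto simp: field_simps)
  with nf show False by simp
qed

text \<open>The one-sided limits at \<open>t\<close> are two boundary profiles that
  \<open>two_colour_paths\<close> separates. Everything involved concerns finitely many increments,
  so parameters from a countable set can describe it.\<close>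

lemma ex_fresh_split:
  fixes a b :: "nat \<Rightarrow> real"
  assumes t: "0 < t" "t < 1"
    and nf: "\<not> flat t x y" and fresh: "\<And>z. t \<noteq> tau z"
    and iso: "\<And>x y. \<exists>e>0. \<forall>s. 0 < \<bar>s - t\<bar> \<longrightarrow> \<bar>s - t\<bar> < e \<longrightarrow> 0 < s \<longrightarrow> s < 1 \<longrightarrow> flat s x y"
    and sublin: "\<And>q k \<epsilon>. q \<in> \<rat> \<Longrightarrow> 0 < q \<Longrightarrow> q < 1 \<Longrightarrow> \<epsilon> > 0 \<Longrightarrow>
      \<exists>C. \<forall>p. \<bar>\<beta> q Plus (level_site k 0 p) (level_site k 0 (p + 1))\<bar> \<le> C + \<epsilon> * \<bar>real_of_int p\<bar>"
    and pairs: "\<And>\<eta>. \<eta> > 0 \<Longrightarrow> \<exists>n. a n < b n \<and> b n - a n < \<eta>"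
  shows "\<exists>k p0 m p S N n. \<exists>q1\<in>\<rat>. \<exists>q2\<in>\<rat>. 0 < q1 \<and> q1 < q2 \<and> q2 < 1 \<and> finite S \<and>
    fresh_split (a n) (b n) (\<lambda>q. \<beta> q Plus) k p0 q1 q2 m p S (1 / real (Suc N))"
proof -
  obtain z where z: "\<not> flat t (z + e1) (z + e2)" using flat_diag[OF t fresh] nf by blast
  \<comment> \<open>The antidiagonal through \<open>z + e1\<close> and \<open>z + e2\<close>; the
    jump then lies between positions \<open>p0\<close> and \<open>p0 + 1\<close>.\<close>
  define k where "k = level z + 1"
  define p0 where "p0 = fst z"
  have z_st: "level_site k 0 p0 = z + e2" "level_site k 0 (p0 + 1) = z + e1"
    by (auto simp: level_site_def k_def p0_def level_def e1_def e2_def intro: prod_eqI)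
  define o' where "o' = level_site k 0 0"
  define f1 where "f1 p = \<beta> t Minus (level_site k 0 p) o'" for p
  define f2 where "f2 p = \<beta> t Plus (level_site k 0 p) o'" for p
  have nb: "level_site k 0 p = level_site k (Suc 0) p + e2" "level_site k 0 (p + 1) = level_site k (Suc 0) p + e1" for p
    by simp_all
  have f1_diff: "f1 (p + 1) - f1 p = \<beta> t Minus (level_site k (Suc 0) p + e1) (level_site k (Suc 0) p + e2)" for p
    using cocycle[OF t, of Minus "level_site k 0 (p + 1)" "level_site k 0 p" o'] by (simp add: f1_def)
  have f2_diff: "f2 (p + 1) - f2 p = \<beta> t Plus (level_site k (Suc 0) p + e1) (level_site k (Suc 0) p + e2)" for p
    using cocycle[OF t, of Plus "level_site k 0 (p + 1)" "level_site k 0 p" o'] by (simp add: f2_def)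
  define h where "h = \<beta> t Plus (z + e1) (z + e2) - \<beta> t Minus (z + e1) (z + e2)"
  have h: "h > 0"
    using iso[of "z + e1" "z + e2"] isolated_not_flat_jump[OF t _ _ z] jump_diag[OF t, of z]
    unfolding h_def by (metis diff_gt_0_iff_gt less_eq_real_def)
  obtain n where n: "a n < b n" "b n - a n < h / 2" using pairs[of "h / 2"] h by auto
  have "\<exists>u j p. (\<forall>i t. u i t \<in> {a n, b n}) \<and> lpv u f1 j (p + 1) < lpv u f1 j p \<and>
           lpv u f2 j p < lpv u f2 j (p + 1)"
  proof (rule two_colour_paths[where ?p0.0 = p0 and h = h])
    show "f1 (p + 1) - f2 (p + 1) \<le> f1 p - f2 p" for p
      using f1_diff[of p] f2_diff[of p] jump_diag[OF t, of "level_site k (Suc 0) p"] by linarith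
    show "f1 (p0 + 1) - f2 (p0 + 1) + h \<le> f1 p0 - f2 p0"
      using f1_diff[of p0] f2_diff[of p0] z_st by (simp add: h_def)
    show "\<exists>C. \<forall>p. \<bar>f1 (p + 1) - f1 p\<bar> \<le> C + \<epsilon> * \<bar>real_of_int p\<bar>" if \<epsilon>: "\<epsilon> > 0" for \<epsilon>
    proof -
      \<comment> \<open>Growth is controlled at rational directions only; monotonicity sandwiches
        the increment at \<open>t\<close> between two of them.\<close>
      obtain q1 q2 where q: "q1 \<in> \<rat>" "0 < q1" "q1 < t" "q2 \<in> \<rat>" "t < q2" "q2 < 1"
        using Rats_dense_in_real[of 0 t] Rats_dense_in_real[of t 1] t by auto
      obtain C1 where C1: "\<And>p. \<bar>\<beta> q1 Plus (level_site k 0 p) (level_site k 0 (p + 1))\<bar> \<le> C1 + \<epsilon> * \<bar>real_of_int p\<bar>"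
        using sublin[of q1 \<epsilon> k] q t \<epsilon> by auto
      obtain C2 where C2: "\<And>p. \<bar>\<beta> q2 Plus (level_site k 0 p) (level_site k 0 (p + 1))\<bar> \<le> C2 + \<epsilon> * \<bar>real_of_int p\<bar>"
        using sublin[of q2 \<epsilon> k] q t \<epsilon> by auto
      have "\<bar>f1 (p + 1) - f1 p\<bar> \<le> max C1 C2 + \<epsilon> * \<bar>real_of_int p\<bar>" for p
      proof -
        have "\<beta> q1 Plus (level_site k 0 (p + 1)) (level_site k 0 p) \<le> f1 (p + 1) - f1 p"
          "f1 (p + 1) - f1 p \<le> \<beta> q2 Plus (level_site k 0 (p + 1)) (level_site k 0 p)"
          using mono_diag[of q1 t Plus "level_site k (Suc 0) p" Minus] mono_diag[of t q2 Minus "level_site k (Suc 0) p" Plus]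
            q t f1_diff[of p] by auto
        then show ?thesis
          using C1[of p] C2[of p] q t path_sym[of q1 Plus "level_site k 0 (p + 1)" "level_site k 0 p"]
            path_sym[of q2 Plus "level_site k 0 (p + 1)" "level_site k 0 p"] by auto
      qed
      then show ?thesis by blast
    qed
  qed (use n in auto)
  then obtain u m p where u: "\<And>i t. u i t \<in> {a n, b n}"
    and less1: "lpv u f1 m (p + 1) < lpv u f1 m p" and less2: "lpv u f2 m p < lpv u f2 m (p + 1)"
    by blast
  \<comment> \<open>Restricted to the places on which the values at \<open>p\<close> and
    \<open>p + 1\<close> depend, hence finite.\<close>
  define S where "S = {(i, t). i < m \<and> p \<le> t \<and> t \<le> p + int m + 1 \<and> u i t = b n}"
  have "S \<subseteq> {..<m} \<times> {p..p + int m + 1}" by (auto simp: S_def)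
  then have finS: "finite S" by (rule finite_subset) auto
  have conf: "config (a n) (b n) S i s = u i s" if "i < m" "p \<le> s" "s \<le> p + int m + 1" for i s
    using u[of i s] that by (auto simp: config_def S_def)
  \<comment> \<open>Rebased from \<open>o'\<close> to position \<open>p\<close>, as
    \<open>fresh_split\<close> requires; this adds a constant to each profile and preserves
    comparisons.\<close>
  define F where "F \<sigma> p' = \<beta> t \<sigma> (level_site k 0 p') (level_site k 0 p)" for \<sigma> p'
  have lpvF: "lpv (config (a n) (b n) S) (F Minus) m p' = lpv u f1 m p' + \<beta> t Minus o' (level_site k 0 p)"
    "lpv (config (a n) (b n) S) (F Plus) m p' = lpv u f2 m p' + \<beta> t Plus o' (level_site k 0 p)"
    if "p' \<in> {p, p + 1}" for p'
    unfolding lpv_add_const[symmetric]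
  proof -
    have F: "F Minus s = f1 s + \<beta> t Minus o' (level_site k 0 p)" "F Plus s = f2 s + \<beta> t Plus o' (level_site k 0 p)" for s
      using cocycle[OF t, of _ "level_site k 0 s" o' "level_site k 0 p"] by (auto simp: F_def f1_def f2_def)
    have c: "config (a n) (b n) S i s = u i s" if "i < m" "p' \<le> s" "s \<le> p' + int m" for i s
      using that \<open>p' \<in> {p, p + 1}\<close> by (intro conf) auto
    show "lpv (config (a n) (b n) S) (F Minus) m p' = lpv u (\<lambda>p'. f1 p' + \<beta> t Minus o' (level_site k 0 p)) m p'"
      "lpv (config (a n) (b n) S) (F Plus) m p' = lpv u (\<lambda>p'. f2 p' + \<beta> t Plus o' (level_site k 0 p)) m p'"
      using c F by (auto intro: lpv_cong)
  qed
  define g1 where "g1 = lpv u f1 m p - lpv u f1 m (p + 1)"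
  define g2 where "g2 = lpv u f2 m (p + 1) - lpv u f2 m p"
  have "min g1 g2 > 0" using less1 less2 by (simp add: g1_def g2_def)
  then obtain N where N: "1 / real (Suc N) < min g1 g2"
    using reals_Archimedean[of "min g1 g2"] by (auto simp: inverse_eq_divide)
  have "\<exists>d>0. (\<forall>s. t - d < s \<and> s < t \<longrightarrow> \<beta> s Plus x y = \<beta> t Minus x y) \<and>
           (\<forall>s. t \<le> s \<and> s < t + d \<longrightarrow> \<beta> s Plus x y = \<beta> t Plus x y)" for x y
  proof -
    obtain e where "e > 0" "\<And>s. 0 < \<bar>s - t\<bar> \<Longrightarrow> \<bar>s - t\<bar> < e \<Longrightarrow> 0 < s \<Longrightarrow> s < 1 \<Longrightarrow> flat s x y"
      using iso[of x y] by blast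
    then show ?thesis by (intro isolated_jump_const[OF t])
  qed
  then obtain dd where dd: "\<And>x y. dd x y > 0"
    "\<And>x y s. t - dd x y < s \<Longrightarrow> s < t \<Longrightarrow> \<beta> s Plus x y = \<beta> t Minus x y"
    "\<And>x y s. t \<le> s \<Longrightarrow> s < t + dd x y \<Longrightarrow> \<beta> s Plus x y = \<beta> t Plus x y"
    by metis
  \<comment> \<open>Within distance \<open>d\<close> of \<open>t\<close>, all of these finitely many
    increments equal their one-sided values.\<close>
  define d where "d = Min (insert (dd (level_site k 0 p0) (level_site k 0 (p0 + 1)))
    ((\<lambda>p'. dd (level_site k 0 p') (level_site k 0 p)) ` {p..p + int m + 1}))"
  have d: "d > 0" unfolding d_def using dd(1) by (subst Min_gr_iff) auto
  have d_le: "d \<le> dd (level_site k 0 p0) (level_site k 0 (p0 + 1))"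
    "\<And>p'. p' \<in> {p..p + int m + 1} \<Longrightarrow> d \<le> dd (level_site k 0 p') (level_site k 0 p)"
    unfolding d_def by (rule Min_le; auto)+
  obtain q1 where q1: "q1 \<in> \<rat>" "max (t - d) 0 < q1" "q1 < t"
    using Rats_dense_in_real[of "max (t - d) 0" t] t d by auto
  obtain q2 where q2: "q2 \<in> \<rat>" "t < q2" "q2 < min (t + d) 1"
    using Rats_dense_in_real[of t "min (t + d) 1"] t d by auto
  define D where "D q = \<beta> q Plus (level_site k 0 p0) (level_site k 0 (p0 + 1))" for q
  define DM where "DM = \<beta> t Minus (level_site k 0 p0) (level_site k 0 (p0 + 1))"
  have DM: "DM \<noteq> D t"
    using h path_sym[OF t, of Minus "z + e1" "z + e2"] path_sym[OF t, of Plus "z + e1" "z + e2"]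
    by (simp add: D_def DM_def z_st h_def)
  have D_left: "D q = DM" if "q1 \<le> q" "q < t" for q
    using dd(2)[of "level_site k 0 p0" "level_site k 0 (p0 + 1)" q] d_le(1) q1 that by (simp add: D_def DM_def)
  have D_right: "D q = D t" if "t \<le> q" "q \<le> q2" for q
    using dd(3)[of q "level_site k 0 p0" "level_site k 0 (p0 + 1)"] d_le(1) q2 that by (simp add: D_def)
  have F_left: "\<beta> q Plus (level_site k 0 p') (level_site k 0 p) = F Minus p'" if "q1 \<le> q" "q < t" "p' \<in> {p..p + int m + 1}" for q p'
    using dd(2)[of "level_site k 0 p'" "level_site k 0 p" q] d_le(2)[OF that(3)] q1 that by (simp add: F_def)
  have F_right: "\<beta> q Plus (level_site k 0 p') (level_site k 0 p) = F Plus p'" if "t \<le> q" "q \<le> q2" "p' \<in> {p..p + int m + 1}" for q p'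
    using dd(3)[of q "level_site k 0 p'" "level_site k 0 p"] d_le(2)[OF that(3)] q2 that by (simp add: F_def)
  have lpv_q: "lpv (config (a n) (b n) S) (\<lambda>t. \<beta> q1 Plus (level_site k 0 t) (level_site k 0 p)) m p' = lpv (config (a n) (b n) S) (F Minus) m p'"
    "lpv (config (a n) (b n) S) (\<lambda>t. \<beta> q2 Plus (level_site k 0 t) (level_site k 0 p)) m p' = lpv (config (a n) (b n) S) (F Plus) m p'"
    if "p' \<in> {p, p + 1}" for p'
  proof -
    have "s \<in> {p..p + int m + 1}" if "p' \<le> s" "s \<le> p' + int m" for s
      using that \<open>p' \<in> {p, p + 1}\<close> by auto
    then show "lpv (config (a n) (b n) S) (\<lambda>t. \<beta> q1 Plus (level_site k 0 t) (level_site k 0 p)) m p' = lpv (config (a n) (b n) S) (F Minus) m p'"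
      "lpv (config (a n) (b n) S) (\<lambda>t. \<beta> q2 Plus (level_site k 0 t) (level_site k 0 p)) m p' = lpv (config (a n) (b n) S) (F Plus) m p'"
      using F_left[of q1] F_right[of q2] q1 q2 by (auto intro!: lpv_cong)
  qed
  have "fresh_split (a n) (b n) (\<lambda>q. \<beta> q Plus) k p0 q1 q2 m p S (1 / real (Suc N))"
    unfolding fresh_split_def D_def[symmetric]
  proof (intro conjI ballI)
    fix q assume "q \<in> \<rat> \<inter> {q1..q2}"
    then have q: "q1 \<le> q" "q \<le> q2" by auto
    show "(\<forall>t\<in>{p..p + int m + 1}. \<beta> q Plus (level_site k 0 t) (level_site k 0 p) = \<beta> q1 Plus (level_site k 0 t) (level_site k 0 p)) \<and> D q \<noteq> D q2 \<or>
      (\<forall>t\<in>{p..p + int m + 1}. \<beta> q Plus (level_site k 0 t) (level_site k 0 p) = \<beta> q2 Plus (level_site k 0 t) (level_site k 0 p)) \<and> D q = D q2"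
    proof (cases "q < t")
      case True
      then show ?thesis using q q1 q2 F_left[of q] F_left[of q1] D_left[of q] D_right[of q2] DM by auto
    next
      case False
      then show ?thesis using q q1 q2 F_right[of q] F_right[of q2] D_right[of q] D_right[of q2] by auto
    qed
  next
    show "D q1 \<noteq> D q2" using q1 q2 D_left[of q1] D_right[of q2] DM by auto
    show "lpv (config (a n) (b n) S) (\<lambda>t. \<beta> q1 Plus (level_site k 0 t) (level_site k 0 p)) m (p + 1) + 1 / real (Suc N) <
      lpv (config (a n) (b n) S) (\<lambda>t. \<beta> q1 Plus (level_site k 0 t) (level_site k 0 p)) m p"
      using N lpv_q(1)[of p] lpv_q(1)[of "p + 1"] lpvF(1)[of p] lpvF(1)[of "p + 1"] by (simp add: g1_def)
    show "lpv (config (a n) (b n) S) (\<lambda>t. \<beta> q2 Plus (level_site k 0 t) (level_site k 0 p)) m p + 1 / real (Suc N) <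
      lpv (config (a n) (b n) S) (\<lambda>t. \<beta> q2 Plus (level_site k 0 t) (level_site k 0 p)) m (p + 1)"
      using N lpv_q(2)[of p] lpv_q(2)[of "p + 1"] lpvF(2)[of p] lpvF(2)[of "p + 1"] by (simp add: g2_def)
  next
    fix z' assume "z' \<in> {z. k \<le> level z}"
    \<comment> \<open>A rational strictly between \<open>t\<close> and \<open>tau z'\<close> lies
      past exactly one of the two, and so separates them.\<close>
    show "\<exists>q\<in>\<rat> \<inter> {q1..q2}. (0 < \<beta> q Plus (z' + e1) (z' + e2)) \<noteq> (D q = D q2)"
    proof (cases "tau z' < t")
      case True
      then obtain q where q: "q \<in> \<rat>" "max (tau z') q1 < q" "q < t"
        using Rats_dense_in_real[of "max (tau z') q1" t] q1 by auto
      then show ?thesis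
        using q1 q2 t rational_diag_pos_iff[of q z'] D_left[of q] D_right[of q2] DM by (intro bexI[of _ q]) auto
    next
      case False
      then have "t < tau z'" using fresh[of z'] by simp
      then obtain q where q: "q \<in> \<rat>" "t < q" "q < min (tau z') q2"
        using Rats_dense_in_real[of t "min (tau z') q2"] q2 by auto
      then show ?thesis
        using q1 q2 t rational_diag_pos_iff[of q z'] D_right[of q] D_right[of q2] by (intro bexI[of _ q]) auto
    qed
  qed
  with q1 q2 t finS show ?thesis
    by (intro exI[of _ k] exI[of _ p0] exI[of _ m] exI[of _ p] exI[of _ S] exI[of _ N] exI[of _ n]
        bexI[of _ q1] bexI[of _ q2]) auto
qed

text \<open>On the rationals of [q1, q2] the diagonal increment at \<open>y\<close> has only two
  values, negative before the boundary jump and positive after it, so \<open>tau y\<close> is the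
  location of that jump. Each last-passage value is off by at most \<open>m \<delta>\<close>, and
  the margin \<epsilon> absorbs two such errors.\<close>

lemma fresh_split_tau:
  assumes fs: "fresh_split a b (\<lambda>q. \<beta> q Plus) k p0 q1 q2 m p S \<epsilon>"
    and q12: "q1 \<in> \<rat>" "q2 \<in> \<rat>" "0 < q1" "q1 < q2" "q2 < 1"
    and W: "\<And>i t. i < m \<Longrightarrow> p \<le> t \<Longrightarrow> t \<le> p + int m + 1 \<Longrightarrow> \<bar>W (level_site k (Suc i) t) - config a b S i t\<bar> \<le> \<delta>"
    and \<delta>: "2 * (real m * \<delta>) \<le> \<epsilon>"
    and y: "y = level_site k (Suc m) p"
  shows "(\<forall>z. k \<le> level z \<longrightarrow> tau z \<noteq> tau y)"
    and "q1 < tau y" "tau y \<le> q2"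
    and "\<beta> (tau y) Minus (y + e1) (y + e2) \<noteq> \<beta> (tau y) Plus (y + e1) (y + e2)"
proof -
  define V where "V q p' = \<beta> q Plus (level_site k m p') (level_site k 0 p)" for q p'
  define L where "L q = \<beta> q Plus (y + e1) (y + e2)" for q
  define D where "D q = \<beta> q Plus (level_site k 0 p0) (level_site k 0 (p0 + 1))" for q
  let ?W = "\<lambda>i p. W (level_site k (Suc i) p)"
  have V: "V q p' = lpv ?W (\<lambda>p'. \<beta> q Plus (level_site k 0 p') (level_site k 0 p)) m p'" if "q1 \<le> q" "q \<le> q2" for q p'
    using lpv_busemann[of q Plus k m p' "level_site k 0 p"] that q12 by (simp add: V_def)
  have L: "L q = V q (p + 1) - V q p" if "q1 \<le> q" "q \<le> q2" for q
    using cocycle[of q Plus "level_site k m (p + 1)" "level_site k m p" "level_site k 0 p"] that q12 by (simp add: L_def V_def y)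
  have lip: "\<bar>V q p' - lpv (config a b S) (\<lambda>p'. \<beta> q Plus (level_site k 0 p') (level_site k 0 p)) m p'\<bar> \<le> real m * \<delta>"
    if "q1 \<le> q" "q \<le> q2" "p' \<in> {p, p + 1}" for q p'
  proof -
    have "\<bar>lpv ?W (\<lambda>p'. \<beta> q Plus (level_site k 0 p') (level_site k 0 p)) m p' -
        lpv (config a b S) (\<lambda>p'. \<beta> q Plus (level_site k 0 p') (level_site k 0 p)) m p'\<bar> \<le> (\<Sum>i<m. \<delta>)"
      using that(3) by (intro lpv_lipschitz W) auto
    then show ?thesis using V[OF that(1,2)] by simp
  qed
  have L1: "L q1 < 0"
    using fs lip[of q1 p] lip[of q1 "p + 1"] L[of q1] \<delta> q12 unfolding fresh_split_def by auto
  have L2: "L q2 > 0"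
    using fs lip[of q2 p] lip[of q2 "p + 1"] L[of q2] \<delta> q12 unfolding fresh_split_def by auto
  have dich: "L q = L q1 \<and> D q \<noteq> D q2 \<or> L q = L q2 \<and> D q = D q2" if q: "q \<in> \<rat>" "q1 \<le> q" "q \<le> q2" for q
  proof -
    have cong: "L q = L q'" if "\<forall>t\<in>{p..p + int m + 1}. \<beta> q Plus (level_site k 0 t) (level_site k 0 p) = \<beta> q' Plus (level_site k 0 t) (level_site k 0 p)"
      "q' \<in> {q1, q2}" for q'
    proof -
      have "V q p' = V q' p'" if p': "p' \<in> {p, p + 1}" for p'
        using \<open>q' \<in> {q1, q2}\<close> q q12 p' \<open>\<forall>t\<in>_. _\<close> by (subst (1 2) V) (auto intro!: lpv_cong)
      then show ?thesis using L[of q] L[of q'] q q12 \<open>q' \<in> {q1, q2}\<close> by auto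
    qed
    have "q \<in> \<rat> \<inter> {q1..q2}" using q by auto
    with fs have "(\<forall>t\<in>{p..p + int m + 1}. \<beta> q Plus (level_site k 0 t) (level_site k 0 p) = \<beta> q1 Plus (level_site k 0 t) (level_site k 0 p)) \<and> D q \<noteq> D q2 \<or>
      (\<forall>t\<in>{p..p + int m + 1}. \<beta> q Plus (level_site k 0 t) (level_site k 0 p) = \<beta> q2 Plus (level_site k 0 t) (level_site k 0 p)) \<and> D q = D q2"
      unfolding fresh_split_def D_def by blast
    then show ?thesis using cong[of q1] cong[of q2] by blast
  qed
  have sign: "tau y \<le> q \<longleftrightarrow> D q = D q2" "tau y \<le> q \<longleftrightarrow> L q > 0" if "q \<in> \<rat>" "q1 \<le> q" "q \<le> q2" for q
    using dich[OF that] rational_diag_pos_iff[of q y] that q12 L1 L2 by (auto simp: L_def)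
  show tau_y: "q1 < tau y" "tau y \<le> q2"
    using sign(2)[of q1] sign(2)[of q2] L1 L2 q12 by auto
  show "\<forall>z. k \<le> level z \<longrightarrow> tau z \<noteq> tau y"
  proof (intro allI impI notI)
    \<comment> \<open>Equal parameters would give equal signs at all rationals in the window,
      against the last clause of \<open>fresh_split\<close>.\<close>
    fix z assume "k \<le> level z" "tau z = tau y"
    then have "\<exists>q\<in>\<rat> \<inter> {q1..q2}. (\<beta> q Plus (z + e1) (z + e2) > 0) \<noteq> (D q = D q2)"
      using fs unfolding fresh_split_def D_def by blast
    then obtain q where q: "q \<in> \<rat>" "q1 \<le> q" "q \<le> q2"
      "(\<beta> q Plus (z + e1) (z + e2) > 0) \<noteq> (D q = D q2)"
      by (metis (no_types, lifting) IntE atLeastAtMost_iff)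
    then show False
      using rational_diag_pos_iff[of q z] sign(1)[of q] q12 \<open>tau z = tau y\<close> by auto
  qed
  have t: "0 < tau y" "tau y < 1" by (auto intro: tau_gt_0 tau_less_1)
  \<comment> \<open>The left limit stays at or below the negative value \<open>L q1\<close> and the
    right limit is nonnegative, so the increment really jumps.\<close>
  have "\<beta> (tau y) Minus (y + e1) (y + e2) \<le> L q1"
  proof (rule tendsto_upperbound[OF left_limit[OF t, of Plus "y + e1" "y + e2"]])
    show "eventually (\<lambda>s. \<beta> s Plus (y + e1) (y + e2) \<le> L q1) (at_left (tau y))"
      using eventually_at_left_real[OF tau_y(1)]
    proof eventually_elim
      case (elim s)
      then obtain q where q: "q \<in> \<rat>" "s < q" "q < tau y" using Rats_dense_in_real[of s "tau y"] by auto
      then have "L q = L q1" using dich[of q] sign[of q] elim tau_y by auto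
      then show ?case using mono_diag[of s q Plus y Plus] q elim q12 t by (auto simp: L_def)
    qed
  qed simp
  moreover have "0 \<le> \<beta> (tau y) Plus (y + e1) (y + e2)"
  proof (rule tendsto_lowerbound[OF right_limit[OF t, of Plus "y + e1" "y + e2"]])
    show "eventually (\<lambda>s. 0 \<le> \<beta> s Plus (y + e1) (y + e2)) (at_right (tau y))"
      using eventually_at_right_real[OF t(2)]
      by eventually_elim (use t in \<open>auto intro!: less_imp_le diag_pos_above_tau\<close>)
  qed simp
  ultimately show "\<beta> (tau y) Minus (y + e1) (y + e2) \<noteq> \<beta> (tau y) Plus (y + e1) (y + e2)"
    using L1 by simp
qed

end

section \<open>Almost sure properties\<close>

text \<open>Otherwise distinct support points are at least \<eta> apart, each cell of length \<eta>
  holds at most one, and the support is a countable union of null sets. Its complement is null as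
  well, a contradiction.\<close>

lemma atomless_support_close_points:
  fixes D :: "real measure"
  assumes D: "real_distribution D" and atomless: "\<And>x. measure D {x} = 0" and \<eta>: "\<eta> > 0"
  shows "\<exists>a b. a < b \<and> b - a < \<eta> \<and>
    (\<forall>\<delta>>0. measure D {a - \<delta><..<a + \<delta>} > 0) \<and> (\<forall>\<delta>>0. measure D {b - \<delta><..<b + \<delta>} > 0)"
proof (rule ccontr)
  assume none: "\<not> ?thesis"
  interpret real_distribution D by (rule D)
  define U where "U = {c. \<forall>\<delta>>0. measure D {c - \<delta><..<c + \<delta>} > 0}"
  define I where "I = {(r, s). r \<in> \<rat> \<and> s \<in> \<rat> \<and> measure D {r<..<s} = 0}"
  have "countable I"
    by (rule countable_subset[of _ "\<rat> \<times> \<rat>"]) (auto simp: I_def intro!: countable_SIGMA countable_rat)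
  then have "(\<Union>(r, s)\<in>I. {r<..<s}) \<in> null_sets D"
    by (intro null_sets_UN') (auto simp: I_def null_sets_def emeasure_eq_measure)
  moreover have "- U \<subseteq> (\<Union>(r, s)\<in>I. {r<..<s})"
  proof
    fix c assume "c \<in> - U"
    then obtain \<delta> where \<delta>: "\<delta> > 0" "measure D {c - \<delta><..<c + \<delta>} = 0"
      by (auto simp: U_def not_less zero_less_measure_iff)
    obtain r s where rs: "r \<in> \<rat>" "s \<in> \<rat>" "c - \<delta> < r" "r < c" "c < s" "s < c + \<delta>"
      using Rats_dense_in_real[of "c - \<delta>" c] Rats_dense_in_real[of c "c + \<delta>"] \<delta>(1) by auto
    have "measure D {r<..<s} \<le> measure D {c - \<delta><..<c + \<delta>}"
      using rs by (intro finite_measure_mono) auto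
    then have "measure D {r<..<s} = 0" using \<delta>(2) by (simp add: measure_le_0_iff)
    with rs show "c \<in> (\<Union>(r, s)\<in>I. {r<..<s})" by (auto simp: I_def intro!: bexI[of _ "(r, s)"])
  qed
  moreover have "(\<Union>n::int. U \<inter> {of_int n * \<eta>..<of_int (n + 1) * \<eta>}) \<in> null_sets D"
  proof (intro null_sets_UN' countableI_type)
    fix n :: int
    have "x = y" if "x \<in> U \<inter> {of_int n * \<eta>..<of_int (n + 1) * \<eta>}" "y \<in> U \<inter> {of_int n * \<eta>..<of_int (n + 1) * \<eta>}" for x y
    proof (rule ccontr)
      assume "x \<noteq> y"
      then have "min x y < max x y" "max x y - min x y < \<eta>" "min x y \<in> U" "max x y \<in> U"
        using that by (auto simp: min_def max_def algebra_simps)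
      with none show False unfolding U_def by blast
    qed
    then have "U \<inter> {of_int n * \<eta>..<of_int (n + 1) * \<eta>} = {} \<or> (\<exists>x. U \<inter> {of_int n * \<eta>..<of_int (n + 1) * \<eta>} = {x})"
      by blast
    then show "U \<inter> {of_int n * \<eta>..<of_int (n + 1) * \<eta>} \<in> null_sets D"
      using atomless by (auto simp: null_sets_def emeasure_eq_measure)
  qed
  moreover have "U \<subseteq> (\<Union>n::int. U \<inter> {of_int n * \<eta>..<of_int (n + 1) * \<eta>})"
  proof
    fix c assume "c \<in> U"
    moreover have "of_int \<lfloor>c / \<eta>\<rfloor> * \<eta> \<le> c" "c < of_int (\<lfloor>c / \<eta>\<rfloor> + 1) * \<eta>"
      using floor_divide_lower[OF \<eta>, of c] floor_divide_upper[OF \<eta>, of c] by auto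
    ultimately show "c \<in> (\<Union>n::int. U \<inter> {of_int n * \<eta>..<of_int (n + 1) * \<eta>})" by auto
  qed
  ultimately have "UNIV \<in> null_sets D"
    by (intro null_sets_subset[OF null_sets.Un, of "(\<Union>(r, s)\<in>I. {r<..<s})" D
          "(\<Union>n::int. U \<inter> {of_int n * \<eta>..<of_int (n + 1) * \<eta>})" UNIV]) auto
  then show False
    using prob_space by (simp add: null_sets_def emeasure_eq_measure)
qed

section \<open>Sublinear growth by Borel-Cantelli\<close>

context prob_space
begin

text \<open>Summing the probabilities of \<epsilon> n < |Y n| over n counts the integers below |Y 0|
  / \<epsilon> in expectation, so the sum is at most E|Y 0| / \<epsilon> + 1.\<close>

lemma sublinear_growth:
  fixes Y :: "nat \<Rightarrow> 'a \<Rightarrow> real"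
  assumes int: "integrable M (Y 0)" and [measurable]: "\<And>n. Y n \<in> borel_measurable M"
    and ident: "\<And>n. distr M borel (Y n) = distr M borel (Y 0)"
  shows "AE \<omega> in M. \<forall>\<epsilon>>0. \<exists>C. \<forall>n. \<bar>Y n \<omega>\<bar> \<le> C + \<epsilon> * real n"
proof -
  have one: "AE \<omega> in M. \<exists>C. \<forall>n. \<bar>Y n \<omega>\<bar> \<le> C + \<epsilon> * real n" if \<epsilon>: "\<epsilon> > 0" for \<epsilon>
  proof -
    define A where "A n = {\<omega> \<in> space M. \<epsilon> * real n < \<bar>Y n \<omega>\<bar>}" for n
    have A [measurable]: "A n \<in> sets M" for n unfolding A_def by measurable
    have prob_A: "prob (A n) = expectation (\<lambda>\<omega>. of_bool (\<epsilon> * real n < \<bar>Y 0 \<omega>\<bar>))" for n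
    proof -
      have "prob (A n) = measure (distr M borel (Y n)) {y. \<epsilon> * real n < \<bar>y\<bar>}"
        by (subst measure_distr) (auto simp: A_def intro!: arg_cong[where f = prob])
      also have "\<dots> = prob {\<omega> \<in> space M. \<epsilon> * real n < \<bar>Y 0 \<omega>\<bar>}"
        unfolding ident[of n] by (subst measure_distr) (auto intro!: arg_cong[where f = prob])
      also have "\<dots> = expectation (\<lambda>\<omega>. of_bool (\<epsilon> * real n < \<bar>Y 0 \<omega>\<bar>))"
      proof -
        have "expectation (\<lambda>\<omega>. of_bool (\<epsilon> * real n < \<bar>Y 0 \<omega>\<bar>)) =
            expectation (indicator {\<omega> \<in> space M. \<epsilon> * real n < \<bar>Y 0 \<omega>\<bar>})"
          by (rule Bochner_Integration.integral_cong) (auto simp: indicator_def)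
        also have "\<dots> = prob {\<omega> \<in> space M. \<epsilon> * real n < \<bar>Y 0 \<omega>\<bar>}"
          by (auto intro!: arg_cong[where f = prob])
        finally show ?thesis ..
      qed
      finally show ?thesis .
    qed
    have int_b: "integrable M (\<lambda>\<omega>. of_bool (\<epsilon> * real n < \<bar>Y 0 \<omega>\<bar>) :: real)" for n
      by (rule integrable_const_bound[of _ 1]) auto
    have "(\<Sum>n<N. prob (A n)) \<le> expectation (\<lambda>\<omega>. \<bar>Y 0 \<omega>\<bar> / \<epsilon> + 1)" for N
    proof -
      have "(\<Sum>n<N. prob (A n)) = expectation (\<lambda>\<omega>. \<Sum>n<N. of_bool (\<epsilon> * real n < \<bar>Y 0 \<omega>\<bar>))"
        unfolding prob_A using int_b by (subst Bochner_Integration.integral_sum) auto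
      also have "\<dots> \<le> expectation (\<lambda>\<omega>. \<bar>Y 0 \<omega>\<bar> / \<epsilon> + 1)"
      proof (rule integral_mono)
        show "integrable M (\<lambda>\<omega>. \<Sum>n<N. of_bool (\<epsilon> * real n < \<bar>Y 0 \<omega>\<bar>) :: real)"
          by (intro Bochner_Integration.integrable_sum int_b)
        fix \<omega>
        have "(\<Sum>n<N. of_bool (\<epsilon> * real n < \<bar>Y 0 \<omega>\<bar>) :: real) = real (card {n\<in>{..<N}. \<epsilon> * real n < \<bar>Y 0 \<omega>\<bar>})"
          by (simp add: of_bool_def sum.If_cases Int_def)
        also have "{n\<in>{..<N}. \<epsilon> * real n < \<bar>Y 0 \<omega>\<bar>} \<subseteq> {..<nat \<lceil>\<bar>Y 0 \<omega>\<bar> / \<epsilon>\<rceil>}"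
          using \<epsilon> by (auto simp: field_simps zless_nat_eq_int_zless less_ceiling_iff)
        then have "real (card {n\<in>{..<N}. \<epsilon> * real n < \<bar>Y 0 \<omega>\<bar>}) \<le> real (nat \<lceil>\<bar>Y 0 \<omega>\<bar> / \<epsilon>\<rceil>)"
          using card_mono[of "{..<nat \<lceil>\<bar>Y 0 \<omega>\<bar> / \<epsilon>\<rceil>}"] by fastforce
        also have "\<dots> \<le> \<bar>Y 0 \<omega>\<bar> / \<epsilon> + 1"
          using \<epsilon> of_int_ceiling_le_add_one[of "\<bar>Y 0 \<omega>\<bar> / \<epsilon>"] by (simp add: of_nat_nat)
        finally show "(\<Sum>n<N. of_bool (\<epsilon> * real n < \<bar>Y 0 \<omega>\<bar>)) \<le> \<bar>Y 0 \<omega>\<bar> / \<epsilon> + 1" .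
      qed (use int in auto)
      finally show ?thesis .
    qed
    then have "summable (\<lambda>n. prob (A n))"
      by (intro summableI_nonneg_bounded) auto
    then have "AE \<omega> in M. eventually (\<lambda>n. \<omega> \<in> space M - A n) sequentially"
      by (intro borel_cantelli_AE1) (auto simp: emeasure_eq_measure)
    then show ?thesis
    proof eventually_elim
      case (elim \<omega>)
      then obtain N where N: "\<And>n. n \<ge> N \<Longrightarrow> \<bar>Y n \<omega>\<bar> \<le> \<epsilon> * real n"
        by (auto simp: eventually_sequentially A_def not_less)
      have "\<bar>Y n \<omega>\<bar> \<le> (\<Sum>n<N. \<bar>Y n \<omega>\<bar>) + \<epsilon> * real n" for n
      proof (cases "n < N")
        case True
        then have "\<bar>Y n \<omega>\<bar> \<le> (\<Sum>n<N. \<bar>Y n \<omega>\<bar>)" by (intro member_le_sum) auto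
        then show ?thesis using \<epsilon> by (simp add: add_increasing2)
      next
        case False
        then show ?thesis using N[of n] by (simp add: sum_nonneg add_increasing)
      qed
      then show ?case by blast
    qed
  qed
  have "AE \<omega> in M. \<forall>k::nat. \<exists>C. \<forall>n. \<bar>Y n \<omega>\<bar> \<le> C + (1 / real (Suc k)) * real n"
    by (subst AE_all_countable) (intro allI one, simp)
  then show ?thesis
  proof eventually_elim
    case (elim \<omega>)
    show ?case
    proof (intro allI impI)
      fix \<epsilon> :: real assume "\<epsilon> > 0"
      then obtain k where k: "1 / real (Suc k) < \<epsilon>" using reals_Archimedean by (auto simp: inverse_eq_divide)
      from elim obtain C where C: "\<And>n. \<bar>Y n \<omega>\<bar> \<le> C + (1 / real (Suc k)) * real n" by blast
      have "\<bar>Y n \<omega>\<bar> \<le> C + \<epsilon> * real n" for n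
        using C[of n] mult_right_mono[OF less_imp_le[OF k], of "real n"] by linarith
      then show "\<exists>C. \<forall>n. \<bar>Y n \<omega>\<bar> \<le> C + \<epsilon> * real n" by blast
    qed
  qed
qed

end

section \<open>From the probability space to sample paths\<close>

definition directed_path :: "(dir \<Rightarrow> sign \<Rightarrow> site \<Rightarrow> site \<Rightarrow> 'a \<Rightarrow> real) \<Rightarrow> 'a \<Rightarrow> real \<Rightarrow> sign \<Rightarrow> site \<Rightarrow> site \<Rightarrow> real"
  where "directed_path B \<omega> t \<sigma> x y = B (dir_at t) \<sigma> x y \<omega>"

context busemann_process
begin

abbreviation "\<beta> \<equiv> directed_path B"

lemma space_M [simp]: "space M = UNIV"
  using sets_eq_imp_space_eq[OF sets_M] by simp

lemma B_borel: "0 < t \<Longrightarrow> t < 1 \<Longrightarrow> B (dir_at t) \<sigma> x y \<in> borel_measurable M"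
  using B_integrable[of "dir_at t" \<sigma> x y] by auto

lemma AE_busemann_path:
  "AE \<omega> in M. busemann_path (\<beta> \<omega>) (\<lambda>x. w x \<omega>) \<and>
    (\<forall>t \<sigma> x y z. 0 < t \<longrightarrow> t < 1 \<longrightarrow> \<beta> \<omega> t \<sigma> (x + z) (y + z) = \<beta> (T z \<omega>) t \<sigma> x y)"
proof -
  obtain \<Omega>0 where \<Omega>0: "\<Omega>0 \<in> sets M" "prob \<Omega>0 = 1" and P: "\<forall>\<omega>\<in>\<Omega>0.
      (\<forall>\<xi>\<in>ri_dirs. \<forall>\<sigma> x y z. B \<xi> \<sigma> (x + z) (y + z) \<omega> = B \<xi> \<sigma> x y (T z \<omega>)) \<and>
      (\<forall>\<xi>\<in>ri_dirs. \<forall>\<sigma> x y z. B \<xi> \<sigma> x y \<omega> + B \<xi> \<sigma> y z \<omega> = B \<xi> \<sigma> x z \<omega>) \<and>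
      (\<forall>\<xi>\<in>ri_dirs. \<forall>\<sigma> x. min (B \<xi> \<sigma> x (x + e1) \<omega>) (B \<xi> \<sigma> x (x + e2) \<omega>) = w x \<omega>) \<and>
      (\<forall>\<xi>\<in>ri_dirs. \<forall>\<xi>'\<in>ri_dirs. dir_less \<xi> \<xi>' \<longrightarrow> (\<forall>x.
         B \<xi> Minus x (x + e1) \<omega> \<ge> B \<xi> Plus x (x + e1) \<omega> \<and>
         B \<xi> Plus x (x + e1) \<omega> \<ge> B \<xi>' Minus x (x + e1) \<omega> \<and>
         B \<xi>' Minus x (x + e1) \<omega> \<ge> B \<xi>' Plus x (x + e1) \<omega> \<and>
         B \<xi> Minus x (x + e2) \<omega> \<le> B \<xi> Plus x (x + e2) \<omega> \<and>
         B \<xi> Plus x (x + e2) \<omega> \<le> B \<xi>' Minus x (x + e2) \<omega> \<and>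
         B \<xi>' Minus x (x + e2) \<omega> \<le> B \<xi>' Plus x (x + e2) \<omega>)) \<and>
      (\<forall>\<xi>\<in>ri_dirs. \<forall>\<sigma> x y.
         ((\<lambda>\<zeta>. B \<zeta> \<sigma> x y \<omega>) \<longlongrightarrow> B \<xi> Minus x y \<omega>) (at \<xi> within {\<zeta>\<in>ri_dirs. dir_less \<zeta> \<xi>}) \<and>
         ((\<lambda>\<zeta>. B \<zeta> \<sigma> x y \<omega>) \<longlongrightarrow> B \<xi> Plus x y \<omega>) (at \<xi> within {\<zeta>\<in>ri_dirs. dir_less \<xi> \<zeta>})) \<and>
      (\<forall>\<sigma> x. filterlim (\<lambda>\<xi>. B \<xi> \<sigma> x (x + e1) \<omega>) at_top (at e2 within ri_dirs) \<and>
             filterlim (\<lambda>\<xi>. B \<xi> \<sigma> x (x + e2) \<omega>) at_top (at e1 within ri_dirs))"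
    using B_pathwise by (elim bexE conjE) (rule that)
  have noteq: "AE \<omega> in M. \<forall>q\<in>(\<rat> :: real set). 0 < q \<and> q < 1 \<longrightarrow>
      (\<forall>x \<sigma>. B (dir_at q) \<sigma> x (x + e1) \<omega> \<noteq> B (dir_at q) \<sigma> x (x + e2) \<omega>)"
  proof (subst AE_ball_countable[OF countable_rat], rule ballI)
    fix q :: real
    show "AE \<omega> in M. 0 < q \<and> q < 1 \<longrightarrow>
      (\<forall>x \<sigma>. B (dir_at q) \<sigma> x (x + e1) \<omega> \<noteq> B (dir_at q) \<sigma> x (x + e2) \<omega>)"
    proof (cases "0 < q \<and> q < 1")
      case True
      then show ?thesis using B_noteq[of "dir_at q"] by simp
    next
      case False
      then show ?thesis by (intro AE_I2) blast
    qed
  qed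
  have dir_at_lim: "(dir_at \<longlongrightarrow> dir_at t) (at t within S)" for t S
    unfolding dir_at_def by (intro tendsto_intros)
  have "AE \<omega> in M. \<omega> \<in> \<Omega>0" using \<Omega>0 by (simp add: AE_in_set_eq_1)
  with noteq show ?thesis
  proof eventually_elim
    case (elim \<omega>)
    note P = bspec[OF P elim(2)]
    note shift = P[THEN conjunct1]
    note P = P[THEN conjunct2]
    note coc = P[THEN conjunct1]
    note P = P[THEN conjunct2]
    note rec = P[THEN conjunct1]
    note P = P[THEN conjunct2]
    note mon = P[THEN conjunct1]
    note P = P[THEN conjunct2]
    note lim = P[THEN conjunct1]
    note blow = P[THEN conjunct2]
    have "busemann_path (\<beta> \<omega>) (\<lambda>x. w x \<omega>)"
    proof
      fix t s :: real and \<sigma> and x y z :: site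
      show "\<beta> \<omega> t \<sigma> x y + \<beta> \<omega> t \<sigma> y z = \<beta> \<omega> t \<sigma> x z" if "0 < t" "t < 1"
        using coc[rule_format, of "dir_at t" \<sigma> x y z] that by (simp add: directed_path_def)
      show "min (\<beta> \<omega> t \<sigma> x (x + e1)) (\<beta> \<omega> t \<sigma> x (x + e2)) = w x \<omega>" if "0 < t" "t < 1"
        using rec[rule_format, of "dir_at t" \<sigma> x] that by (simp add: directed_path_def)
      show "\<beta> \<omega> s Plus x (x + e1) \<le> \<beta> \<omega> s Minus x (x + e1) \<and>
          \<beta> \<omega> t Minus x (x + e1) \<le> \<beta> \<omega> s Plus x (x + e1) \<and> \<beta> \<omega> t Plus x (x + e1) \<le> \<beta> \<omega> t Minus x (x + e1)"
        "\<beta> \<omega> s Minus x (x + e2) \<le> \<beta> \<omega> s Plus x (x + e2) \<and>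
          \<beta> \<omega> s Plus x (x + e2) \<le> \<beta> \<omega> t Minus x (x + e2) \<and> \<beta> \<omega> t Minus x (x + e2) \<le> \<beta> \<omega> t Plus x (x + e2)"
        if "0 < s" "s < t" "t < 1"
        using mon[rule_format, of "dir_at s" "dir_at t" x] that by (auto simp: directed_path_def)
      show "((\<lambda>s. \<beta> \<omega> s \<sigma> x y) \<longlongrightarrow> \<beta> \<omega> t Minus x y) (at_left t)" if t: "0 < t" "t < 1"
      proof -
        have "filterlim dir_at (at (dir_at t) within {\<zeta>\<in>ri_dirs. dir_less \<zeta> (dir_at t)}) (at_left t)"
          unfolding filterlim_at
          using eventually_at_left_real[OF t(1)] t by (auto intro: dir_at_lim elim!: eventually_mono)
        moreover have "((\<lambda>\<zeta>. B \<zeta> \<sigma> x y \<omega>) \<longlongrightarrow> B (dir_at t) Minus x y \<omega>)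
            (at (dir_at t) within {\<zeta>\<in>ri_dirs. dir_less \<zeta> (dir_at t)})"
          using t by (intro lim[rule_format, of "dir_at t" \<sigma> x y, THEN conjunct1]) simp
        ultimately show ?thesis
          unfolding directed_path_def by (rule filterlim_compose[rotated])
      qed
      show "((\<lambda>s. \<beta> \<omega> s \<sigma> x y) \<longlongrightarrow> \<beta> \<omega> t Plus x y) (at_right t)" if t: "0 < t" "t < 1"
      proof -
        have "filterlim dir_at (at (dir_at t) within {\<zeta>\<in>ri_dirs. dir_less (dir_at t) \<zeta>}) (at_right t)"
          unfolding filterlim_at
          using eventually_at_right_real[OF t(2)] t by (auto intro: dir_at_lim elim!: eventually_mono)
        moreover have "((\<lambda>\<zeta>. B \<zeta> \<sigma> x y \<omega>) \<longlongrightarrow> B (dir_at t) Plus x y \<omega>)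
            (at (dir_at t) within {\<zeta>\<in>ri_dirs. dir_less (dir_at t) \<zeta>})"
          using t by (intro lim[rule_format, of "dir_at t" \<sigma> x y, THEN conjunct2]) simp
        ultimately show ?thesis
          unfolding directed_path_def by (rule filterlim_compose[rotated])
      qed
      have e: "(e1 :: dir) = dir_at 1" "(e2 :: dir) = dir_at 0"
        by (auto simp: dir_at_def e1_def e2_def)
      have "filterlim dir_at (at (dir_at 0) within ri_dirs) (at_right 0)"
        unfolding filterlim_at
        using eventually_at_right_real[of 0 1] by (auto intro: dir_at_lim elim!: eventually_mono)
      then show "filterlim (\<lambda>t. \<beta> \<omega> t \<sigma> x (x + e1)) at_top (at_right 0)"
        unfolding directed_path_def using blow[rule_format, of \<sigma> x, THEN conjunct1] unfolding e
        by (rule filterlim_compose[of "\<lambda>\<zeta>. B \<zeta> \<sigma> x (x + e1) \<omega>", rotated])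
      have "filterlim dir_at (at (dir_at 1) within ri_dirs) (at_left 1)"
        unfolding filterlim_at
        using eventually_at_left_real[of 0 1] by (auto intro: dir_at_lim elim!: eventually_mono)
      then show "filterlim (\<lambda>t. \<beta> \<omega> t \<sigma> x (x + e2)) at_top (at_left 1)"
        unfolding directed_path_def using blow[rule_format, of \<sigma> x, THEN conjunct2] unfolding e
        by (rule filterlim_compose[of "\<lambda>\<zeta>. B \<zeta> \<sigma> x (x + e2) \<omega>", rotated])
      show "\<beta> \<omega> t Plus x (x + e1) \<noteq> \<beta> \<omega> t Plus x (x + e2)" if "t \<in> \<rat>" "0 < t" "t < 1"
        using elim(1)[rule_format, of t Plus x] that by (simp add: directed_path_def)
    qed
    moreover have "\<forall>t \<sigma> x y z. 0 < t \<longrightarrow> t < 1 \<longrightarrow> \<beta> \<omega> t \<sigma> (x + z) (y + z) = \<beta> (T z \<omega>) t \<sigma> x y"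
    proof (intro allI impI)
      fix t \<sigma> x y z assume "0 < t" "t < (1 :: real)"
      then show "\<beta> \<omega> t \<sigma> (x + z) (y + z) = \<beta> (T z \<omega>) t \<sigma> x y"
        using shift[rule_format, of "dir_at t" \<sigma> x z y] by (simp add: directed_path_def)
    qed
    ultimately show ?case ..
  qed
qed

text \<open>Increments between neighbours on an antidiagonal are translates of one integrable
  variable by multiples of (1, -1), hence identically distributed. The values 1 and -1 of
  \<open>c\<close> cover the two ends.\<close>

lemma AE_sublinear:
  "AE \<omega> in M. \<forall>q\<in>(\<rat> :: real set). 0 < q \<longrightarrow> q < 1 \<longrightarrow> (\<forall>k. \<forall>\<epsilon>>0.
    \<exists>C. \<forall>p. \<bar>\<beta> \<omega> q Plus (level_site k 0 p) (level_site k 0 (p + 1))\<bar> \<le> C + \<epsilon> * \<bar>real_of_int p\<bar>)"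
proof -
  have one: "AE \<omega> in M. \<forall>\<epsilon>>0. \<exists>C. \<forall>n. \<bar>B (dir_at q) Plus (level_site k 0 (c * int n)) (level_site k 0 (c * int n + 1)) \<omega>\<bar> \<le> C + \<epsilon> * real n"
    if q: "0 < q" "q < 1" for q k and c :: int
  proof (rule sublinear_growth)
    fix n
    let ?v = "(c * int n, - (c * int n))"
    show B: "B (dir_at q) Plus (level_site k 0 (c * int n)) (level_site k 0 (c * int n + 1)) \<in> borel_measurable M" for n
      using q by (rule B_borel)
    show "integrable M (B (dir_at q) Plus (level_site k 0 (c * int 0)) (level_site k 0 (c * int 0 + 1)))"
      using q by (intro B_integrable) simp
    have st: "level_site k 0 (c * int 0) + ?v = level_site k 0 (c * int n)" "level_site k 0 (c * int 0 + 1) + ?v = level_site k 0 (c * int n + 1)"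
      by (auto simp: level_site_def)
    have "distr M borel (B (dir_at q) Plus (level_site k 0 (c * int n)) (level_site k 0 (c * int n + 1))) =
      distr M borel (\<lambda>\<omega>. B (dir_at q) Plus (level_site k 0 (c * int 0)) (level_site k 0 (c * int 0 + 1)) (T ?v \<omega>))"
    proof (rule distr_cong_AE)
      show "AE \<omega> in M. B (dir_at q) Plus (level_site k 0 (c * int n)) (level_site k 0 (c * int n + 1)) \<omega> =
          B (dir_at q) Plus (level_site k 0 (c * int 0)) (level_site k 0 (c * int 0 + 1)) (T ?v \<omega>)"
        using AE_busemann_path
      proof eventually_elim
        case (elim \<omega>)
        then have "\<beta> \<omega> q Plus (level_site k 0 (c * int 0) + ?v) (level_site k 0 (c * int 0 + 1) + ?v) =
            \<beta> (T ?v \<omega>) q Plus (level_site k 0 (c * int 0)) (level_site k 0 (c * int 0 + 1))"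
          using q by blast
        then show ?case unfolding st by (simp add: directed_path_def)
      qed
    qed (use q T_measurable B_borel in \<open>auto intro: measurable_compose\<close>)
    also have "\<dots> = distr (distr M M (T ?v)) borel (B (dir_at q) Plus (level_site k 0 (c * int 0)) (level_site k 0 (c * int 0 + 1)))"
      using q T_measurable B_borel by (subst distr_distr) (auto simp: comp_def)
    also have "\<dots> = distr M borel (B (dir_at q) Plus (level_site k 0 (c * int 0)) (level_site k 0 (c * int 0 + 1)))"
      by (simp add: T_preserving)
    finally show "distr M borel (B (dir_at q) Plus (level_site k 0 (c * int n)) (level_site k 0 (c * int n + 1))) =
      distr M borel (B (dir_at q) Plus (level_site k 0 (c * int 0)) (level_site k 0 (c * int 0 + 1)))" .
  qed
  have "AE \<omega> in M. \<forall>q\<in>(\<rat> :: real set) \<inter> {0<..<1}. \<forall>k::int. \<forall>c::int. \<forall>\<epsilon>>0. \<exists>C. \<forall>n. \<bar>B (dir_at q) Plus (level_site k 0 (c * int n)) (level_site k 0 (c * int n + 1)) \<omega>\<bar> \<le> C + \<epsilon> * real n"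
    using one by (subst AE_ball_countable) (auto simp: AE_all_countable countable_rat)
  then show ?thesis
  proof eventually_elim
    case (elim \<omega>)
    show ?case
    proof (intro ballI allI impI)
      fix q \<epsilon> :: real and k :: int assume q: "q \<in> \<rat>" "0 < q" "q < 1" and \<epsilon>: "\<epsilon> > 0"
      from elim q \<epsilon> obtain C1 where C1: "\<And>n. \<bar>\<beta> \<omega> q Plus (level_site k 0 (1 * int n)) (level_site k 0 (1 * int n + 1))\<bar> \<le> C1 + \<epsilon> * real n"
        unfolding directed_path_def by (meson IntI greaterThanLessThan_iff)
      from elim q \<epsilon> obtain C2 where C2: "\<And>n. \<bar>\<beta> \<omega> q Plus (level_site k 0 (-1 * int n)) (level_site k 0 (-1 * int n + 1))\<bar> \<le> C2 + \<epsilon> * real n"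
        unfolding directed_path_def by (meson IntI greaterThanLessThan_iff)
      have "\<bar>\<beta> \<omega> q Plus (level_site k 0 p) (level_site k 0 (p + 1))\<bar> \<le> max C1 C2 + \<epsilon> * \<bar>real_of_int p\<bar>" for p
        using C1[of "nat p"] C2[of "nat (- p)"] by (cases "0 \<le> p") auto
      then show "\<exists>C. \<forall>p. \<bar>\<beta> \<omega> q Plus (level_site k 0 p) (level_site k 0 (p + 1))\<bar> \<le> C + \<epsilon> * \<bar>real_of_int p\<bar>" by blast
    qed
  qed
qed

lemma ex_support_pairs:
  obtains a b :: "nat \<Rightarrow> real" where
    "\<And>n \<delta>. \<delta> > 0 \<Longrightarrow> prob {\<omega>. \<bar>w 0 \<omega> - a n\<bar> < \<delta>} > 0"
    "\<And>n \<delta>. \<delta> > 0 \<Longrightarrow> prob {\<omega>. \<bar>w 0 \<omega> - b n\<bar> < \<delta>} > 0"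
    "\<And>\<eta>. \<eta> > 0 \<Longrightarrow> \<exists>n. a n < b n \<and> b n - a n < \<eta>"
proof -
  let ?D = "distr M borel (w 0)"
  have D: "real_distribution ?D"
    using w_measurable by (simp add: real_distribution_def real_distribution_axioms_def prob_space_distr)
  then interpret D: real_distribution ?D .
  have meas: "measure ?D {c - \<delta><..<c + \<delta>} = prob {\<omega>. \<bar>w 0 \<omega> - c\<bar> < \<delta>}" for c \<delta>
    using w_measurable by (subst measure_distr) (auto intro!: arg_cong[where f = prob])
  have "\<exists>a b. a < b \<and> b - a < 1 / real (Suc n) \<and>
    (\<forall>\<delta>>0. prob {\<omega>. \<bar>w 0 \<omega> - a\<bar> < \<delta>} > 0) \<and> (\<forall>\<delta>>0. prob {\<omega>. \<bar>w 0 \<omega> - b\<bar> < \<delta>} > 0)" for n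
    using atomless_support_close_points[OF D, of "1 / real (Suc n)"] w_continuous D.isCont_cdf
    by (auto simp: meas)
  then obtain a b where ab: "\<And>n. a n < b n" "\<And>n. b n - a n < 1 / real (Suc n)"
    "\<And>n \<delta>. \<delta> > 0 \<Longrightarrow> prob {\<omega>. \<bar>w 0 \<omega> - a n\<bar> < \<delta>} > 0"
    "\<And>n \<delta>. \<delta> > 0 \<Longrightarrow> prob {\<omega>. \<bar>w 0 \<omega> - b n\<bar> < \<delta>} > 0"
    by metis
  show thesis
  proof (rule that[OF ab(3,4)])
    fix \<eta> :: real assume "\<eta> > 0"
    then obtain n where "1 / real (Suc n) < \<eta>" using reals_Archimedean by (auto simp: inverse_eq_divide)
    with ab(1,2)[of n] show "\<exists>n. a n < b n \<and> b n - a n < \<eta>" by (intro exI[of _ n]) auto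
  qed
qed

end

section \<open>Recurrence of competition interface directions\<close>

text \<open>Points are added in increasing order. With a variable right end \<open>c\<close>, the
  bound for the earlier points can stop at the last of them and leave room for the next
  jump.\<close>

lemma sum_jumps_le:
  fixes Gp Gm :: "real \<Rightarrow> real"
  assumes jump: "\<And>t. r \<le> t \<Longrightarrow> t \<le> s \<Longrightarrow> Gm t \<le> Gp t"
    and mono: "\<And>t u. r \<le> t \<Longrightarrow> t < u \<Longrightarrow> u \<le> s \<Longrightarrow> Gp t \<le> Gm u"
    and F: "finite F" "F \<subseteq> {r..s}" "r \<le> s"
  shows "(\<Sum>t\<in>F. Gp t - Gm t) \<le> Gp s - Gm r"
proof -
  have mono': "Gm t \<le> Gm u" "Gp t \<le> Gp u" if "r \<le> t" "t \<le> u" "u \<le> s" for t u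
    using jump[of t] jump[of u] mono[of t u] that by (cases "t = u"; force)+
  have "\<forall>c\<in>{r..s}. F \<subseteq> {r..c} \<longrightarrow> (\<Sum>t\<in>F. Gp t - Gm t) \<le> Gp c - Gm r"
    using F(1)
  proof (induction rule: finite_linorder_max_induct)
    case empty
    show ?case
    proof (intro ballI impI)
      fix c assume "c \<in> {r..s}"
      then show "(\<Sum>t\<in>{}. Gp t - Gm t) \<le> Gp c - Gm r" using jump[of r] mono'[of r c] by simp
    qed
  next
    case (insert b A)
    show ?case
    proof (intro ballI impI)
      fix c assume c: "c \<in> {r..s}" "insert b A \<subseteq> {r..c}"
      show "(\<Sum>t\<in>insert b A. Gp t - Gm t) \<le> Gp c - Gm r"
      proof (cases "A = {}")
        case True
        then show ?thesis using c mono'[of r b] mono'[of b c] by auto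
      next
        case False
        have m: "Max A \<in> A" using insert.hyps(1) False by simp
        with insert.hyps c have m': "Max A < b" "Max A \<in> {r..s}" "A \<subseteq> {r..Max A}" by auto
        with insert.IH have "(\<Sum>t\<in>A. Gp t - Gm t) \<le> Gp (Max A) - Gm r" by blast
        moreover have "Gp (Max A) \<le> Gm b" using m' c by (intro mono) auto
        moreover have "b \<notin> A" using insert.hyps by auto
        ultimately show ?thesis using c mono'(2)[of b c] insert.hyps(1) by simp
      qed
    qed
  qed
  with F(2,3) show ?thesis by auto
qed

text \<open>\<open>first\<close> selects the least index of each value. A sum over a random set of
  values thus becomes a series over a fixed enumeration, which makes measurability
  accessible.\<close>

lemma nn_integral_count_space_image:
  fixes \<tau> :: "'i::countable \<Rightarrow> 'b"
  defines "first \<equiv> \<lambda>K H n. from_nat n \<in> H \<and> \<tau> (from_nat n) \<in> K \<and>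
    (\<forall>m<n. from_nat m \<in> H \<longrightarrow> \<tau> (from_nat m) \<noteq> \<tau> (from_nat n))"
  shows "(\<integral>\<^sup>+t. f t \<partial>count_space (K \<inter> \<tau> ` H)) = (\<Sum>n. if first K H n then f (\<tau> (from_nat n)) else 0)"
    and "inj_on (\<lambda>n. \<tau> (from_nat n)) {n. first K H n}"
proof -
  show inj: "inj_on (\<lambda>n. \<tau> (from_nat n)) {n. first K H n}"
    by (rule inj_onI) (metis (mono_tags, lifting) first_def linorder_neqE_nat mem_Collect_eq)
  have surj: "(\<lambda>n. \<tau> (from_nat n)) ` {n. first K H n} = K \<inter> \<tau> ` H"
  proof (intro equalityI subsetI)
    fix t assume "t \<in> K \<inter> \<tau> ` H"
    then obtain x where x: "x \<in> H" "\<tau> x = t" "t \<in> K" by auto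
    define Q where "Q n \<longleftrightarrow> from_nat n \<in> H \<and> \<tau> (from_nat n) = t" for n
    have "Q (to_nat x)" using x by (simp add: Q_def)
    then obtain n where n: "Q n" "\<And>m. m < n \<Longrightarrow> \<not> Q m"
      by (metis exists_least_iff)
    then have "first K H n" "\<tau> (from_nat n) = t"
      using x(3) unfolding first_def Q_def by auto
    then show "t \<in> (\<lambda>n. \<tau> (from_nat n)) ` {n. first K H n}" by blast
  qed (auto simp: first_def)
  have "(\<integral>\<^sup>+t. f t \<partial>count_space (K \<inter> \<tau> ` H)) = (\<integral>\<^sup>+n. f (\<tau> (from_nat n)) \<partial>count_space {n. first K H n})"
    by (rule nn_integral_bij_count_space[symmetric]) (simp add: bij_betw_def inj surj)
  also have "\<dots> = (\<integral>\<^sup>+n. (if first K H n then f (\<tau> (from_nat n)) else 0) \<partial>count_space UNIV)"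
    by (subst nn_integral_count_space_indicator) (auto intro!: nn_integral_cong simp: indicator_def)
  also have "\<dots> = (\<Sum>n. if first K H n then f (\<tau> (from_nat n)) else 0)"
    by (rule nn_integral_count_space_nat)
  finally show "(\<integral>\<^sup>+t. f t \<partial>count_space (K \<inter> \<tau> ` H)) = (\<Sum>n. if first K H n then f (\<tau> (from_nat n)) else 0)" .
qed

lemma nn_integral_count_space_mono_set:
  assumes "A \<subseteq> A'"
  shows "(\<integral>\<^sup>+t. f t \<partial>count_space A) \<le> (\<integral>\<^sup>+t. f t \<partial>count_space A')"
proof -
  have *: "(\<integral>\<^sup>+t. f t \<partial>count_space S) = (\<integral>\<^sup>+t. f t * indicator S t \<partial>count_space UNIV)" for S
    by (simp add: nn_integral_restrict_space[symmetric] restrict_count_space)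
  show ?thesis unfolding * using assms by (intro nn_integral_mono) (auto simp: indicator_def)
qed

lemma nn_integral_count_space_insert:
  assumes "t \<notin> A" "t \<in> A'" "A \<subseteq> A'"
  shows "(\<integral>\<^sup>+t. f t \<partial>count_space A) + f t \<le> (\<integral>\<^sup>+t. f t \<partial>count_space A')"
proof -
  have *: "(\<integral>\<^sup>+t. f t \<partial>count_space S) = (\<integral>\<^sup>+t. f t * indicator S t \<partial>count_space UNIV)" for S
    by (simp add: nn_integral_restrict_space[symmetric] restrict_count_space)
  have "(\<integral>\<^sup>+t. f t \<partial>count_space A) + f t = (\<integral>\<^sup>+t. f t \<partial>count_space A) + (\<integral>\<^sup>+t. f t \<partial>count_space {t})"
    by (simp add: nn_integral_count_space_finite)
  also have "\<dots> = (\<integral>\<^sup>+s. f s * indicator A s + f s * indicator {t} s \<partial>count_space UNIV)"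
    unfolding * by (intro nn_integral_add[symmetric]) auto
  also have "\<dots> \<le> (\<integral>\<^sup>+t. f t \<partial>count_space A')"
    unfolding * using assms by (intro nn_integral_mono) (auto simp: indicator_def)
  finally show ?thesis .
qed

section \<open>Jump mass carried by interface directions\<close>

definition path_jump :: "(real \<Rightarrow> sign \<Rightarrow> site \<Rightarrow> site \<Rightarrow> real) \<Rightarrow> site \<Rightarrow> site \<Rightarrow> real \<Rightarrow> real" where
  "path_jump \<beta> e z t = \<bar>\<beta> t Minus z (z + e) - \<beta> t Plus z (z + e)\<bar>"

text \<open>The mass of the flow across one edge, restricted to directions attained in
  \<open>H\<close>. A direction attained by several sites counts once.\<close>

definition interface_mass ::
    "(real \<Rightarrow> sign \<Rightarrow> site \<Rightarrow> site \<Rightarrow> real) \<Rightarrow> real \<Rightarrow> real \<Rightarrow> site set \<Rightarrow> site \<Rightarrow> site \<Rightarrow> ennreal" where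
  "interface_mass \<beta> r s H e z =
    (\<integral>\<^sup>+t. ennreal (path_jump \<beta> e z t) \<partial>count_space ({r..s} \<inter> interface_param \<beta> ` H))"

context busemann_path
begin

text \<open>The two ways around a unit square have the same total increment. Increments along
  \<open>e1\<close> jump down and those along \<open>e2\<close> jump up, so absolute values turn
  this identity into a balance of flows.\<close>

lemma path_jump_conservation:
  assumes t: "0 < t" "t < 1"
  shows "path_jump \<beta> e1 z t + path_jump \<beta> e2 z t = path_jump \<beta> e1 (z + e2) t + path_jump \<beta> e2 (z + e1) t"
proof -
  have "\<beta> t \<sigma> z (z + e1) + \<beta> t \<sigma> (z + e1) (z + e1 + e2) = \<beta> t \<sigma> z (z + e2) + \<beta> t \<sigma> (z + e2) (z + e2 + e1)" for \<sigma>
    using cocycle[OF t, of \<sigma> z "z + e1" "z + e1 + e2"] cocycle[OF t, of \<sigma> z "z + e2" "z + e2 + e1"]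
    by (simp add: add.commute add.left_commute)
  from this[of Plus] this[of Minus] show ?thesis
    using jump_e1[OF t, of z] jump_e2[OF t, of z] jump_e1[OF t, of "z + e2"] jump_e2[OF t, of "z + e1"]
    by (simp add: path_jump_def)
qed

lemma interface_mass_conservation:
  assumes "0 < r" "s < 1"
  shows "interface_mass \<beta> r s H e1 z + interface_mass \<beta> r s H e2 z =
    interface_mass \<beta> r s H e1 (z + e2) + interface_mass \<beta> r s H e2 (z + e1)"
proof -
  have nn: "0 \<le> path_jump \<beta> e z t" for e z t by (simp add: path_jump_def)
  show ?thesis
    unfolding interface_mass_def
    by (subst (1 2) nn_integral_add[symmetric])
      (use assms in \<open>auto intro!: nn_integral_cong simp: path_jump_conservation nn simp flip: ennreal_plus\<close>)
qed

text \<open>The jumps of a monotone function add up to at most its total variation. The bound is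
  integrable, which lets expected masses be subtracted later.\<close>

lemma interface_mass_bound:
  assumes rs: "0 < r" "r \<le> s" "s < 1" and e: "e \<in> {e1, e2}"
  shows "interface_mass \<beta> r s H e z \<le> ennreal \<bar>\<beta> s Plus z (z + e) - \<beta> r Minus z (z + e)\<bar>"
proof -
  have fin: "(\<Sum>t\<in>F. path_jump \<beta> e z t) \<le> \<bar>\<beta> s Plus z (z + e) - \<beta> r Minus z (z + e)\<bar>"
    if F: "finite F" "F \<subseteq> {r..s}" for F
  proof (cases "e = e2")
    case True
    have "(\<Sum>t\<in>F. path_jump \<beta> e z t) = (\<Sum>t\<in>F. \<beta> t Plus z (z + e2) - \<beta> t Minus z (z + e2))"
      using F rs by (intro sum.cong) (auto simp: path_jump_def True jump_e2 subset_iff)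
    also have "\<dots> \<le> \<beta> s Plus z (z + e2) - \<beta> r Minus z (z + e2)"
      using rs F by (intro sum_jumps_le[of r s] jump_e2 mono_e2) auto
    finally show ?thesis unfolding True by linarith
  next
    case False
    then have e: "e = e1" using e by simp
    have "(\<Sum>t\<in>F. path_jump \<beta> e z t) = (\<Sum>t\<in>F. - \<beta> t Plus z (z + e1) - - \<beta> t Minus z (z + e1))"
      using F rs by (intro sum.cong) (auto simp: path_jump_def e jump_e1 subset_iff)
    also have "\<dots> \<le> - \<beta> s Plus z (z + e1) - - \<beta> r Minus z (z + e1)"
      using rs F by (intro sum_jumps_le[of r s]) (auto intro: jump_e1 mono_e1)
    finally show ?thesis unfolding e by linarith
  qed
  let ?\<tau> = "\<lambda>n. tau (from_nat n)"
  define first where "first n \<longleftrightarrow> from_nat n \<in> H \<and> ?\<tau> n \<in> {r..s} \<and>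
    (\<forall>m<n. from_nat m \<in> H \<longrightarrow> ?\<tau> m \<noteq> ?\<tau> n)" for n
  have inj: "inj_on ?\<tau> {n. first n}"
    unfolding first_def by (rule nn_integral_count_space_image(2))
  have "interface_mass \<beta> r s H e z = (\<Sum>n. if first n then ennreal (path_jump \<beta> e z (?\<tau> n)) else 0)"
    unfolding interface_mass_def first_def by (rule nn_integral_count_space_image(1))
  also have "\<dots> \<le> ennreal \<bar>\<beta> s Plus z (z + e) - \<beta> r Minus z (z + e)\<bar>"
  proof (rule suminf_le_const[OF summableI])
    fix N
    have "(\<Sum>n<N. if first n then ennreal (path_jump \<beta> e z (?\<tau> n)) else 0) =
        (\<Sum>n\<in>{..<N} \<inter> {n. first n}. ennreal (path_jump \<beta> e z (?\<tau> n)))"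
      by (simp add: sum.If_cases)
    also have "\<dots> = (\<Sum>t\<in>?\<tau> ` ({..<N} \<inter> {n. first n}). ennreal (path_jump \<beta> e z t))"
      using inj by (subst sum.reindex) (auto intro: inj_on_subset)
    also have "\<dots> = ennreal (\<Sum>t\<in>?\<tau> ` ({..<N} \<inter> {n. first n}). path_jump \<beta> e z t)"
      by (rule sum_ennreal) (simp add: path_jump_def)
    also have "\<dots> \<le> ennreal \<bar>\<beta> s Plus z (z + e) - \<beta> r Minus z (z + e)\<bar>"
      by (intro ennreal_leI fin) (auto simp: first_def)
    finally show "(\<Sum>n<N. if first n then ennreal (path_jump \<beta> e z (?\<tau> n)) else 0) \<le>
      ennreal \<bar>\<beta> s Plus z (z + e) - \<beta> r Minus z (z + e)\<bar>" .
  qed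
  finally show ?thesis .
qed

end

lemma interface_mass_shift:
  assumes sh: "\<And>t \<sigma> x y. 0 < t \<Longrightarrow> t < 1 \<Longrightarrow> \<beta> t \<sigma> (x + v) (y + v) = \<beta>' t \<sigma> x y"
    and rs: "0 < r" "s < 1"
  shows "interface_mass \<beta> r s H e (z + v) = interface_mass \<beta>' r s {x. x + v \<in> H} e z"
proof -
  have j: "path_jump \<beta> e (z + v) t = path_jump \<beta>' e z t" if "0 < t" "t < 1" for t
    using sh[OF that, of _ z "z + e"] by (simp add: path_jump_def add.assoc add.commute[of v])
  have p: "interface_param \<beta> (x + v) = interface_param \<beta>' x" for x
  proof -
    have "\<beta> q Plus (x + v + e1) (x + v + e2) = \<beta>' q Plus (x + e1) (x + e2)" if "0 < q" "q < 1" for q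
      using sh[OF that, of Plus "x + e1" "x + e2"] by (simp add: add.assoc add.commute[of v])
    then show ?thesis unfolding interface_param_def by (metis (no_types, lifting))
  qed
  have im: "interface_param \<beta> ` H = interface_param \<beta>' ` {x. x + v \<in> H}"
  proof -
    have H: "H = (\<lambda>x. x + v) ` {x. x + v \<in> H}"
    proof (intro equalityI subsetI)
      fix x assume "x \<in> H"
      then show "x \<in> (\<lambda>x. x + v) ` {x. x + v \<in> H}" by (intro image_eqI[of _ _ "x - v"]) auto
    qed auto
    have "interface_param \<beta> ` H = interface_param \<beta> ` (\<lambda>x. x + v) ` {x. x + v \<in> H}"
      by (rule arg_cong[OF H])
    also have "\<dots> = interface_param \<beta>' ` {x. x + v \<in> H}"
      unfolding image_image by (intro image_cong) (simp_all add: p)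
    finally show ?thesis .
  qed
  show ?thesis
    unfolding interface_mass_def im using rs by (intro nn_integral_cong) (auto simp: j)
qed

section \<open>Measurability and stationarity of the jump mass\<close>

context busemann_process
begin

lemma interface_param_measurable [measurable]:
  "(\<lambda>\<omega>. interface_param (\<beta> \<omega>) x) \<in> borel_measurable M"
  unfolding borel_measurable_iff_less
proof
  fix c :: real
  have c: "countable {q \<in> \<rat>. 0 < q \<and> q < 1 \<and> q < c}"
    by (rule countable_subset[OF _ countable_rat]) auto
  have "{\<omega> \<in> space M. 1 < c \<or> (\<exists>q\<in>{q \<in> \<rat>. 0 < q \<and> q < 1 \<and> q < c}. 0 < B (dir_at q) Plus (x + e1) (x + e2) \<omega>)} \<in> sets M"
  proof (intro sets.sets_Collect_disj sets.sets_Collect_const sets.sets_Collect_countable_Ex' c)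
    fix q assume "q \<in> {q \<in> \<rat>. 0 < q \<and> q < 1 \<and> q < c}"
    then have [measurable]: "B (dir_at q) Plus (x + e1) (x + e2) \<in> borel_measurable M"
      by (intro B_borel) auto
    show "{\<omega> \<in> space M. 0 < B (dir_at q) Plus (x + e1) (x + e2) \<omega>} \<in> sets M" by measurable
  qed
  also have "{\<omega> \<in> space M. 1 < c \<or> (\<exists>q\<in>{q \<in> \<rat>. 0 < q \<and> q < 1 \<and> q < c}. 0 < B (dir_at q) Plus (x + e1) (x + e2) \<omega>)} =
      {\<omega> \<in> space M. interface_param (\<beta> \<omega>) x < c}"
    unfolding interface_param_less_iff directed_path_def by blast
  finally show "{\<omega> \<in> space M. interface_param (\<beta> \<omega>) x < c} \<in> sets M" .
qed

text \<open>The direction is itself random here, so joint measurability in environment and direction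
  is used.\<close>

lemma B_random_direction_measurable:
  assumes f: "f \<in> borel_measurable M" and f01: "\<And>\<omega>. 0 < f \<omega> \<and> f \<omega> < 1"
  shows "(\<lambda>\<omega>. \<beta> \<omega> (f \<omega>) \<sigma> x y) \<in> borel_measurable M"
proof -
  have d: "(\<lambda>\<omega>. dir_at (f \<omega>)) \<in> measurable M (restrict_space borel ri_dirs)"
    using f f01 by (intro measurable_restrict_space2 measurable_compose[OF f dir_at_borel]) auto
  have "(\<lambda>\<omega>. (x, y, \<omega>, dir_at (f \<omega>))) \<in> measurable M
      (count_space UNIV \<Otimes>\<^sub>M (count_space UNIV \<Otimes>\<^sub>M (M \<Otimes>\<^sub>M restrict_space borel ri_dirs)))"
    using d by (intro measurable_Pair) auto
  from measurable_compose[OF this B_measurable[of \<sigma>]] show ?thesis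
    by (simp add: directed_path_def)
qed

lemma interface_mass_measurable:
  assumes rs: "0 < r" "s < 1"
  shows "(\<lambda>\<omega>. interface_mass (\<beta> \<omega>) r s H e z) \<in> borel_measurable M"
proof -
  define P where "P \<omega> n \<longleftrightarrow> from_nat n \<in> H \<and> interface_param (\<beta> \<omega>) (from_nat n) \<in> {r..s} \<and>
    (\<forall>m<n. from_nat m \<in> H \<longrightarrow> interface_param (\<beta> \<omega>) (from_nat m) \<noteq> interface_param (\<beta> \<omega>) (from_nat n))" for \<omega> n
  \<comment> \<open>The default 1/2 keeps the direction inside \<open>ri_dirs\<close>; it never
    occurs in a term selected by \<open>P\<close>.\<close>
  define f where "f n \<omega> = (if 0 < interface_param (\<beta> \<omega>) (from_nat n) \<and> interface_param (\<beta> \<omega>) (from_nat n) < 1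
    then interface_param (\<beta> \<omega>) (from_nat n) else 1 / 2)" for n \<omega>
  have f: "f n \<in> borel_measurable M" for n unfolding f_def by measurable
  have f01: "0 < f n \<omega> \<and> f n \<omega> < 1" for n \<omega> by (simp add: f_def)
  note [measurable] = B_random_direction_measurable[OF f f01]
  have [measurable]: "Measurable.pred M (\<lambda>\<omega>. P \<omega> n)" for n unfolding P_def by measurable
  have "(\<lambda>\<omega>. \<Sum>n. if P \<omega> n then ennreal (path_jump (\<beta> \<omega>) e z (f n \<omega>)) else 0) \<in> borel_measurable M"
    unfolding path_jump_def by measurable
  also have "(\<lambda>\<omega>. \<Sum>n. if P \<omega> n then ennreal (path_jump (\<beta> \<omega>) e z (f n \<omega>)) else 0) =
      (\<lambda>\<omega>. interface_mass (\<beta> \<omega>) r s H e z)"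
  proof
    fix \<omega>
    have "f n \<omega> = interface_param (\<beta> \<omega>) (from_nat n)" if "P \<omega> n" for n
      using that rs by (auto simp: P_def f_def)
    then show "(\<Sum>n. if P \<omega> n then ennreal (path_jump (\<beta> \<omega>) e z (f n \<omega>)) else 0) =
        interface_mass (\<beta> \<omega>) r s H e z"
      unfolding interface_mass_def nn_integral_count_space_image(1) P_def[symmetric]
      by (intro suminf_cong) auto
  qed
  finally show ?thesis .
qed

text \<open>The half-plane \<open>{x. k \<le> level x}\<close> shifted by \<open>- e1\<close> or \<open>- e2\<close> is \<open>{x. k - 1 \<le> level x}\<close>, so
  conservation makes the expected masses of these nested half-planes equal.\<close>

lemma AE_interface_mass_eq:
  assumes rs: "0 < r" "r \<le> s" "s < 1"
  shows "AE \<omega> in M. \<forall>t e. r \<le> t \<longrightarrow> t \<le> s \<longrightarrow> e \<in> {e1, e2} \<longrightarrow> path_jump (\<beta> \<omega>) e z t \<noteq> 0 \<longrightarrow>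
    t \<in> interface_param (\<beta> \<omega>) ` {x. k - 1 \<le> level x} \<longrightarrow> t \<in> interface_param (\<beta> \<omega>) ` {x. k \<le> level x}"
proof -
  let ?m = "\<lambda>H e z \<omega>. interface_mass (\<beta> \<omega>) r s H e z"
  define H where "H k = {x. k \<le> level x}" for k
  note meas = interface_mass_measurable[OF rs(1,3)]
  have shift: "(\<integral>\<^sup>+\<omega>. ?m H e (z + v) \<omega> \<partial>M) = (\<integral>\<^sup>+\<omega>. ?m {x. x + v \<in> H} e z \<omega> \<partial>M)" for H e z v
  proof -
    have "(\<integral>\<^sup>+\<omega>. ?m H e (z + v) \<omega> \<partial>M) = (\<integral>\<^sup>+\<omega>. ?m {x. x + v \<in> H} e z (T v \<omega>) \<partial>M)"
    proof (rule nn_integral_cong_AE)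
      show "AE \<omega> in M. ?m H e (z + v) \<omega> = ?m {x. x + v \<in> H} e z (T v \<omega>)"
        using AE_busemann_path
      proof eventually_elim
        case (elim \<omega>)
        show ?case by (rule interface_mass_shift) (use elim rs in blast)+
      qed
    qed
    also have "\<dots> = (\<integral>\<^sup>+\<omega>. ?m {x. x + v \<in> H} e z \<omega> \<partial>distr M M (T v))"
      using T_measurable meas by (intro nn_integral_distr[symmetric]) auto
    finally show ?thesis by (simp add: T_preserving)
  qed
  define F where "F k \<omega> = ?m (H k) e1 z \<omega> + ?m (H k) e2 z \<omega>" for k \<omega>
  have F: "F k \<in> borel_measurable M" for k unfolding F_def using meas by (intro borel_measurable_add) auto
  have "(\<integral>\<^sup>+\<omega>. F k \<omega> \<partial>M) = (\<integral>\<^sup>+\<omega>. ?m (H k) e1 (z + e2) \<omega> + ?m (H k) e2 (z + e1) \<omega> \<partial>M)"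
  proof (rule nn_integral_cong_AE)
    show "AE \<omega> in M. F k \<omega> = ?m (H k) e1 (z + e2) \<omega> + ?m (H k) e2 (z + e1) \<omega>"
      using AE_busemann_path
      by eventually_elim (use rs in \<open>auto simp: F_def intro: busemann_path.interface_mass_conservation\<close>)
  qed
  also have "\<dots> = (\<integral>\<^sup>+\<omega>. ?m (H k) e1 (z + e2) \<omega> \<partial>M) + (\<integral>\<^sup>+\<omega>. ?m (H k) e2 (z + e1) \<omega> \<partial>M)"
    using meas by (intro nn_integral_add) auto
  also have "\<dots> = (\<integral>\<^sup>+\<omega>. ?m (H (k - 1)) e1 z \<omega> \<partial>M) + (\<integral>\<^sup>+\<omega>. ?m (H (k - 1)) e2 z \<omega> \<partial>M)"
  proof -
    have "{x. x + e2 \<in> H k} = H (k - 1)" "{x. x + e1 \<in> H k} = H (k - 1)" by (auto simp: H_def)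
    then show ?thesis by (simp add: shift)
  qed
  also have "\<dots> = (\<integral>\<^sup>+\<omega>. F (k - 1) \<omega> \<partial>M)"
    unfolding F_def using meas by (intro nn_integral_add[symmetric]) auto
  finally have eq: "(\<integral>\<^sup>+\<omega>. F k \<omega> \<partial>M) = (\<integral>\<^sup>+\<omega>. F (k - 1) \<omega> \<partial>M)" .
  have H_mono: "H k \<subseteq> H (k - 1)" by (auto simp: H_def)
  have m_mono: "?m (H k) e z \<omega> \<le> ?m (H (k - 1)) e z \<omega>" for e \<omega>
    unfolding interface_mass_def using H_mono by (intro nn_integral_count_space_mono_set) auto
  have F_mono: "F k \<omega> \<le> F (k - 1) \<omega>" for \<omega>
    unfolding F_def by (intro add_mono m_mono)
  have bound: "AE \<omega> in M. F k \<omega> \<le> ennreal (\<Sum>e\<in>{e1, e2}. \<bar>\<beta> \<omega> s Plus z (z + e) - \<beta> \<omega> r Minus z (z + e)\<bar>)" for k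
    using AE_busemann_path
  proof eventually_elim
    case (elim \<omega>)
    then interpret busemann_path "\<beta> \<omega>" "\<lambda>x. w x \<omega>" by blast
    have "(e1 :: site) \<noteq> e2" by (simp add: e1_def e2_def)
    then show ?case
      using interface_mass_bound[OF rs, of e1 "H k" z] interface_mass_bound[OF rs, of e2 "H k" z]
      unfolding F_def by (auto simp: ennreal_plus intro: add_mono)
  qed
  have fin: "(\<integral>\<^sup>+\<omega>. F k \<omega> \<partial>M) \<noteq> \<infinity>"
  proof -
    have "integrable M (\<lambda>\<omega>. \<Sum>e\<in>{e1, e2}. \<bar>\<beta> \<omega> s Plus z (z + e) - \<beta> \<omega> r Minus z (z + e)\<bar>)"
      unfolding directed_path_def using rs
      by (intro Bochner_Integration.integrable_sum integrable_abs Bochner_Integration.integrable_diff B_integrable) auto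
    then have "(\<integral>\<^sup>+\<omega>. ennreal (\<Sum>e\<in>{e1, e2}. \<bar>\<beta> \<omega> s Plus z (z + e) - \<beta> \<omega> r Minus z (z + e)\<bar>) \<partial>M) < \<infinity>"
      by (subst nn_integral_eq_integral) (auto simp: sum_nonneg)
    moreover have "(\<integral>\<^sup>+\<omega>. F k \<omega> \<partial>M) \<le> (\<integral>\<^sup>+\<omega>. ennreal (\<Sum>e\<in>{e1, e2}. \<bar>\<beta> \<omega> s Plus z (z + e) - \<beta> \<omega> r Minus z (z + e)\<bar>) \<partial>M)"
      by (intro nn_integral_mono_AE bound)
    ultimately show ?thesis by auto
  qed
  \<comment> \<open>Ordered variables with equal finite expectations agree almost surely.\<close>
  have "(\<integral>\<^sup>+\<omega>. F (k - 1) \<omega> - F k \<omega> \<partial>M) = 0"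
    using fin eq F_mono by (subst nn_integral_diff[OF F F]) (auto simp: top_unique)
  then have "AE \<omega> in M. F (k - 1) \<omega> - F k \<omega> = 0"
    using F by (subst (asm) nn_integral_0_iff_AE) auto
  then show ?thesis
    using bound[of k] unfolding H_def[symmetric]
  proof eventually_elim
    case (elim \<omega>)
    then have eqF: "F (k - 1) \<omega> \<le> F k \<omega>" and finF: "F k \<omega> < \<top>"
      by (auto simp: diff_eq_0_iff_ennreal le_less_trans[OF _ ennreal_less_top])
    show ?case
    proof (intro allI impI, rule ccontr)
      fix t e assume t: "r \<le> t" "t \<le> s" "e \<in> {e1, e2}" "path_jump (\<beta> \<omega>) e z t \<noteq> 0"
        "t \<in> interface_param (\<beta> \<omega>) ` H (k - 1)" "t \<notin> interface_param (\<beta> \<omega>) ` H k"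
      \<comment> \<open>A direction attained in the larger half-plane only would add its whole jump
        to the larger mass.\<close>
      have "?m (H k) e z \<omega> + ennreal (path_jump (\<beta> \<omega>) e z t) \<le> ?m (H (k - 1)) e z \<omega>"
        unfolding interface_mass_def using t H_mono by (intro nn_integral_count_space_insert) auto
      note le = this
      have "F k \<omega> + ennreal (path_jump (\<beta> \<omega>) e z t) \<le> F (k - 1) \<omega>"
      proof (cases "e = e1")
        case True
        have "(?m (H k) e1 z \<omega> + ennreal (path_jump (\<beta> \<omega>) e z t)) + ?m (H k) e2 z \<omega> \<le> F (k - 1) \<omega>"
          unfolding F_def by (intro add_mono m_mono) (use le True in simp)
        then show ?thesis by (simp add: F_def ac_simps)
      next
        case False
        then have "e = e2" using t(3) by simp
        then have "?m (H k) e1 z \<omega> + (?m (H k) e2 z \<omega> + ennreal (path_jump (\<beta> \<omega>) e z t)) \<le> F (k - 1) \<omega>"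
          unfolding F_def by (intro add_mono m_mono) (use le in simp)
        then show ?thesis by (simp add: F_def ac_simps)
      qed
      also note eqF
      finally have le': "F k \<omega> + ennreal (path_jump (\<beta> \<omega>) e z t) \<le> F k \<omega>" .
      obtain f where f: "F k \<omega> = ennreal f" "0 \<le> f" using finF by (cases "F k \<omega>") auto
      have j: "0 \<le> path_jump (\<beta> \<omega>) e z t" by (simp add: path_jump_def)
      have "ennreal (f + path_jump (\<beta> \<omega>) e z t) \<le> ennreal f"
        using le' f j by (simp add: ennreal_plus)
      then have "path_jump (\<beta> \<omega>) e z t \<le> 0"
        using f(2) by (subst (asm) ennreal_le_iff) auto
      with j t(4) show False by simp
    qed
  qed
qed

text \<open>The direction is attained at \<open>y\<close>, and \<open>AE_interface_mass_eq\<close>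
  raises the level by one at a time. Rational \<open>r\<close>, \<open>s\<close> around
  \<open>tau y\<close> keep the union of exceptional events countable.\<close>

lemma AE_recurrence:
  "AE \<omega> in M. \<forall>y e k. e \<in> {e1, e2} \<longrightarrow> path_jump (\<beta> \<omega>) e y (interface_param (\<beta> \<omega>) y) \<noteq> 0 \<longrightarrow>
    (\<exists>z. k \<le> level z \<and> interface_param (\<beta> \<omega>) z = interface_param (\<beta> \<omega>) y)"
proof -
  have "AE \<omega> in M. \<forall>r\<in>\<rat>. \<forall>s\<in>\<rat>. \<forall>z k. 0 < r \<longrightarrow> r \<le> s \<longrightarrow> s < 1 \<longrightarrow> (\<forall>t e. r \<le> t \<longrightarrow> t \<le> s \<longrightarrow> e \<in> {e1, e2} \<longrightarrow> path_jump (\<beta> \<omega>) e z t \<noteq> 0 \<longrightarrow>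
    t \<in> interface_param (\<beta> \<omega>) ` {x. k - 1 \<le> level x} \<longrightarrow> t \<in> interface_param (\<beta> \<omega>) ` {x. k \<le> level x})"
    by (intro AE_ball_countable[THEN iffD2] AE_all_countable[THEN iffD2] ballI allI countable_rat AE_impI AE_interface_mass_eq)
  with AE_busemann_path show ?thesis
  proof eventually_elim
    case (elim \<omega>)
    then interpret busemann_path "\<beta> \<omega>" "\<lambda>x. w x \<omega>" by blast
    show ?case
    proof (intro allI impI)
      fix y e k assume e: "e \<in> {e1, e2}" "path_jump (\<beta> \<omega>) e y (tau y) \<noteq> 0"
      obtain r s where rs: "r \<in> \<rat>" "s \<in> \<rat>" "0 < r" "r < tau y" "tau y < s" "s < 1"
        using Rats_dense_in_real[OF tau_gt_0[of y]] Rats_dense_in_real[OF tau_less_1[of y]] by blast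
      have "tau y \<in> tau ` {x. level y + int n \<le> level x}" for n
      proof (induction n)
        case (Suc n)
        from elim(2)[rule_format, of r s "tau y" e y "level y + int (Suc n)"] rs e Suc
        show ?case by simp
      qed simp
      from this[of "nat (k - level y)"] obtain x where "tau y = tau x" "level y + int (nat (k - level y)) \<le> level x"
        by auto
      moreover have "k \<le> level y + int (nat (k - level y))" by simp
      ultimately show "\<exists>z. k \<le> level z \<and> tau z = tau y" by (intro exI[of _ x]) auto
    qed
  qed
qed

end

section \<open>Directions without a competition interface\<close>

lemma pred_ball_countable:
  assumes "countable X" "\<And>i. i \<in> X \<Longrightarrow> Measurable.pred N (P i)"
  shows "Measurable.pred N (\<lambda>\<omega>. \<forall>i\<in>X. P i \<omega>)"
  using assms unfolding pred_def by (intro sets.sets_Collect_countable_All') auto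

lemma pred_bex_countable:
  assumes "countable X" "\<And>i. i \<in> X \<Longrightarrow> Measurable.pred N (P i)"
  shows "Measurable.pred N (\<lambda>\<omega>. \<exists>i\<in>X. P i \<omega>)"
  using assms unfolding pred_def by (intro sets.sets_Collect_countable_Ex') auto

lemma lpv_measurable:
  assumes "\<And>p. f p \<in> borel_measurable N"
  shows "(\<lambda>\<omega>. lpv u (\<lambda>p. f p \<omega>) j p) \<in> borel_measurable N"
  using assms by (induction j arbitrary: p) auto

lemma fresh_split_cong:
  assumes "q1 \<le> q2" "\<And>q. q1 \<le> q \<Longrightarrow> q \<le> q2 \<Longrightarrow> \<phi> q = \<phi>' q"
  shows "fresh_split a b \<phi> k p0 q1 q2 m p S \<epsilon> \<longleftrightarrow> fresh_split a b \<phi>' k p0 q1 q2 m p S \<epsilon>"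
proof -
  have 1: "\<phi> q1 = \<phi>' q1" "\<phi> q2 = \<phi>' q2" using assms by auto
  have 2: "\<phi> q = \<phi>' q" if "q \<in> \<rat> \<inter> {q1..q2}" for q using assms that by auto
  show ?thesis unfolding fresh_split_def 1 by (simp only: 2 cong: ball_cong bex_cong)
qed

text \<open>All quantifiers have countable range and only sites of level at least \<open>k\<close>
  enter, so \<open>N\<close> can be the sigma-algebra generated by that half-plane.\<close>

lemma fresh_split_measurable:
  assumes q12: "q1 \<le> q2"
    and \<phi>: "\<And>q x y. q1 \<le> q \<Longrightarrow> q \<le> q2 \<Longrightarrow> k \<le> level x \<Longrightarrow> k \<le> level y \<Longrightarrow> \<phi> q x y \<in> borel_measurable N"
  shows "Measurable.pred N (\<lambda>\<omega>. fresh_split a b (\<lambda>q x y. \<phi> q x y \<omega>) k p0 q1 q2 m p S \<epsilon>)"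
proof -
  have c: "countable (\<rat> \<inter> {q1..q2})" by (intro countable_Int1 countable_rat)
  have st: "\<phi> q (level_site k 0 t) (level_site k 0 t') \<in> borel_measurable N" if "q1 \<le> q" "q \<le> q2" for q t t'
    using that by (intro \<phi>) auto
  note [measurable] = st[OF order_refl q12] st[OF q12 order_refl]
  have [measurable]: "\<phi> q (level_site k 0 t) (level_site k 0 t') \<in> borel_measurable N" if "q \<in> \<rat> \<inter> {q1..q2}" for q t t'
    using that by (intro st) auto
  have z [measurable]: "\<phi> q (z + e1) (z + e2) \<in> borel_measurable N" if "q \<in> \<rat> \<inter> {q1..q2}" "z \<in> {z. k \<le> level z}" for q z
    using that by (intro \<phi>) auto
  note [measurable] = lpv_measurable
  show ?thesis
    unfolding fresh_split_def
    by (intro pred_intros_logic pred_ball_countable pred_bex_countable c countableI_type) measurable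
qed

lemma gen_sigma_measurable:
  fixes F :: "('a \<Rightarrow> real) set"
  assumes "X \<in> F"
  shows "X \<in> borel_measurable (sigma (space M) {X -` S \<inter> space M | X S. X \<in> F \<and> S \<in> sets borel})"
proof (rule measurableI)
  fix A :: "real set" assume "A \<in> sets borel"
  with assms show "X -` A \<inter> space (sigma (space M) {X -` S \<inter> space M | X S. X \<in> F \<and> S \<in> sets borel})
      \<in> sets (sigma (space M) {X -` S \<inter> space M | X S. X \<in> F \<and> S \<in> sets borel})"
    by (subst sets_measure_of) (auto simp: space_measure_of_conv intro!: sigma_sets.Basic)
qed simp

lemma sets_gen_sigma:
  fixes F :: "('a \<Rightarrow> real) set"
  shows "sets (sigma (space M) {X -` S \<inter> space M | X S. X \<in> F \<and> S \<in> sets borel}) = gen_sigma M F"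
  unfolding gen_sigma_def by (rule sets_measure_of) auto

section \<open>Independence against recurrence\<close>

context busemann_process
begin

lemma prob_w_close: "prob {\<omega>. \<bar>w x \<omega> - c\<bar> < \<delta>} = prob {\<omega>. \<bar>w 0 \<omega> - c\<bar> < \<delta>}"
proof -
  have "prob {\<omega>. \<bar>w x \<omega> - c\<bar> < \<delta>} = measure (distr M borel (w x)) {c - \<delta><..<c + \<delta>}" for x
    using w_measurable by (subst measure_distr) (auto intro!: arg_cong[where f = prob])
  then show ?thesis by (simp add: w_ident[of x])
qed

text \<open>The weights below level \<open>k\<close> are independent of everything that \<open>fresh_split\<close> looks at, and
  they are close to the prescribed configuration with positive probability. A split would then
  occur at a direction that is not attained at level at least \<open>k\<close>, contradicting recurrence.\<close>

lemma AE_not_fresh_split: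
  assumes q12: "q1 \<in> \<rat>" "q2 \<in> \<rat>" "0 < q1" "q1 < q2" "q2 < 1" and \<epsilon>: "\<epsilon> > 0"
    and a: "\<And>\<delta>. \<delta> > 0 \<Longrightarrow> prob {\<omega>. \<bar>w 0 \<omega> - a\<bar> < \<delta>} > 0"
    and b: "\<And>\<delta>. \<delta> > 0 \<Longrightarrow> prob {\<omega>. \<bar>w 0 \<omega> - b\<bar> < \<delta>} > 0"
  shows "AE \<omega> in M. \<not> fresh_split a b (\<lambda>q. \<beta> \<omega> q Plus) k p0 q1 q2 m p S \<epsilon>"
proof -
  define I where "I = {x. k \<le> level x}"
  define F1 where "F1 = {w x | x. x \<in> I} \<union>
         {B \<xi> \<sigma> x y | \<xi> \<sigma> x y. \<xi> \<in> ri_dirs \<and> x \<in> I \<and> fst x \<le> fst y \<and> snd x \<le> snd y}"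
  define F2 where "F2 = {w x | x. \<forall>z\<in>I. \<not> (fst z \<le> fst x \<and> snd z \<le> snd x)}"
  have indep: "indep_set (gen_sigma M F1) (gen_sigma M F2)"
    unfolding F1_def F2_def by (rule B_indep)
  define N1 where "N1 = sigma (space M) {X -` S \<inter> space M | X S. X \<in> F1 \<and> S \<in> sets borel}"
  have sets_N1: "sets N1 = gen_sigma M F1" unfolding N1_def by (rule sets_gen_sigma)
  define N2 where "N2 = sigma (space M) {X -` S \<inter> space M | X S. X \<in> F2 \<and> S \<in> sets borel}"
  have sets_N2: "sets N2 = gen_sigma M F2" unfolding N2_def by (rule sets_gen_sigma)
  \<comment> \<open>The independence property covers increments from a site to a larger one. Other
    pairs are reached through their join, and on Busemann paths the detour gives the same value by
    the cocycle property.\<close>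
  define join where "join x y = (max (fst x) (fst y), max (snd x) (snd y))" for x y :: site
  define \<phi> where "\<phi> q x y \<omega> = B (dir_at q) Plus x (join x y) \<omega> - B (dir_at q) Plus y (join x y) \<omega>" for q x y \<omega>
  have \<phi>_N1: "\<phi> q x y \<in> borel_measurable N1" if "q1 \<le> q" "q \<le> q2" "k \<le> level x" "k \<le> level y" for q x y
  proof -
    have "B (dir_at q) Plus x v \<in> F1" if "k \<le> level x" "fst x \<le> fst v" "snd x \<le> snd v" for x v
    proof -
      have "dir_at q \<in> ri_dirs" using \<open>q1 \<le> q\<close> \<open>q \<le> q2\<close> q12 by simp
      then show ?thesis unfolding F1_def I_def using that by blast
    qed
    then have "B (dir_at q) Plus x (join x y) \<in> F1" "B (dir_at q) Plus y (join x y) \<in> F1"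
      using that by (auto simp: join_def)
    then show ?thesis
      unfolding \<phi>_def N1_def by (intro borel_measurable_diff gen_sigma_measurable)
  qed
  define A where "A = {\<omega> \<in> space M. fresh_split a b (\<lambda>q x y. \<phi> q x y \<omega>) k p0 q1 q2 m p S \<epsilon>}"
  have A: "A \<in> gen_sigma M F1"
  proof -
    have "Measurable.pred N1 (\<lambda>\<omega>. fresh_split a b (\<lambda>q x y. \<phi> q x y \<omega>) k p0 q1 q2 m p S \<epsilon>)"
      using q12 by (intro fresh_split_measurable \<phi>_N1) auto
    then have "{\<omega> \<in> space N1. fresh_split a b (\<lambda>q x y. \<phi> q x y \<omega>) k p0 q1 q2 m p S \<epsilon>} \<in> sets N1"
      by (simp add: pred_def)
    moreover have "space N1 = space M" by (simp add: N1_def space_measure_of_conv)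
    ultimately show ?thesis unfolding A_def sets_N1[symmetric] by simp
  qed
  \<comment> \<open>The factor 2 serves the two values compared, and \<open>m + 1\<close> keeps the
    quotient defined when \<open>m = 0\<close>.\<close>
  define \<delta> where "\<delta> = \<epsilon> / (2 * (real m + 1))"
  have \<delta>: "\<delta> > 0" "2 * (real m * \<delta>) \<le> \<epsilon>" using \<epsilon> by (auto simp: \<delta>_def field_simps)
  define J where "J = (\<lambda>(i, t). level_site k (Suc i) t) ` ({..<m} \<times> {p..p + int m + 1})"
  \<comment> \<open>Recovers row index and position from the site, inverting
    \<open>level_site k (Suc i) t\<close>.\<close>
  define c where "c x = config a b S (nat (k - level x - 1)) (fst x)" for x
  define C where "C = {\<omega> \<in> space M. \<forall>x\<in>J. \<bar>w x \<omega> - c x\<bar> < \<delta>}"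
  have finJ: "finite J" by (simp add: J_def)
  have C: "C \<in> gen_sigma M F2"
  proof -
    have w: "w x \<in> borel_measurable N2" if "x \<in> J" for x
    proof -
      have "level x < k" using that by (auto simp: J_def)
      then have "\<forall>z\<in>I. \<not> (fst z \<le> fst x \<and> snd z \<le> snd x)" by (auto simp: I_def level_def)
      then have "w x \<in> F2" unfolding F2_def by blast
      then show ?thesis unfolding N2_def by (rule gen_sigma_measurable)
    qed
    have "Measurable.pred N2 (\<lambda>\<omega>. \<forall>x\<in>J. \<bar>w x \<omega> - c x\<bar> < \<delta>)"
    proof (rule pred_ball_countable[OF countable_finite[OF finJ]])
      fix x assume "x \<in> J"
      note [measurable] = w[OF this]
      show "Measurable.pred N2 (\<lambda>\<omega>. \<bar>w x \<omega> - c x\<bar> < \<delta>)" by measurable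
    qed
    then have "{\<omega> \<in> space N2. \<forall>x\<in>J. \<bar>w x \<omega> - c x\<bar> < \<delta>} \<in> sets N2"
      by (simp add: pred_def)
    moreover have "space N2 = space M" by (simp add: N2_def space_measure_of_conv)
    ultimately show ?thesis unfolding C_def sets_N2[symmetric] by simp
  qed
  have C_pos: "prob C > 0"
  \<comment> \<open>For \<open>m = 0\<close> no weight is prescribed, while the product formula
    needs a nonempty index set.\<close>
  proof (cases "J = {}")
    case True
    then show ?thesis using prob_space by (simp add: C_def)
  next
    case False
    have "C = (\<Inter>x\<in>J. w x -` {c x - \<delta><..<c x + \<delta>} \<inter> space M)"
      using False by (auto simp: C_def abs_less_iff)
    also have "prob \<dots> = (\<Prod>x\<in>J. prob (w x -` {c x - \<delta><..<c x + \<delta>} \<inter> space M))"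
      using False finJ by (intro indep_varsD[OF w_indep]) auto
    also have "\<dots> = (\<Prod>x\<in>J. prob {\<omega>. \<bar>w 0 \<omega> - c x\<bar> < \<delta>})"
    proof (rule prod.cong[OF refl])
      fix x
      have "w x -` {c x - \<delta><..<c x + \<delta>} \<inter> space M = {\<omega>. \<bar>w x \<omega> - c x\<bar> < \<delta>}" by auto
      then show "prob (w x -` {c x - \<delta><..<c x + \<delta>} \<inter> space M) = prob {\<omega>. \<bar>w 0 \<omega> - c x\<bar> < \<delta>}"
        by (simp add: prob_w_close[of x])
    qed
    also have "\<dots> > 0"
      using a[OF \<delta>(1)] b[OF \<delta>(1)] by (intro prod_pos) (auto simp: c_def config_def)
    finally show ?thesis .
  qed
  have path_eq: "fresh_split a b (\<lambda>q x y. \<phi> q x y \<omega>) k p0 q1 q2 m p S \<epsilon> \<longleftrightarrow>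
      fresh_split a b (\<lambda>q. \<beta> \<omega> q Plus) k p0 q1 q2 m p S \<epsilon>" if "busemann_path (\<beta> \<omega>) (\<lambda>x. w x \<omega>)" for \<omega>
  proof (rule fresh_split_cong)
    interpret busemann_path "\<beta> \<omega>" "\<lambda>x. w x \<omega>" by (rule that)
    fix q assume "q1 \<le> q" "q \<le> q2"
    then show "(\<lambda>x y. \<phi> q x y \<omega>) = \<beta> \<omega> q Plus"
      using q12 cocycle[of q Plus] by (auto simp: fun_eq_iff \<phi>_def directed_path_def algebra_simps)
  qed (use q12 in simp)
  have "AE \<omega> in M. \<omega> \<notin> A \<inter> C"
    using AE_busemann_path AE_recurrence
  proof eventually_elim
    case (elim \<omega>)
    then interpret busemann_path "\<beta> \<omega>" "\<lambda>x. w x \<omega>" by blast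
    show ?case
    proof
      assume "\<omega> \<in> A \<inter> C"
      then have fs: "fresh_split a b (\<lambda>q. \<beta> \<omega> q Plus) k p0 q1 q2 m p S \<epsilon>"
        and cl: "\<And>x. x \<in> J \<Longrightarrow> \<bar>w x \<omega> - c x\<bar> < \<delta>"
        using path_eq[OF busemann_path_axioms] by (auto simp: A_def C_def)
      define y where "y = level_site k (Suc m) p"
      have W: "\<bar>w (level_site k (Suc i) t) \<omega> - config a b S i t\<bar> \<le> \<delta>" if "i < m" "p \<le> t" "t \<le> p + int m + 1" for i t
      proof -
        have "level_site k (Suc i) t \<in> J" using that by (force simp: J_def)
        moreover have "c (level_site k (Suc i) t) = config a b S i t" by (simp add: c_def level_site_def level_def)
        ultimately show ?thesis using cl[of "level_site k (Suc i) t"] by simp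
      qed
      note fst = fresh_split_tau[OF fs q12 W \<delta>(2) y_def]
      have t: "0 < tau y" "tau y < 1" by (auto intro: tau_gt_0 tau_less_1)
      have "path_jump (\<beta> \<omega>) e1 y (tau y) \<noteq> 0 \<or> path_jump (\<beta> \<omega>) e2 y (tau y) \<noteq> 0"
        using fst(4) path_diag[OF t, of Minus y] path_diag[OF t, of Plus y] by (auto simp: path_jump_def)
      then obtain z where "k \<le> level z" "tau z = tau y"
        using elim(2) by blast
      with fst(1) show False by blast
    qed
  qed
  moreover have ev: "A \<in> events" "C \<in> events"
    using A C indep_setD_ev1[OF indep] indep_setD_ev2[OF indep] by auto
  ultimately have "prob (A \<inter> C) = 0" by (subst prob_eq_0) auto
  then have "prob A = 0" using indep_setD[OF indep A C] C_pos by simp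
  then have "AE \<omega> in M. \<omega> \<notin> A" using ev by (simp add: prob_eq_0)
  with AE_busemann_path show ?thesis
    by eventually_elim (auto simp: A_def path_eq)
qed

end

section \<open>Assembly on one almost sure event\<close>

theorem theorem3p7:
  fixes M :: "'a::polish_space measure"
    and T :: "site \<Rightarrow> 'a \<Rightarrow> 'a"
    and w :: "site \<Rightarrow> 'a \<Rightarrow> real"
    and g :: "dir \<Rightarrow> real"
    and B :: "dir \<Rightarrow> sign \<Rightarrow> site \<Rightarrow> site \<Rightarrow> 'a \<Rightarrow> real"
  assumes "busemann_process M T w g B"
  shows "AE \<omega> in M.
     (\<forall>x. supp_mu B x (x + e1) \<omega> \<inter> supp_mu B x (x + e2) \<omega> = {xi_star B (T x \<omega>)}) \<and>
     {xi_star B (T x \<omega>) | x. True} \<subseteq> exceptional_dirs B \<omega> \<and>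
     (jump_process_condition M B \<longrightarrow>
        exceptional_dirs B \<omega> = {xi_star B (T x \<omega>) | x. True})"
proof -
  interpret busemann_process M T w g B by (rule assms)
  obtain a b :: "nat \<Rightarrow> real" where ab:
    "\<And>n \<delta>. \<delta> > 0 \<Longrightarrow> prob {\<omega>. \<bar>w 0 \<omega> - a n\<bar> < \<delta>} > 0"
    "\<And>n \<delta>. \<delta> > 0 \<Longrightarrow> prob {\<omega>. \<bar>w 0 \<omega> - b n\<bar> < \<delta>} > 0"
    "\<And>\<eta>. \<eta> > 0 \<Longrightarrow> \<exists>n. a n < b n \<and> b n - a n < \<eta>"
    by (rule ex_support_pairs) blast
  \<comment> \<open>Finite sets are written as \<open>set xs\<close>: lists are countable, so one
    almost sure event serves all parameters.\<close>
  have no_split: "AE \<omega> in M. \<forall>q1\<in>\<rat>. \<forall>q2\<in>\<rat>. \<forall>k p0 m p (xs :: (nat \<times> int) list) N n.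
      0 < q1 \<longrightarrow> q1 < q2 \<longrightarrow> q2 < 1 \<longrightarrow>
      \<not> fresh_split (a n) (b n) (\<lambda>q. \<beta> \<omega> q Plus) k p0 q1 q2 m p (set xs) (1 / real (Suc N))"
    by (intro AE_ball_countable[THEN iffD2] AE_all_countable[THEN iffD2] ballI allI countable_rat AE_impI
        AE_not_fresh_split ab) auto
  have jump: "AE \<omega> in M. jump_process_condition M B \<longrightarrow> (\<forall>x y. \<forall>\<xi>\<in>supp_mu B x y \<omega>. \<xi> isolated_in supp_mu B x y \<omega>)"
  proof (cases "jump_process_condition M B")
    case True
    then obtain \<Omega>1 where "\<Omega>1 \<in> events" "prob \<Omega>1 = 1"
      "\<And>\<omega>. \<omega> \<in> \<Omega>1 \<Longrightarrow> \<forall>x y. \<forall>\<xi>\<in>supp_mu B x y \<omega>. \<xi> isolated_in supp_mu B x y \<omega>"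
      unfolding jump_process_condition_def by blast
    then show ?thesis using AE_in_set_eq_1[of \<Omega>1] by (auto elim!: eventually_mono)
  qed simp
  from AE_busemann_path AE_sublinear no_split jump show ?thesis
  proof eventually_elim
    case (elim \<omega>)
    then interpret busemann_path "\<beta> \<omega>" "\<lambda>x. w x \<omega>" by blast
    have supp: "supp_mu B x y \<omega> = dir_at ` {t. 0 < t \<and> t < 1 \<and> \<not> flat t x y}" for x y
      by (rule supp_mu_eq) (simp add: directed_path_def)
    have xi: "xi_star B (T x \<omega>) = dir_at (tau x)" for x
    proof (rule xi_star_eq)
      fix t :: real and \<sigma> assume "0 < t" "t < 1"
      then have "\<beta> \<omega> t \<sigma> (e1 + x) (e2 + x) = \<beta> (T x \<omega>) t \<sigma> e1 e2" using elim(1) by blast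
      then show "B (dir_at t) \<sigma> e1 e2 (T x \<omega>) = \<beta> \<omega> t \<sigma> (x + e1) (x + e2)"
        by (simp add: directed_path_def add.commute)
    qed
    have a: "supp_mu B x (x + e1) \<omega> \<inter> supp_mu B x (x + e2) \<omega> = {xi_star B (T x \<omega>)}" for x
    proof -
      have "{t. 0 < t \<and> t < 1 \<and> \<not> flat t x (x + e1)} \<inter> {t. 0 < t \<and> t < 1 \<and> \<not> flat t x (x + e2)} = {tau x}"
        using not_flat_e1_e2_iff[of _ x] tau_gt_0[of x] tau_less_1[of x] by auto
      moreover have "inj dir_at" by (rule injI) simp
      ultimately show ?thesis unfolding supp xi by (simp flip: image_Int)
    qed
    then have sub: "{xi_star B (T x \<omega>) | x. True} \<subseteq> exceptional_dirs B \<omega>"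
      unfolding exceptional_dirs_def by blast
    have "exceptional_dirs B \<omega> \<subseteq> {xi_star B (T x \<omega>) | x. True}" if "jump_process_condition M B"
    proof
      fix \<xi> assume "\<xi> \<in> exceptional_dirs B \<omega>"
      then obtain x y t where t: "\<xi> = dir_at t" "0 < t" "t < 1" "\<not> flat t x y"
        unfolding exceptional_dirs_def supp by auto
      \<comment> \<open>Flatness near \<open>t\<close>, except perhaps at \<open>t\<close>, for
        every pair of sites: flatness is an open condition, and where it fails at \<open>t\<close>
        the jump condition makes \<open>t\<close> an isolated point of the support.\<close>
      have iso: "\<exists>e>0. \<forall>s. 0 < \<bar>s - t\<bar> \<longrightarrow> \<bar>s - t\<bar> < e \<longrightarrow> 0 < s \<longrightarrow> s < 1 \<longrightarrow> flat s x' y'" for x' y'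
      proof (cases "flat t x' y'")
        case True
        then show ?thesis using flat_nearby by blast
      next
        case False
        then have "dir_at t \<in> supp_mu B x' y' \<omega>" using t by (auto simp: supp)
        then have "dir_at t isolated_in supp_mu B x' y' \<omega>" using elim(4) that by blast
        then obtain U where U: "open U" "U \<inter> supp_mu B x' y' \<omega> = {dir_at t}"
          by (auto simp: isolated_in_def)
        have "open (dir_at -` U)" using U(1) by (intro open_vimage continuous_dir_at)
        moreover have "t \<in> dir_at -` U" using U(2) by auto
        ultimately obtain e where e: "e > 0" "\<And>s. dist s t < e \<Longrightarrow> dir_at s \<in> U"
          unfolding open_dist by (metis vimageE)
        have "flat s x' y'" if s: "0 < \<bar>s - t\<bar>" "\<bar>s - t\<bar> < e" "0 < s" "s < 1" for s
        proof (rule ccontr)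
          assume "\<not> flat s x' y'"
          then have "dir_at s \<in> U \<inter> supp_mu B x' y' \<omega>" using s e(2)[of s] by (auto simp: supp dist_real_def)
          with U(2) s show False by auto
        qed
        with e(1) show ?thesis by blast
      qed
      have "\<exists>z. t = tau z"
      proof (rule ccontr)
        assume "\<nexists>z. t = tau z"
        then have "\<exists>k p0 m p S N n. \<exists>q1\<in>\<rat>. \<exists>q2\<in>\<rat>. 0 < q1 \<and> q1 < q2 \<and> q2 < 1 \<and> finite S \<and>
          fresh_split (a n) (b n) (\<lambda>q. \<beta> \<omega> q Plus) k p0 q1 q2 m p S (1 / real (Suc N))"
          using t elim(2) ab(3) iso by (intro ex_fresh_split[where t = t]) blast+
        then show False using elim(3) finite_list by metis
      qed
      then show "\<xi> \<in> {xi_star B (T x \<omega>) | x. True}" using t(1) xi by auto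
    qed
    with a sub show ?case by blast
  qed
qed

end
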